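(* Let $n\in\mathbb{N}$, $m\in\mathbb{N}_0$ and $-1<a<m$. Suppose that $f\in\dot B^{m-a,1}(\mathbb{R}^n)$ and let $$u(x,t):=(W_t*f)(x)=\int_{\mathbb{R}^n}W_t(x-y)f(y)\,dy,\qquad W_t(x):=\frac{\exp(-|x|^2/(4t^2))}{(4\pi t^2)^{n/2}},\qquad (x,t)\in\mathbb{R}^n\times(0,\infty).$$ Then $$\int_{\mathbb{R}^{n+1}_+}t^a|\nabla^{m+1}u(x,t)|\,dt\,dx\le C\,|f|_{B^{m-a,1}(\mathbb{R}^n)},$$ where $C>0$ is a constant depending only on $n,m,a$ (not on $f$).
   Context: $\mathbb{N}_0=\{0,1,2,\dots\}$, $\mathbb{N}=\{1,2,\dots\}$, $\mathbb{R}^{n+1}_+=\mathbb{R}^n\times(0,\infty)$ with points $(x,t)$. $\nabla^{k}u$ is the tensor of all partial derivatives of order $k$ of $u$ jointly in $(x,t)$. Differences: $\Delta_hf(x)=f(x+h)-f(x)$, $\Delta_h^{k+1}f=\Delta_h^k(\Delta_hf)$. Homogeneous Besov spaces, for $1\le p<\infty$ (used here with $p=1$). For $0<s\le1$, $\dot B^{s,p}(\mathbb{R}^n)$ is the set of $f\in L^p_{\mathrm{loc}}(\mathbb{R}^n)$ with $$|f|_{B^{s,p}(\mathbb{R}^n)}:=\Big(\int_{\mathbb{R}^n}\|\Delta_h^{\lfloor s\rfloor+1}f\|_{L^p(\mathbb{R}^n)}^p\frac{dh}{|h|^{n+sp}}\Big)^{1/p}<\infty$$ (so first differences are used if $0<s<1$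 and second differences if $s=1$). For $s>1$ let $\ell=\max\{j\in\mathbb{N}: j<s\}$; $\dot B^{s,p}(\mathbb{R}^n)$ is the set of $f\in W^{\ell,p}_{\mathrm{loc}}(\mathbb{R}^n)$ such that $\frac{\partial^\alpha f}{\partial x^\alpha}\in\dot B^{s-\ell,p}(\mathbb{R}^n)$ for all multi-indices $\alpha\in\mathbb{N}_0^n$ with $|\alpha|=\ell$, with seminorm $|f|_{B^{s,p}(\mathbb{R}^n)}:=\sum_{|\alpha|=\ell}\big|\frac{\partial^\alpha f}{\partial x^\alpha}\big|_{B^{s-\ell,p}(\mathbb{R}^n)}$. *)

theory Defs
  imports "HOL-Analysis.Analysis"
begin

section \<open>Iterated partial derivatives\<close>

definition partial :: "'a::euclidean_space \<Rightarrow> ('a \<Rightarrow> real) \<Rightarrow> 'a \<Rightarrow> real" where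
  "partial b f x = deriv (\<lambda>r. f (x + r *\<^sub>R b)) 0"

abbreviation partials :: "'a::euclidean_space list \<Rightarrow> ('a \<Rightarrow> real) \<Rightarrow> 'a \<Rightarrow> real" where
  "partials bs f \<equiv> foldr partial bs f"

text \<open>The Euclidean norm of the tensor \<open>\<nabla>\<^sup>k u\<close>, whose entries are indexed by all ordered
  \<open>k\<close>-tuples of coordinate directions.\<close>

definition nabla_norm :: "nat \<Rightarrow> ('a::euclidean_space \<Rightarrow> real) \<Rightarrow> 'a \<Rightarrow> real" where
  "nabla_norm k u z = sqrt (\<Sum>bs | set bs \<subseteq> Basis \<and> length bs = k. (partials bs u z)\<^sup>2)"

text \<open>\<open>C\<^sup>\<infinity>\<close> functions: differentiability of all iterated partial derivatives also gives
  their continuity, so no separate continuity requirement is needed, and \<open>deriv\<close>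
  always denotes a genuine derivative here.\<close>

definition smooth :: "('a::euclidean_space \<Rightarrow> real) \<Rightarrow> bool" where
  "smooth f \<longleftrightarrow> (\<forall>bs \<in> lists Basis. partials bs f differentiable_on UNIV)"

definition test_fun :: "('a::euclidean_space \<Rightarrow> real) \<Rightarrow> bool" where
  "test_fun \<phi> \<longleftrightarrow> smooth \<phi> \<and> compact (closure {x. \<phi> x \<noteq> 0})"


section \<open>Local Lebesgue and Sobolev spaces, weak derivatives\<close>

definition Lp_loc :: "real \<Rightarrow> ('a::euclidean_space \<Rightarrow> real) set" where
  "Lp_loc p = {f \<in> borel_measurable lebesgue.
     \<forall>K. compact K \<longrightarrow> (\<integral>\<^sup>+x\<in>K. ennreal (\<bar>f x\<bar> powr p) \<partial>lebesgue) < \<infinity>}"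

text \<open>Multi-indices are functions \<open>'n \<Rightarrow> nat\<close>. The classical derivative \<open>\<partial>\<^sup>\<alpha> \<phi>\<close> of a smooth \<open>\<phi>\<close>
  is \<open>partials (map (\<lambda>i. axis i 1) js) \<phi>\<close> for any list \<open>js\<close> of coordinates in which each \<open>i\<close>
  occurs \<open>\<alpha> i\<close> times; the order of differentiation does not matter.\<close>

definition is_weak_deriv ::
    "('n::finite \<Rightarrow> nat) \<Rightarrow> (real^'n \<Rightarrow> real) \<Rightarrow> (real^'n \<Rightarrow> real) \<Rightarrow> bool" where
  "is_weak_deriv \<alpha> f g \<longleftrightarrow>
     (\<forall>\<phi> js. test_fun \<phi> \<and> count_list js = \<alpha> \<longrightarrow>
        (LINT x|lebesgue. f x * partials (map (\<lambda>i. axis i 1) js) \<phi> x) =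
        (-1) ^ (\<Sum>i\<in>UNIV. \<alpha> i) * (LINT x|lebesgue. g x * \<phi> x))"

text \<open>The weak derivative is determined up to a null set, which is invisible to
  everything below; one representative is chosen.\<close>

definition weak_deriv :: "('n::finite \<Rightarrow> nat) \<Rightarrow> (real^'n \<Rightarrow> real) \<Rightarrow> real^'n \<Rightarrow> real" where
  "weak_deriv \<alpha> f = (SOME g. g \<in> Lp_loc 1 \<and> is_weak_deriv \<alpha> f g)"

definition Wkp_loc :: "nat \<Rightarrow> real \<Rightarrow> (real^'n \<Rightarrow> real) set" where
  "Wkp_loc k p = {f \<in> Lp_loc p.
     \<forall>\<alpha>. (\<Sum>i\<in>UNIV. \<alpha> i) \<le> k \<longrightarrow> (\<exists>g \<in> Lp_loc p. is_weak_deriv \<alpha> f g)}"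


section \<open>Homogeneous Besov spaces\<close>

text \<open>\<open>x\<^sup>r\<close> on \<open>[0,\<infinity>]\<close>, intended for exponents \<open>r > 0\<close>.\<close>

definition ennpowr :: "ennreal \<Rightarrow> real \<Rightarrow> ennreal" where
  "ennpowr x r = (if x = \<infinity> then \<infinity> else ennreal (enn2real x powr r))"

definition Lp_norm :: "real \<Rightarrow> ('a::euclidean_space \<Rightarrow> real) \<Rightarrow> ennreal" where
  "Lp_norm p f = ennpowr (\<integral>\<^sup>+x. ennreal (\<bar>f x\<bar> powr p) \<partial>lebesgue) (1 / p)"

primrec fdiff :: "nat \<Rightarrow> 'a::real_vector \<Rightarrow> ('a \<Rightarrow> real) \<Rightarrow> 'a \<Rightarrow> real" where
  "fdiff 0 h f = f"
| "fdiff (Suc k) h f = fdiff k h (\<lambda>x. f (x + h) - f x)"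

text \<open>The case \<open>0 < s \<le> 1\<close>. The value of the integrand at \<open>h = 0\<close> is irrelevant.\<close>

definition besov_seminorm_le1 :: "real \<Rightarrow> real \<Rightarrow> (real^'n \<Rightarrow> real) \<Rightarrow> ennreal" where
  "besov_seminorm_le1 s p f =
     ennpowr (\<integral>\<^sup>+h. ennpowr (Lp_norm p (fdiff (nat \<lfloor>s\<rfloor> + 1) h f)) p
                     / ennreal (norm h powr (real CARD('n) + s * p)) \<partial>lebesgue) (1 / p)"

definition besov_le1 :: "real \<Rightarrow> real \<Rightarrow> (real^'n \<Rightarrow> real) set" where
  "besov_le1 s p = {f \<in> Lp_loc p. besov_seminorm_le1 s p f < \<infinity>}"

definition besov_ell :: "real \<Rightarrow> nat" where
  "besov_ell s = Max {j. 1 \<le> j \<and> real j < s}"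

text \<open>The general case, for \<open>s > 0\<close> and \<open>1 \<le> p < \<infinity>\<close>.\<close>

definition besov_seminorm :: "real \<Rightarrow> real \<Rightarrow> (real^'n \<Rightarrow> real) \<Rightarrow> ennreal" where
  "besov_seminorm s p f =
     (if s \<le> 1 then besov_seminorm_le1 s p f
      else \<Sum>\<alpha> | (\<Sum>i\<in>UNIV. \<alpha> i) = besov_ell s.
             besov_seminorm_le1 (s - real (besov_ell s)) p (weak_deriv \<alpha> f))"

definition besov :: "real \<Rightarrow> real \<Rightarrow> (real^'n \<Rightarrow> real) set" where
  "besov s p =
     (if s \<le> 1 then besov_le1 s p
      else {f \<in> Wkp_loc (besov_ell s) p.
              \<forall>\<alpha>. (\<Sum>i\<in>UNIV. \<alpha> i) = besov_ell s \<longrightarrow>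
                  weak_deriv \<alpha> f \<in> besov_le1 (s - real (besov_ell s)) p})"


section \<open>The Gaussian extension to the half-space\<close>

definition gauss_kernel :: "real \<Rightarrow> real^'n \<Rightarrow> real" where
  "gauss_kernel t x =
     exp (- (norm x)\<^sup>2 / (4 * t\<^sup>2)) / (4 * pi * t\<^sup>2) powr (real CARD('n) / 2)"

text \<open>Only the values at points \<open>(x, t)\<close> with \<open>t > 0\<close> are meaningful.\<close>

definition gauss_ext :: "(real^'n \<Rightarrow> real) \<Rightarrow> (real^'n) \<times> real \<Rightarrow> real" where
  "gauss_ext f = (\<lambda>(x, t). LINT y|lebesgue. gauss_kernel t (x - y) * f y)"

end

theory Submission
  imports Defs "HOL-Probability.Distributions"
begin

text \<open>Every derivative of order \<open>m + 1\<close> in \<open>(x, t)\<close> of the extension \<open>u = W\<^sub>t * f\<close> is a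
  combination of \<open>t\<^bsup>|\<gamma>| - m - 1\<^esup> (\<partial>\<^sup>\<gamma> W\<^sub>t * f)\<close> with \<open>|\<gamma>| \<ge> m + 1\<close>, because \<open>u\<close> solves a rescaled heat
  equation. With \<open>m - a = l + \<sigma>\<close> and \<open>0 < \<sigma> \<le> 1\<close>, \<open>l\<close> of the derivatives are moved onto \<open>f\<close>, and at
  least one (two if \<open>\<sigma> = 1\<close>) remains on the kernel. For \<open>\<sigma> < 1\<close> the remaining kernel has mean zero, so
  \<open>\<parallel>\<partial>\<^sup>\<beta> W\<^sub>t * g\<parallel>\<^sub>1\<close> is bounded by a Gaussian average of \<open>\<parallel>\<Delta>\<^sub>h g\<parallel>\<^sub>1\<close>; for \<open>\<sigma> = 1\<close> the semigroup property splits
  off an even kernel of order two, which pairs with second differences. Integrating the Gaussian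
  against the power of \<open>t\<close> gives exactly the weight \<open>|h|\<^bsup>- n - \<sigma>\<^esup>\<close> of the seminorm.

  That the convolution converges at all needs an argument: a finite Besov seminorm makes \<open>\<partial>\<^sup>\<alpha> f\<close> for
  \<open>|\<alpha>| = l\<close> integrable against every Gaussian, and by a duality argument with tensor product test
  functions this property passes from the weak derivatives to \<open>f\<close>.\<close>

text \<open>Membership in the Besov space says nothing directly about growth: \<open>f\<close> is
  only locally integrable, and the seminorm sees differences of top-order derivatives only. The
  analysis therefore runs inside the class \<open>gauss_integrable\<close>, where every
  \<open>heat_conv\<close> converges and can be differentiated under the integral; membership in it
  is a separate problem. Tensor products suit as test functions because the Gauss kernel itself is a
  product over the coordinates: derivatives, antiderivatives in one direction and cutoffs act on
  one-dimensional factors, and polynomial multiples remain finite sums of products, so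
  Stone-Weierstrass can approximate the sign of \<open>f\<close>. A derivative in \<open>t\<close>
  costs two derivatives in \<open>x\<close> but gains a factor \<open>t\<close>, so all terms share
  one scaling and produce the same weight in \<open>h\<close>. The condition \<open>-1 < a\<close>
  enters through a count of derivatives: it leaves one on the kernel, and two in the case of second
  differences. Integrals are computed for Borel representatives over \<open>lborel\<close>, where
  Fubini and translations are available; a.e. equality carries the result back to
  \<open>lebesgue\<close>.\<close>

section \<open>Differentiation under the integral sign\<close>

text \<open>The mean value inequality on the interval of radius \<open>\<delta>\<close> turns the
  bound \<open>G\<close> on the derivative into a bound on the difference quotients, so dominated
  convergence applies along every null sequence.\<close>

lemma has_real_derivative_lebesgue_integral:
  fixes F F' :: "real \<Rightarrow> 'a \<Rightarrow> real"
  assumes "\<delta> > 0"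
    and int: "\<And>r. \<bar>r - r0\<bar> < \<delta> \<Longrightarrow> integrable M (F r)"
    and der: "\<And>r y. \<bar>r - r0\<bar> < \<delta> \<Longrightarrow> y \<in> space M \<Longrightarrow> ((\<lambda>r. F r y) has_real_derivative F' r y) (at r)"
    and bnd: "\<And>r y. \<bar>r - r0\<bar> < \<delta> \<Longrightarrow> y \<in> space M \<Longrightarrow> \<bar>F' r y\<bar> \<le> G y"
    and G: "integrable M G"
    and meas: "F' r0 \<in> borel_measurable M"
  shows "((\<lambda>r. LINT y|M. F r y) has_real_derivative (LINT y|M. F' r0 y)) (at r0)"
proof -
  have "((\<lambda>h. ((LINT y|M. F (r0 + h) y) - (LINT y|M. F r0 y)) / h) \<longlongrightarrow> (LINT y|M. F' r0 y)) (at 0)"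
  proof (rule Lim_transform_eventually)
    have ev: "\<forall>\<^sub>F h in at (0::real). \<bar>h\<bar> < \<delta> \<and> h \<noteq> 0"
      unfolding eventually_at using \<open>\<delta> > 0\<close> by (intro exI[of _ \<delta>]) auto
    show "\<forall>\<^sub>F h in at 0. (LINT y|M. (F (r0 + h) y - F r0 y) / h) =
        ((LINT y|M. F (r0 + h) y) - (LINT y|M. F r0 y)) / h"
      using ev
    proof eventually_elim
      case (elim h)
      have "integrable M (F (r0+h))" "integrable M (F r0)"
        using elim \<open>\<delta> > 0\<close> by (auto intro!: int)
      then show ?case by simp
    qed
    show "((\<lambda>h. LINT y|M. (F (r0 + h) y - F r0 y) / h) \<longlongrightarrow> (LINT y|M. F' r0 y)) (at 0)"
      unfolding tendsto_at_iff_sequentially comp_def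
    proof (intro allI impI)
      fix X :: "nat \<Rightarrow> real"
      assume X: "\<forall>i. X i \<in> UNIV - {0}" "X \<longlonglongrightarrow> 0"
      from X(2) \<open>\<delta> > 0\<close> have "\<forall>\<^sub>F i in sequentially. \<bar>X i\<bar> < \<delta>"
        by (auto simp: tendsto_iff dist_real_def)
      then obtain N where N: "\<And>i. i \<ge> N \<Longrightarrow> \<bar>X i\<bar> < \<delta>"
        unfolding eventually_sequentially by blast
      have "(\<lambda>i. LINT y|M. (F (r0 + X (i + N)) y - F r0 y) / X (i + N)) \<longlonglongrightarrow> (LINT y|M. F' r0 y)"
      proof (rule integral_dominated_convergence[where w = G])
        show "(\<lambda>y. (F (r0 + X (i + N)) y - F r0 y) / X (i + N)) \<in> borel_measurable M" for i
          using int[of "r0 + X (i+N)"] int[of r0] N[of "i+N"] \<open>\<delta> > 0\<close> by auto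
        show "AE y in M. (\<lambda>i. (F (r0 + X (i + N)) y - F r0 y) / X (i + N)) \<longlonglongrightarrow> F' r0 y"
        proof (rule AE_I2)
          fix y assume y: "y \<in> space M"
          have "((\<lambda>h. (F (r0 + h) y - F r0 y) / h) \<longlongrightarrow> F' r0 y) (at 0)"
            using der[of r0 y] y \<open>\<delta> > 0\<close> by (simp add: DERIV_def)
          then have "(\<lambda>i. (F (r0 + X i) y - F r0 y) / X i) \<longlonglongrightarrow> F' r0 y"
            using X unfolding tendsto_at_iff_sequentially comp_def by blast
          then show "(\<lambda>i. (F (r0 + X (i + N)) y - F r0 y) / X (i + N)) \<longlonglongrightarrow> F' r0 y"
            by (rule LIMSEQ_ignore_initial_segment)
        qed
        show "AE y in M. norm ((F (r0 + X (i + N)) y - F r0 y) / X (i + N)) \<le> G y" for i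
        proof (rule AE_I2)
          fix y assume y: "y \<in> space M"
          let ?S = "{r0 - \<delta><..<r0 + \<delta>}"
          have "norm (F (r0 + X (i + N)) y - F r0 y) \<le> G y * norm (r0 + X (i + N) - r0)"
          proof (rule field_differentiable_bound[where S = ?S and f' = "\<lambda>r. F' r y"])
            show "((\<lambda>r. F r y) has_field_derivative F' z y) (at z within ?S)" if "z \<in> ?S" for z
              using that by (intro has_field_derivative_at_within[OF der] y) auto
            show "norm (F' z y) \<le> G y" if "z \<in> ?S" for z
              using that bnd[of z y] y by auto
          qed (use N[of "i+N"] \<open>\<delta> > 0\<close> in auto)
          then show "norm ((F (r0 + X (i + N)) y - F r0 y) / X (i + N)) \<le> G y"
            using X(1) by (simp add: divide_simps abs_mult)
        qed
      qed (use meas G in auto)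
      then show "(\<lambda>i. LINT y|M. (F (r0 + X i) y - F r0 y) / X i) \<longlonglongrightarrow> (LINT y|M. F' r0 y)"
        by (rule LIMSEQ_offset)
    qed
  qed
  then show ?thesis by (simp add: DERIV_def)
qed

section \<open>Derivatives of the Gauss kernel\<close>

text \<open>\<open>gauss_hermite k\<close> is the \<open>k\<close>-th derivative of \<open>exp (- v\<^sup>2 / 4) / sqrt (4 * pi)\<close>, defined by the
  Hermite recurrence.\<close>

fun gauss_hermite :: "nat \<Rightarrow> real \<Rightarrow> real" where
  "gauss_hermite 0 v = exp (- v\<^sup>2 / 4) / sqrt (4 * pi)"
| "gauss_hermite (Suc 0) v = - (v / 2) * gauss_hermite 0 v"
| "gauss_hermite (Suc (Suc k)) v = - (v * gauss_hermite (Suc k) v + real (Suc k) * gauss_hermite k v) / 2"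

lemma gauss_hermite_deriv: "(gauss_hermite k has_real_derivative gauss_hermite (Suc k) v) (at v)"
proof -
  have base0: "(gauss_hermite 0 has_real_derivative gauss_hermite (Suc 0) v) (at v)" for v
  proof -
    have "((\<lambda>v. exp (- v\<^sup>2 / 4) / sqrt (4 * pi)) has_real_derivative - (v / 2) * (exp (- v\<^sup>2 / 4) / sqrt (4 * pi))) (at v)"
      by (rule derivative_eq_intros refl | simp)+ (simp add: divide_simps power2_eq_square)
    then show ?thesis by (simp add: gauss_hermite.simps(1)[abs_def])
  qed
  have base1: "(gauss_hermite (Suc 0) has_real_derivative gauss_hermite (Suc (Suc 0)) v) (at v)" for v
  proof -
    have "((\<lambda>v. - (v / 2) * gauss_hermite 0 v) has_real_derivative (- (1/2)) * gauss_hermite 0 v + gauss_hermite (Suc 0) v * (- (v / 2))) (at v)"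
      by (rule DERIV_mult[OF _ base0]) (auto intro!: derivative_eq_intros)
    also have "(- (1/2)) * gauss_hermite 0 v + gauss_hermite (Suc 0) v * (- (v / 2)) = gauss_hermite (Suc (Suc 0)) v"
      by (simp add: field_simps)
    finally show ?thesis by (simp add: gauss_hermite.simps(2)[abs_def])
  qed
  \<comment> \<open>The recurrence reaches back two steps, so the induction carries two consecutive
    orders. Differentiating the recurrence for \<open>k + 2\<close> yields one extra copy of
    \<open>gauss_hermite (Suc k)\<close>, which is exactly the increase of the coefficient in the
    recurrence for \<open>k + 3\<close>.\<close>
  have "(gauss_hermite k has_real_derivative gauss_hermite (Suc k) v) (at v) \<and>
      (gauss_hermite (Suc k) has_real_derivative gauss_hermite (Suc (Suc k)) v) (at v)" for v
  proof (induction k)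
    case 0
    show ?case using base0 base1 by blast
  next
    case (Suc k)
    then have k: "(gauss_hermite k has_real_derivative gauss_hermite (Suc k) v) (at v)"
      and Sk: "(gauss_hermite (Suc k) has_real_derivative gauss_hermite (Suc (Suc k)) v) (at v)" by auto
    have "((\<lambda>v. - (v * gauss_hermite (Suc k) v + real (Suc k) * gauss_hermite k v) / 2) has_real_derivative
        - ((1 * gauss_hermite (Suc k) v + gauss_hermite (Suc (Suc k)) v * v) + real (Suc k) * gauss_hermite (Suc k) v) / 2) (at v)"
      by (intro DERIV_cdivide DERIV_minus DERIV_add DERIV_mult[OF DERIV_ident Sk] DERIV_cmult k)
    also have "- ((1 * gauss_hermite (Suc k) v + gauss_hermite (Suc (Suc k)) v * v) + real (Suc k) * gauss_hermite (Suc k) v) / 2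
       = gauss_hermite (Suc (Suc (Suc k))) v"
      by (subst gauss_hermite.simps(3)[of "Suc k"]) (simp add: algebra_simps del: gauss_hermite.simps)
    finally have "(gauss_hermite (Suc (Suc k)) has_real_derivative gauss_hermite (Suc (Suc (Suc k))) v) (at v)"
      by (simp only: gauss_hermite.simps(3)[of k, abs_def])
    with Sk show ?case by blast
  qed
  then show ?thesis by blast
qed

lemma gauss_hermite_deriv' [derivative_intros]:
  assumes "(f has_real_derivative D) (at x within S)"
  shows "((\<lambda>x. gauss_hermite k (f x)) has_real_derivative gauss_hermite (Suc k) (f x) * D) (at x within S)"
  using DERIV_chain2[OF gauss_hermite_deriv assms] .

lemma gauss_hermite_minus: "gauss_hermite k (- v) = (-1) ^ k * gauss_hermite k v"
  by (induction k v rule: gauss_hermite.induct) (auto simp: field_simps)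

text \<open>\<open>gauss_hermite k\<close> is a polynomial times
  \<open>exp (- v\<^sup>2 / 4)\<close>, so every exponent below 1/4 is attainable. The factor
  \<open>v\<close> in the recurrence is paid for by passing from \<open>c'\<close>, halfway between
  \<open>c\<close> and 1/4, down to \<open>c\<close>; this is why the induction is over all
  \<open>c\<close>.\<close>

lemma gauss_hermite_bound:
  assumes "c < 1/4"
  shows "\<exists>C>0. \<forall>v. \<bar>gauss_hermite k v\<bar> \<le> C * exp (- c * v\<^sup>2)"
  using assms
proof (induction k arbitrary: c rule: less_induct)
  case (less k)
  define c' where "c' = (c + 1/4) / 2"
  have c': "c < c'" "c' < 1/4" using less.prems by (auto simp: c'_def)
  have lin: "\<bar>v\<bar> * exp (- c' * v\<^sup>2) \<le> (1 + 1 / (c' - c)) * exp (- c * v\<^sup>2)" for v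
  proof -
    have "(\<bar>v\<bar> - 1)\<^sup>2 \<ge> 0" by simp
    then have "2 * \<bar>v\<bar> \<le> 1 + v\<^sup>2" by (simp add: power2_diff)
    then have "\<bar>v\<bar> \<le> 1 + v\<^sup>2" by linarith
    also have "\<dots> \<le> (1 + 1 / (c' - c)) * (1 + (c' - c) * v\<^sup>2)"
    proof -
      define e where "e = c' - c"
      have e: "e > 0" using c' by (simp add: e_def)
      have "(1 + 1 / e) * (1 + e * v\<^sup>2) = 1 + v\<^sup>2 + (1 / e + e * v\<^sup>2)"
        using e by (simp add: field_simps)
      then show ?thesis using e by (simp add: e_def)
    qed
    also have "\<dots> \<le> (1 + 1 / (c' - c)) * exp ((c' - c) * v\<^sup>2)"
      using c' by (intro mult_left_mono) auto
    finally have "\<bar>v\<bar> * exp (- c' * v\<^sup>2) \<le> (1 + 1 / (c' - c)) * exp ((c' - c) * v\<^sup>2) * exp (- c' * v\<^sup>2)"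
      by (intro mult_right_mono) auto
    then show ?thesis by (simp add: mult.assoc flip: exp_add) (simp add: algebra_simps)
  qed
  have le: "exp (- c' * v\<^sup>2) \<le> exp (- c * v\<^sup>2)" for v
    using c' by (auto intro: mult_right_mono)
  define M where "M = 1 + 1 / (c' - c)"
  have M: "M > 0" using c' by (auto simp: M_def add_pos_pos)
  consider "k = 0" | "k = 1" | k' where "k = Suc (Suc k')"
    by (metis One_nat_def old.nat.exhaust)
  then show ?case
  proof cases
    case 1
    have "\<bar>gauss_hermite 0 v\<bar> \<le> 1 / sqrt (4*pi) * exp (- c * v\<^sup>2)" for v
    proof -
      have "c * v\<^sup>2 \<le> 1/4 * v\<^sup>2" using less.prems by (intro mult_right_mono) auto
      then show ?thesis by (simp add: divide_right_mono)
    qed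
    then show ?thesis unfolding 1 by (intro exI[of _ "1 / sqrt (4*pi)"]) auto
  next
    case 2
    obtain C where C: "C > 0" "\<And>v. \<bar>gauss_hermite 0 v\<bar> \<le> C * exp (- c' * v\<^sup>2)"
      using less.IH[of 0 c'] 2 c' by auto
    have "\<bar>gauss_hermite k v\<bar> \<le> (M * C) * exp (- c * v\<^sup>2)" for v
    proof -
      have "\<bar>gauss_hermite k v\<bar> = \<bar>v\<bar> * \<bar>gauss_hermite 0 v\<bar> / 2" by (simp add: 2 abs_mult)
      also have "\<dots> \<le> \<bar>v\<bar> * (C * exp (- c' * v\<^sup>2)) / 2"
        using C(2)[of v] by (intro divide_right_mono mult_left_mono) auto
      also have "\<dots> = C * (\<bar>v\<bar> * exp (- c' * v\<^sup>2)) / 2" by simp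
      also have "\<dots> \<le> C * (M * exp (- c * v\<^sup>2)) / 2"
        using lin[of v] C(1) unfolding M_def by (intro divide_right_mono mult_left_mono) auto
      also have "\<dots> \<le> (M * C) * exp (- c * v\<^sup>2)" using M C(1) by simp
      finally show ?thesis .
    qed
    then show ?thesis using M C(1) by (intro exI[of _ "M * C"]) auto
  next
    case 3
    obtain C where C: "C > 0" "\<And>v. \<bar>gauss_hermite (Suc k') v\<bar> \<le> C * exp (- c' * v\<^sup>2)"
      using less.IH[of "Suc k'" c'] 3 c' by auto
    obtain D where D: "D > 0" "\<And>v. \<bar>gauss_hermite k' v\<bar> \<le> D * exp (- c' * v\<^sup>2)"
      using less.IH[of k' c'] 3 c' by auto
    have "\<bar>gauss_hermite k v\<bar> \<le> (C * M + real (Suc k') * D) * exp (- c * v\<^sup>2)" for v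
    proof -
      have "\<bar>gauss_hermite k v\<bar> = \<bar>v * gauss_hermite (Suc k') v + real (Suc k') * gauss_hermite k' v\<bar> / 2"
        by (simp only: 3 gauss_hermite.simps abs_divide abs_minus_cancel abs_numeral)
      also have "\<dots> \<le> \<bar>v * gauss_hermite (Suc k') v + real (Suc k') * gauss_hermite k' v\<bar>" by simp
      also have "\<dots> \<le> \<bar>v\<bar> * \<bar>gauss_hermite (Suc k') v\<bar> + real (Suc k') * \<bar>gauss_hermite k' v\<bar>"
        by (rule order_trans[OF abs_triangle_ineq]) (simp add: abs_mult)
      also have "\<dots> \<le> \<bar>v\<bar> * (C * exp (- c' * v\<^sup>2)) + real (Suc k') * (D * exp (- c' * v\<^sup>2))"
        using C(2)[of v] D(2)[of v] by (intro add_mono mult_left_mono) auto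
      also have "\<dots> = C * (\<bar>v\<bar> * exp (- c' * v\<^sup>2)) + real (Suc k') * D * exp (- c' * v\<^sup>2)" by simp
      also have "\<dots> \<le> C * (M * exp (- c * v\<^sup>2)) + real (Suc k') * D * exp (- c * v\<^sup>2)"
        using lin[of v] le[of v] C(1) D(1) unfolding M_def
        by (intro add_mono mult_left_mono) auto
      finally show ?thesis by (simp add: algebra_simps)
    qed
    then show ?thesis using M C(1) D(1)
      by (intro exI[of _ "C * M + real (Suc k') * D"]) (auto intro!: add_pos_nonneg mult_pos_pos)
  qed
qed

text \<open>In the notation of the paper \<open>heat \<alpha> t\<close> is \<open>\<partial>\<^sup>\<alpha> W\<^sub>t\<close>; it is a product of the derivatives
  \<open>heat1 k t\<close> of the one-dimensional kernel, and \<open>heat_conv \<alpha> f t\<close> will be \<open>\<partial>\<^sup>\<alpha> W\<^sub>t * f\<close>.\<close>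

definition heat1 :: "nat \<Rightarrow> real \<Rightarrow> real \<Rightarrow> real" where
  "heat1 k t y = gauss_hermite k (y / t) / t ^ (k + 1)"

lemma heat1_deriv_y:
  assumes "t \<noteq> 0"
  shows "(heat1 k t has_real_derivative heat1 (Suc k) t y) (at y)"
  unfolding heat1_def[abs_def] using assms
  by (auto intro!: derivative_eq_intros simp: field_simps)

text \<open>The kernel is the heat kernel at time \<open>t\<^sup>2\<close>, whence the factor
  \<open>2 * t\<close>. In the variable \<open>y / t\<close> this heat equation is the Hermite
  recurrence.\<close>

lemma heat1_deriv_t:
  assumes "t \<noteq> 0"
  shows "((\<lambda>t. heat1 k t y) has_real_derivative 2 * t * heat1 (Suc (Suc k)) t y) (at t)"
proof -
  have "((\<lambda>t. gauss_hermite k (y / t) / t ^ (k + 1)) has_real_derivative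
      (gauss_hermite (Suc k) (y / t) * (- y / t^2) * t ^ (k+1) - gauss_hermite k (y/t) * (real (k + 1) * t ^ k)) / (t ^ (k+1))\<^sup>2) (at t)"
  proof (rule DERIV_cong[OF DERIV_divide])
    show "((\<lambda>t. gauss_hermite k (y / t)) has_real_derivative gauss_hermite (Suc k) (y / t) * (- y / t^2)) (at t)"
      using assms by (auto intro!: derivative_eq_intros simp: power2_eq_square)
    show "((\<lambda>t. t ^ (k + 1)) has_real_derivative real (k + 1) * t ^ k) (at t)"
      using DERIV_pow[of "k+1" t] by simp
  qed (use assms in \<open>auto simp: power2_eq_square\<close>)
  also have "(gauss_hermite (Suc k) (y / t) * (- y / t^2) * t ^ (k+1) - gauss_hermite k (y/t) * (real (k + 1) * t ^ k)) / (t ^ (k+1))\<^sup>2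
     = 2 * t * (gauss_hermite (Suc (Suc k)) (y / t) / t ^ (Suc (Suc k) + 1))"
    using assms by (simp add: power2_eq_square divide_simps) (simp add: algebra_simps)
  finally show ?thesis by (simp add: heat1_def)
qed

lemma heat1_minus: "heat1 k t (- y) = (-1) ^ k * heat1 k t y"
  by (simp add: heat1_def gauss_hermite_minus)

lemma gauss_hermite_continuous [continuous_intros]:
  "continuous_on S f \<Longrightarrow> continuous_on S (\<lambda>x. gauss_hermite k (f x))"
  by (rule continuous_on_compose2[of UNIV "gauss_hermite k"])
    (auto intro!: DERIV_continuous_on[of _ _ "gauss_hermite (Suc k)"] gauss_hermite_deriv)

lemma gauss_hermite_measurable [measurable]: "gauss_hermite k \<in> borel_measurable borel"
  by (intro borel_measurable_continuous_onI continuous_intros)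

lemma heat1_measurable [measurable]:
  assumes [measurable]: "f \<in> borel_measurable M" "g \<in> borel_measurable M"
  shows "(\<lambda>x. heat1 k (f x) (g x)) \<in> borel_measurable M"
  unfolding heat1_def by measurable

text \<open>Half of the Gaussian decay is given up to absorb the Hermite polynomial, so 1/8 replaces
  1/4. The resulting \<open>8 * t\<^sup>2\<close> recurs in the difference estimates and in the
  integral over \<open>t\<close>.\<close>

lemma heat1_bound:
  "\<exists>C>0. \<forall>t>0. \<forall>y. \<bar>heat1 k t y\<bar> \<le> C / t ^ (k + 1) * exp (- y\<^sup>2 / (8 * t\<^sup>2))"
proof -
  obtain C where C: "C > 0" "\<And>v. \<bar>gauss_hermite k v\<bar> \<le> C * exp (- (1/8) * v\<^sup>2)"
    using gauss_hermite_bound[of "1/8" k] by auto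
  have "\<bar>heat1 k t y\<bar> \<le> C / t ^ (k + 1) * exp (- y\<^sup>2 / (8 * t\<^sup>2))" if "t > 0" for t y
  proof -
    have "\<bar>heat1 k t y\<bar> = \<bar>gauss_hermite k (y/t)\<bar> / t ^ (k+1)" using that by (simp add: heat1_def)
    also have "\<dots> \<le> C * exp (- (1/8) * (y/t)\<^sup>2) / t ^ (k+1)"
      using that by (intro divide_right_mono C) auto
    finally show ?thesis by (simp add: power_divide)
  qed
  with C(1) show ?thesis by blast
qed

definition heat :: "('n::finite \<Rightarrow> nat) \<Rightarrow> real \<Rightarrow> real^'n \<Rightarrow> real" where
  "heat \<alpha> t x = (\<Prod>i\<in>UNIV. heat1 (\<alpha> i) t (x $ i))"

abbreviation msize :: "('n::finite \<Rightarrow> nat) \<Rightarrow> nat" where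
  "msize \<alpha> \<equiv> (\<Sum>i\<in>UNIV. \<alpha> i)"

lemma prod_fun_upd_UNIV:
  fixes i :: "'n::finite"
  shows "(\<Prod>j\<in>UNIV. f j ((\<alpha>(i := a)) j)) = f i a * (\<Prod>j\<in>UNIV - {i}. f j (\<alpha> j))"
proof -
  have "(\<Prod>j\<in>UNIV. f j ((\<alpha>(i := a)) j)) = f i ((\<alpha>(i := a)) i) * (\<Prod>j\<in>UNIV - {i}. f j ((\<alpha>(i := a)) j))"
    by (rule prod.remove) auto
  also have "(\<Prod>j\<in>UNIV - {i}. f j ((\<alpha>(i := a)) j)) = (\<Prod>j\<in>UNIV - {i}. f j (\<alpha> j))"
    by (rule prod.cong) auto
  finally show ?thesis by simp
qed

lemma msize_upd: "msize (\<alpha>(i := \<alpha> i + k)) = msize \<alpha> + k"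
proof -
  have "msize (\<alpha>(i := \<alpha> i + k)) = (\<alpha> i + k) + (\<Sum>j\<in>UNIV - {i}. (\<alpha>(i := \<alpha> i + k)) j)"
    by (subst sum.remove[of _ i]) auto
  also have "(\<Sum>j\<in>UNIV - {i}. (\<alpha>(i := \<alpha> i + k)) j) = (\<Sum>j\<in>UNIV - {i}. \<alpha> j)"
    by (rule sum.cong) auto
  also have "(\<alpha> i + k) + (\<Sum>j\<in>UNIV - {i}. \<alpha> j) = msize \<alpha> + k"
    by (subst (2) sum.remove[of _ i]) auto
  finally show ?thesis .
qed

lemma has_real_derivative_prod_finite:
  fixes i :: "'n::finite"
  assumes "\<And>j. ((f j) has_real_derivative f' j) (at x)"
  shows "((\<lambda>x. \<Prod>j\<in>UNIV. f j x) has_real_derivative (\<Sum>i\<in>UNIV. f' i * (\<Prod>j\<in>UNIV-{i}. f j x))) (at x)"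
  using has_field_derivative_prod[of UNIV f f' x] assms by auto

lemma tensor_deriv:
  fixes x :: "real^'n"
  assumes "(g i has_real_derivative d) (at (x $ i + r))"
  shows "((\<lambda>r. \<Prod>j\<in>UNIV. g j ((x + r *\<^sub>R axis i 1) $ j)) has_real_derivative
     (d * (\<Prod>j\<in>UNIV-{i}. g j ((x + r *\<^sub>R axis i 1) $ j)))) (at r)"
proof -
  have eq: "(\<Prod>j\<in>UNIV. g j ((x + r *\<^sub>R axis i 1) $ j)) = g i (x $ i + r) * (\<Prod>j\<in>UNIV-{i}. g j (x $ j))" for r
    by (subst prod.remove[of _ i]) (auto simp: axis_def intro!: prod.cong)
  have eq': "(\<Prod>j\<in>UNIV-{i}. g j ((x + r *\<^sub>R axis i 1) $ j)) = (\<Prod>j\<in>UNIV-{i}. g j (x $ j))"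
    by (auto simp: axis_def intro!: prod.cong)
  have "((\<lambda>r. x $ i + r) has_real_derivative 1) (at r)"
    by (rule DERIV_cong[OF DERIV_add[OF DERIV_const DERIV_ident]]) simp
  from DERIV_chain2[where f = "g i", OF assms this]
  have "((\<lambda>r. g i (x $ i + r)) has_real_derivative d) (at r)" by simp
  then show ?thesis unfolding eq eq' by (rule DERIV_cmult_right)
qed

lemma heat_deriv_x:
  assumes "t \<noteq> 0"
  shows "((\<lambda>r. heat \<alpha> t (x + r *\<^sub>R axis i 1)) has_real_derivative
     heat (\<alpha>(i := Suc (\<alpha> i))) t (x + r *\<^sub>R axis i 1)) (at r)"
proof -
  have 1: "heat (\<alpha>(i := Suc (\<alpha> i))) t (x + r *\<^sub>R axis i 1) =
      heat1 (Suc (\<alpha> i)) t (x $ i + r) * (\<Prod>j\<in>UNIV-{i}. heat1 (\<alpha> j) t ((x + r *\<^sub>R axis i 1) $ j))"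
    unfolding heat_def
    by (subst prod_fun_upd_UNIV[where f = "\<lambda>j k. heat1 k t ((x + r *\<^sub>R axis i 1) $ j)"]) (simp add: axis_def)
  show ?thesis
    unfolding 1 unfolding heat_def by (rule tensor_deriv[where g = "\<lambda>j. heat1 (\<alpha> j) t"], rule heat1_deriv_y[OF assms])
qed

lemma heat_deriv_t:
  assumes "t \<noteq> 0"
  shows "((\<lambda>t. heat \<alpha> t x) has_real_derivative 2 * t * (\<Sum>i\<in>UNIV. heat (\<alpha>(i := \<alpha> i + 2)) t x)) (at t)"
proof -
  have "heat (\<alpha>(i := \<alpha> i + 2)) t x = heat1 (\<alpha> i + 2) t (x $ i) * (\<Prod>j\<in>UNIV-{i}. heat1 (\<alpha> j) t (x $ j))" for i
    unfolding heat_def by (rule prod_fun_upd_UNIV[where f = "\<lambda>j k. heat1 k t (x $ j)"])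
  then show ?thesis
    using has_real_derivative_prod_finite[of "\<lambda>i t. heat1 (\<alpha> i) t (x $ i)" "\<lambda>i. 2 * t * heat1 (Suc (Suc (\<alpha> i))) t (x $ i)" t]
      heat1_deriv_t[OF assms]
    by (simp add: heat_def sum_distrib_left mult_ac)
qed

lemma heat_minus: "heat \<alpha> t (- x) = (-1) ^ msize \<alpha> * heat \<alpha> t x"
  by (simp only: heat_def vector_uminus_component heat1_minus prod.distrib power_sum)

lemma norm_sq_vec: "(norm (x::real^'n))\<^sup>2 = (\<Sum>i\<in>UNIV. (x $ i)\<^sup>2)"
  by (simp add: norm_vec_def L2_set_def sum_nonneg)

lemma heat_bound:
  fixes \<alpha> :: "'n::finite \<Rightarrow> nat"
  shows "\<exists>C>0. \<forall>t>0. \<forall>x. \<bar>heat \<alpha> t x\<bar> \<le> C / t ^ (CARD('n) + msize \<alpha>) * exp (- (norm x)\<^sup>2 / (8 * t\<^sup>2))"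
proof -
  have "\<forall>k. \<exists>C>0. \<forall>t>0. \<forall>y. \<bar>heat1 k t y\<bar> \<le> C / t ^ (k + 1) * exp (- y\<^sup>2 / (8 * t\<^sup>2))"
    using heat1_bound by blast
  then obtain C where C: "\<And>k. C k > 0"
    "\<And>k t y. t > 0 \<Longrightarrow> \<bar>heat1 k t y\<bar> \<le> C k / t ^ (k + 1) * exp (- y\<^sup>2 / (8 * t\<^sup>2))"
    by metis
  have "\<bar>heat \<alpha> t x\<bar> \<le> (\<Prod>i\<in>UNIV. C (\<alpha> i)) / t ^ (CARD('n) + msize \<alpha>) * exp (- (norm x)\<^sup>2 / (8 * t\<^sup>2))"
    if "t > 0" for t x
  proof -
    have "\<bar>heat \<alpha> t x\<bar> = (\<Prod>i\<in>UNIV. \<bar>heat1 (\<alpha> i) t (x $ i)\<bar>)" by (simp add: heat_def abs_prod)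
    also have "\<dots> \<le> (\<Prod>i\<in>UNIV. C (\<alpha> i) / t ^ (\<alpha> i + 1) * exp (- (x $ i)\<^sup>2 / (8 * t\<^sup>2)))"
      by (intro prod_mono conjI C(2) that) auto
    also have "\<dots> = (\<Prod>i\<in>UNIV. C (\<alpha> i)) / (\<Prod>i\<in>UNIV. t ^ (\<alpha> i + 1)) * exp (\<Sum>i\<in>UNIV. - (x $ i)\<^sup>2 / (8 * t\<^sup>2))"
      by (simp add: prod.distrib prod_dividef exp_sum)
    also have "(\<Prod>i\<in>(UNIV::'n set). t ^ (\<alpha> i + 1)) = t ^ (CARD('n) + msize \<alpha>)"
      by (simp only: prod.distrib power_add power_one_right prod_constant power_sum mult.commute)
    also have "(\<Sum>i\<in>UNIV. - (x $ i)\<^sup>2 / (8 * t\<^sup>2)) = - (norm x)\<^sup>2 / (8 * t\<^sup>2)"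
      by (simp add: norm_sq_vec sum_divide_distrib sum_negf)
    finally show ?thesis .
  qed
  moreover have "(\<Prod>i\<in>UNIV. C (\<alpha> i)) > 0" by (intro prod_pos) (auto simp: C)
  ultimately show ?thesis by blast
qed

lemma heat_measurable [measurable]:
  assumes [measurable]: "f \<in> borel_measurable M" "g \<in> borel_measurable M"
  shows "(\<lambda>x. heat \<alpha> (f x) (g x)) \<in> borel_measurable M"
proof -
  have [measurable]: "(\<lambda>x. g x $ i) \<in> borel_measurable M" for i
    by (rule borel_measurable_continuous_on[OF _ assms(2)]) (intro continuous_intros)
  show ?thesis unfolding heat_def by measurable
qed

lemma gauss_kernel_eq_heat:
  assumes "t > 0"
  shows "gauss_kernel t x = heat (\<lambda>_. 0) t (x::real^'n)"
proof -
  have "heat (\<lambda>_. 0) t x = (\<Prod>i\<in>UNIV. exp (- (x $ i)\<^sup>2 / (4 * t\<^sup>2)) / (sqrt (4 * pi) * t))"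
    unfolding heat_def heat1_def by (intro prod.cong refl) (simp add: power_divide mult.commute)
  also have "\<dots> = (\<Prod>i\<in>UNIV. exp (- (x $ i)\<^sup>2 / (4 * t\<^sup>2))) / (sqrt (4 * pi) * t) ^ CARD('n)"
    by (simp add: prod_dividef)
  also have "(\<Prod>i\<in>UNIV. exp (- (x $ i)\<^sup>2 / (4 * t\<^sup>2))) = exp (- (norm x)\<^sup>2 / (4 * t\<^sup>2))"
    by (subst exp_sum[symmetric]) (simp_all add: norm_sq_vec sum_divide_distrib sum_negf)
  also have "(sqrt (4 * pi) * t) ^ CARD('n) = (4 * pi * t\<^sup>2) powr (real CARD('n) / 2)"
  proof -
    have pos: "0 < 4 * pi * t\<^sup>2" using assms by simp
    have "(4 * pi * t\<^sup>2) powr (real CARD('n) / 2) = ((4 * pi * t\<^sup>2) powr (1/2)) powr real CARD('n)"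
      by (subst powr_powr) simp
    also have "(4 * pi * t\<^sup>2) powr (1/2) = sqrt (4 * pi) * t"
      using assms pos by (subst powr_half_sqrt) (simp_all add: real_sqrt_mult)
    also have "(sqrt (4 * pi) * t) powr real CARD('n) = (sqrt (4 * pi) * t) ^ CARD('n)"
      using assms by (intro powr_realpow) simp
    finally show ?thesis by simp
  qed
  finally show ?thesis by (simp add: gauss_kernel_def)
qed

section \<open>The Gaussian extension and its derivatives\<close>

lemma nn_integral_lborel_affine:
  fixes t :: "'a::euclidean_space"
  assumes [measurable]: "f \<in> borel_measurable borel" and c: "c \<noteq> 0"
  shows "(\<integral>\<^sup>+x. f x \<partial>lborel) = ennreal (\<bar>c\<bar> ^ DIM('a)) * (\<integral>\<^sup>+x. f (t + c *\<^sub>R x) \<partial>lborel)"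
  by (subst lborel_affine[OF c, of t])
     (simp add: nn_integral_density nn_integral_distr nn_integral_cmult ennreal_power)

lemma lborel_distr_reflect:
  fixes t :: "'a::euclidean_space"
  assumes "c = 1 \<or> c = - 1"
  shows "distr lborel borel (\<lambda>x. t + c *\<^sub>R x) = lborel"
  using assms by (subst (2) lborel_affine[of c t]) (auto simp: density_1)

lemma
  fixes t :: "'a::euclidean_space" and f :: "'a \<Rightarrow> real"
  assumes [measurable]: "f \<in> borel_measurable borel"
  shows integral_lborel_translate: "(LINT x|lborel. f (t + x)) = (LINT x|lborel. f x)"
    and integral_lborel_reflect: "(LINT x|lborel. f (t - x)) = (LINT x|lborel. f x)"
    and integrable_lborel_translate: "integrable lborel (\<lambda>x. f (t + x)) \<longleftrightarrow> integrable lborel f"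
    and integrable_lborel_reflect: "integrable lborel (\<lambda>x. f (t - x)) \<longleftrightarrow> integrable lborel f"
proof -
  have *: "distr lborel borel (\<lambda>x. t + x) = lborel" "distr lborel borel (\<lambda>x. t - x) = lborel"
    using lborel_distr_reflect[of 1 t] lborel_distr_reflect[of "-1" t] by simp_all
  show "(LINT x|lborel. f (t + x)) = (LINT x|lborel. f x)"
    by (subst (2) *(1)[symmetric], subst integral_distr) auto
  show "(LINT x|lborel. f (t - x)) = (LINT x|lborel. f x)"
    by (subst (2) *(2)[symmetric], subst integral_distr) auto
  show "integrable lborel (\<lambda>x. f (t + x)) \<longleftrightarrow> integrable lborel f"
    by (subst (2) *(1)[symmetric], subst integrable_distr_eq) auto
  show "integrable lborel (\<lambda>x. f (t - x)) \<longleftrightarrow> integrable lborel f"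
    by (subst (2) *(2)[symmetric], subst integrable_distr_eq) auto
qed

lemma nn_integral_lborel_translate:
  fixes t :: "'a::euclidean_space" and f :: "'a \<Rightarrow> ennreal"
  assumes [measurable]: "f \<in> borel_measurable borel"
  shows "(\<integral>\<^sup>+x. f (t + x) \<partial>lborel) = (\<integral>\<^sup>+x. f x \<partial>lborel)"
  using nn_integral_lborel_affine[of f 1 t] by simp

lemma Basis_vec_real: "(Basis :: (real^'n) set) = range (\<lambda>i. axis i 1)"
  by (auto simp: Basis_vec_def)

lemma nn_integral_lborel_vec_prod:
  fixes f :: "'n::finite \<Rightarrow> real \<Rightarrow> real"
  assumes [measurable]: "\<And>i. f i \<in> borel_measurable borel" and nn: "\<And>i x. 0 \<le> f i x"
  shows "(\<integral>\<^sup>+x. ennreal (\<Prod>i\<in>UNIV. f i (x $ i)) \<partial>(lborel :: (real^'n) measure)) =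
    (\<Prod>i\<in>UNIV. \<integral>\<^sup>+y. ennreal (f i y) \<partial>lborel)"
proof -
  \<comment> \<open>The product formula for \<open>lborel\<close> is indexed by basis vectors;
    \<open>g\<close> relabels the factors accordingly.\<close>
  define g where "g b = f (THE i. b = axis i (1::real))" for b :: "real^'n"
  have g: "g (axis i 1) = f i" for i
    unfolding g_def by (simp add: axis_eq_axis)
  have inj: "inj (\<lambda>i::'n. axis i (1::real))" by (auto simp: inj_on_def axis_eq_axis)
  have "(\<integral>\<^sup>+x. (\<Prod>b\<in>Basis. ennreal (g b (x \<bullet> b))) \<partial>(lborel :: (real^'n) measure)) =
     (\<Prod>b\<in>Basis. \<integral>\<^sup>+y. ennreal (g b y) \<partial>lborel)"
    by (rule nn_integral_lborel_prod) (auto simp: g Basis_vec_real)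
  then show ?thesis
    unfolding Basis_vec_real
    by (simp add: prod.reindex[OF inj] g inner_axis prod_ennreal nn)
qed

lemma integrable_gauss_1d:
  fixes c :: real assumes "c > 0"
  shows "(\<integral>\<^sup>+y. ennreal (exp (- c * y\<^sup>2)) \<partial>lborel) < \<infinity>"
proof -
  \<comment> \<open>The function \<open>exp (- c * y\<^sup>2)\<close> is a multiple of the normal
    density of variance \<open>1 / (2 * c)\<close>.\<close>
  have "integrable lborel (\<lambda>y. sqrt (pi / c) * normal_density 0 (1 / sqrt (2 * c)) y)"
    using assms by (intro integrable_mult_right integrable_normal_density) auto
  also have "(\<lambda>y. sqrt (pi / c) * normal_density 0 (1 / sqrt (2 * c)) y) = (\<lambda>y. exp (- c * y\<^sup>2))"
    using assms by (auto simp: normal_density_def fun_eq_iff power_divide real_sqrt_divide real_sqrt_mult field_simps)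
  finally show ?thesis by (simp add: integrable_iff_bounded)
qed

lemma integrable_gauss:
  fixes c :: real assumes "c > 0"
  shows "integrable lborel (\<lambda>x::real^'n. exp (- c * (norm x)\<^sup>2))"
proof -
  have eq: "exp (- c * (norm x)\<^sup>2) = (\<Prod>i\<in>UNIV. exp (- c * (x $ i)\<^sup>2))" for x :: "real^'n"
    by (simp add: norm_sq_vec sum_distrib_left sum_negf flip: exp_sum)
  have "(\<integral>\<^sup>+x. ennreal (exp (- c * (norm x)\<^sup>2)) \<partial>(lborel :: (real^'n) measure)) =
      (\<Prod>i\<in>(UNIV::'n set). \<integral>\<^sup>+y. ennreal (exp (- c * y\<^sup>2)) \<partial>lborel)"
    unfolding eq by (rule nn_integral_lborel_vec_prod) auto
  also have "\<dots> < \<infinity>"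
    using integrable_gauss_1d[OF assms] by (simp add: power_less_top_ennreal)
  finally show ?thesis by (auto simp: integrable_iff_bounded)
qed

section \<open>Convolution with the kernel and its derivatives\<close>

text \<open>All exponents \<open>c\<close> are required, because \<open>t\<close> is arbitrary and
  because recentring a Gaussian or absorbing a polynomial into it costs part of the
  exponent.\<close>

definition gauss_integrable :: "(real^'n \<Rightarrow> real) \<Rightarrow> bool" where
  "gauss_integrable f \<longleftrightarrow> f \<in> borel_measurable borel \<and> (\<forall>c>0. integrable lborel (\<lambda>x. exp (- c * (norm x)\<^sup>2) * f x))"

lemma gauss_integrable_integrable_bound:
  assumes "gauss_integrable f" and [measurable]: "g \<in> borel_measurable borel" and "c > 0"
    and "\<And>y. \<bar>g y\<bar> \<le> C * exp (- c * (norm y)\<^sup>2)"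
  shows "integrable lborel (\<lambda>y. g y * f y)"
proof (rule Bochner_Integration.integrable_bound)
  show "integrable lborel (\<lambda>y. C * (exp (- c * (norm y)\<^sup>2) * f y))"
    using assms by (auto simp: gauss_integrable_def)
  have [measurable]: "f \<in> borel_measurable borel" using assms(1) by (simp add: gauss_integrable_def)
  show "(\<lambda>y. g y * f y) \<in> borel_measurable lborel" by simp
  have "\<bar>g y * f y\<bar> \<le> \<bar>C * (exp (- c * (norm y)\<^sup>2) * f y)\<bar>" for y
  proof -
    have "\<bar>g y\<bar> * \<bar>f y\<bar> \<le> \<bar>C * exp (- c * (norm y)\<^sup>2)\<bar> * \<bar>f y\<bar>"
      using assms(4)[of y] by (intro mult_right_mono) auto
    then show ?thesis by (simp add: abs_mult mult.assoc)
  qed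
  then show "AE y in lborel. norm (g y * f y) \<le> norm (C * (exp (- c * (norm y)\<^sup>2) * f y))"
    by simp
qed

text \<open>Moves the centre of a Gaussian from \<open>x\<close> to the origin: half of the exponent
  is lost, and a factor depending on \<open>x\<close> appears.\<close>

lemma norm_diff_sq_ge: "(norm (x - y))\<^sup>2 \<ge> (norm y)\<^sup>2 / 2 - (norm (x::'a::real_inner))\<^sup>2"
proof -
  have "norm y \<le> norm x + norm (x - y)" using norm_triangle_sub[of y x] by (simp add: norm_minus_commute)
  then have "(norm y)\<^sup>2 \<le> (norm x + norm (x - y))\<^sup>2" by (intro power_mono) auto
  also have "\<dots> \<le> 2 * (norm x)\<^sup>2 + 2 * (norm (x - y))\<^sup>2"
    using zero_le_power2[of "norm x - norm (x - y)"] by (simp add: power2_sum power2_diff)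
  finally show ?thesis by simp
qed

text \<open>A majorant uniform for \<open>t\<close> near \<open>t0\<close> and \<open>x\<close> in a
  ball, as needed for differentiating under the integral in \<open>x\<close> and in
  \<open>t\<close>. The slowest decay occurs at \<open>t = 2 * t0\<close>, where
  \<open>8 * t\<^sup>2\<close> is \<open>32 * t0\<^sup>2\<close>; recentring doubles this to 64. The
  largest prefactor occurs at \<open>t = t0 / 2\<close>.\<close>

lemma heat_dom:
  fixes \<alpha> :: "'n::finite \<Rightarrow> nat"
  assumes "t0 > 0"
  shows "\<exists>C>0. \<exists>c>0. \<forall>t\<in>{t0/2..2*t0}. \<forall>x y. norm x \<le> R \<longrightarrow> \<bar>heat \<alpha> t (x - y)\<bar> \<le> C * exp (- c * (norm y)\<^sup>2)"
proof -
  obtain C0 where C0: "C0 > 0" "\<And>t x. t > 0 \<Longrightarrow> \<bar>heat \<alpha> t x\<bar> \<le> C0 / t ^ (CARD('n) + msize \<alpha>) * exp (- (norm x)\<^sup>2 / (8 * t\<^sup>2))"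
    using heat_bound[of \<alpha>] by blast
  define N where "N = CARD('n) + msize \<alpha>"
  define C where "C = C0 / (t0/2)^N * exp (R\<^sup>2 / (32 * t0\<^sup>2))"
  define c where "c = 1 / (64 * t0\<^sup>2)"
  have "\<bar>heat \<alpha> t (x - y)\<bar> \<le> C * exp (- c * (norm y)\<^sup>2)" if t: "t \<in> {t0/2..2*t0}" and x: "norm x \<le> R" for t x y
  proof -
    have t0: "t > 0" using t assms by auto
    have "t\<^sup>2 \<le> (2 * t0)\<^sup>2" using t t0 by (intro power_mono) auto
    then have tt: "8 * t\<^sup>2 \<le> 32 * t0\<^sup>2" by (simp add: power2_eq_square)
    have "(norm x)\<^sup>2 \<le> R\<^sup>2" using x by (intro power_mono) auto
    then have "(norm y)\<^sup>2 / 2 - R\<^sup>2 \<le> (norm (x - y))\<^sup>2"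
      using norm_diff_sq_ge[of y x] by linarith
    then have "((norm y)\<^sup>2 / 2 - R\<^sup>2) / (32 * t0\<^sup>2) \<le> (norm (x - y))\<^sup>2 / (32 * t0\<^sup>2)"
      by (intro divide_right_mono) auto
    also have "\<dots> \<le> (norm (x - y))\<^sup>2 / (8 * t\<^sup>2)"
      using tt t0 assms by (intro divide_left_mono mult_pos_pos) auto
    finally have e: "- (norm (x - y))\<^sup>2 / (8 * t\<^sup>2) \<le> R\<^sup>2 / (32 * t0\<^sup>2) + (- c * (norm y)\<^sup>2)"
      by (simp add: c_def diff_divide_distrib)
    have "\<bar>heat \<alpha> t (x - y)\<bar> \<le> C0 / t ^ N * exp (- (norm (x - y))\<^sup>2 / (8 * t\<^sup>2))"
      unfolding N_def by (rule C0(2)[OF t0])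
    also have "\<dots> \<le> C0 / (t0/2)^N * exp (R\<^sup>2 / (32 * t0\<^sup>2) + (- c * (norm y)\<^sup>2))"
    proof (intro mult_mono divide_left_mono power_mono)
      show "exp (- (norm (x - y))\<^sup>2 / (8 * t\<^sup>2)) \<le> exp (R\<^sup>2 / (32 * t0\<^sup>2) + (- c * (norm y)\<^sup>2))"
        using e by simp
    qed (use t t0 assms C0 in auto)
    also have "\<dots> = C * exp (- c * (norm y)\<^sup>2)" unfolding C_def exp_add by (simp only: mult.assoc)
    finally show ?thesis .
  qed
  moreover have "C > 0" "c > 0" using C0 assms by (auto simp: C_def c_def)
  ultimately show ?thesis by blast
qed

definition heat_conv :: "('n::finite \<Rightarrow> nat) \<Rightarrow> (real^'n \<Rightarrow> real) \<Rightarrow> real \<Rightarrow> real^'n \<Rightarrow> real" where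
  "heat_conv \<alpha> f t x = (LINT y|lborel. heat \<alpha> t (x - y) * f y)"

lemma heat_conv_integrable:
  assumes "gauss_integrable f" "t > 0"
  shows "integrable lborel (\<lambda>y. heat \<alpha> t (x - y) * f y)"
proof -
  obtain C c where "C > 0" "c > 0" and C: "\<forall>t'\<in>{t/2..2*t}. \<forall>x' y. norm x' \<le> norm x \<longrightarrow> \<bar>heat \<alpha> t' (x' - y)\<bar> \<le> C * exp (- c * (norm y)\<^sup>2)"
    using heat_dom[OF assms(2), of "norm x" \<alpha>] by blast
  show ?thesis
    by (rule gauss_integrable_integrable_bound[OF assms(1) _ \<open>c > 0\<close>, where C = C]) (use C assms in auto)
qed

lemma heat_conv_deriv_x:
  assumes f: "gauss_integrable f" and t: "t > 0"
  shows "((\<lambda>r. heat_conv \<alpha> f t (x + r *\<^sub>R axis i 1)) has_real_derivative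
     heat_conv (\<alpha>(i := Suc (\<alpha> i))) f t (x + r0 *\<^sub>R axis i 1)) (at r0)"
proof -
  \<comment> \<open>Large enough to contain every \<open>x + r *\<^sub>R axis i 1\<close> with
    \<open>\<bar>r - r0\<bar> < 1\<close>.\<close>
  let ?R = "norm x + \<bar>r0\<bar> + 1"
  have fm [measurable]: "f \<in> borel_measurable borel" using f by (simp add: gauss_integrable_def)
  obtain C c where C: "C > 0" "c > 0" and bnd: "\<forall>t'\<in>{t/2..2*t}. \<forall>x' y. norm x' \<le> ?R \<longrightarrow> \<bar>heat (\<alpha>(i := Suc (\<alpha> i))) t' (x' - y)\<bar> \<le> C * exp (- c * (norm y)\<^sup>2)"
    using heat_dom[OF t, of ?R "\<alpha>(i := Suc (\<alpha> i))"] by blast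
  show ?thesis
    unfolding heat_conv_def
  proof (rule has_real_derivative_lebesgue_integral[where \<delta> = 1 and G = "\<lambda>y. C * (exp (- c * (norm y)\<^sup>2) * \<bar>f y\<bar>)"
        and F' = "\<lambda>r y. heat (\<alpha>(i := Suc (\<alpha> i))) t (x + r *\<^sub>R axis i 1 - y) * f y"])
    show "integrable lborel (\<lambda>y. heat \<alpha> t (x + r *\<^sub>R axis i 1 - y) * f y)" for r
      by (rule heat_conv_integrable[OF f t])
    have "((\<lambda>r. heat \<alpha> t ((x - y) + r *\<^sub>R axis i 1)) has_real_derivative
        heat (\<alpha>(i := Suc (\<alpha> i))) t ((x - y) + r *\<^sub>R axis i 1)) (at r)" for r y
      using t by (intro heat_deriv_x) simp
    then show "((\<lambda>r. heat \<alpha> t (x + r *\<^sub>R axis i 1 - y) * f y) has_real_derivative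
        heat (\<alpha>(i := Suc (\<alpha> i))) t (x + r *\<^sub>R axis i 1 - y) * f y) (at r)" for r y
      by (intro DERIV_cmult_right) (simp add: algebra_simps)
    show "\<bar>heat (\<alpha>(i := Suc (\<alpha> i))) t (x + r *\<^sub>R axis i 1 - y) * f y\<bar> \<le> C * (exp (- c * (norm y)\<^sup>2) * \<bar>f y\<bar>)"
      if "\<bar>r - r0\<bar> < 1" for r y
    proof -
      have "norm (x + r *\<^sub>R axis i 1) \<le> norm x + \<bar>r\<bar> * 1"
        by (rule order_trans[OF norm_triangle_ineq]) simp
      then have "norm (x + r *\<^sub>R axis i 1) \<le> ?R" using that by linarith
      then have "\<bar>heat (\<alpha>(i := Suc (\<alpha> i))) t (x + r *\<^sub>R axis i 1 - y)\<bar> \<le> C * exp (- c * (norm y)\<^sup>2)"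
        using bnd t by auto
      then have "\<bar>heat (\<alpha>(i := Suc (\<alpha> i))) t (x + r *\<^sub>R axis i 1 - y)\<bar> * \<bar>f y\<bar> \<le> C * exp (- c * (norm y)\<^sup>2) * \<bar>f y\<bar>"
        by (intro mult_right_mono) auto
      then show ?thesis by (simp add: abs_mult mult.assoc)
    qed
    have "integrable lborel (\<lambda>y. \<bar>exp (- c * (norm y)\<^sup>2) * f y\<bar>)"
      using f C by (intro integrable_abs) (auto simp: gauss_integrable_def)
    then show "integrable lborel (\<lambda>y. C * (exp (- c * (norm y)\<^sup>2) * \<bar>f y\<bar>))"
      by (intro integrable_mult_right) (simp add: abs_mult)
    show "(\<lambda>y. heat (\<alpha>(i := Suc (\<alpha> i))) t (x + r0 *\<^sub>R axis i 1 - y) * f y) \<in> borel_measurable lborel"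
      by simp
  qed simp
qed

lemma heat_conv_deriv_t:
  assumes f: "gauss_integrable f" and t: "t > 0"
  shows "((\<lambda>t. heat_conv \<alpha> f t x) has_real_derivative 2 * t * (\<Sum>i\<in>UNIV. heat_conv (\<alpha>(i := \<alpha> i + 2)) f t x)) (at t)"
proof -
  have fm [measurable]: "f \<in> borel_measurable borel" using f by (simp add: gauss_integrable_def)
  have "\<forall>i. \<exists>C c. C > 0 \<and> c > 0 \<and> (\<forall>t'\<in>{t/2..2*t}. \<forall>x' y. norm x' \<le> norm x \<longrightarrow> \<bar>heat (\<alpha>(i := \<alpha> i + 2)) t' (x' - y)\<bar> \<le> C * exp (- c * (norm y)\<^sup>2))"
    using heat_dom[OF t] by blast
  then obtain C c where C: "\<And>i. C i > 0" "\<And>i. c i > (0::real)" and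
     bnd: "\<And>i t' y. t' \<in> {t/2..2*t} \<Longrightarrow> \<bar>heat (\<alpha>(i := \<alpha> i + 2)) t' (x - y)\<bar> \<le> C i * exp (- c i * (norm y)\<^sup>2)"
    by (metis order_refl)
  have "((\<lambda>t. heat_conv \<alpha> f t x) has_real_derivative
      (LINT y|lborel. 2 * t * (\<Sum>i\<in>UNIV. heat (\<alpha>(i := \<alpha> i + 2)) t (x - y)) * f y)) (at t)"
    unfolding heat_conv_def
  \<comment> \<open>With \<open>\<delta> = t / 2\<close> every admissible \<open>r\<close> lies in
    the range covered by the majorant, and \<open>2 * r\<close> is at most
    \<open>4 * t\<close>.\<close>
  proof (rule has_real_derivative_lebesgue_integral[where \<delta> = "t/2" and
        G = "\<lambda>y. 4 * t * (\<Sum>i\<in>UNIV. C i * (exp (- c i * (norm y)\<^sup>2) * \<bar>f y\<bar>))"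
        and F' = "\<lambda>t y. 2 * t * (\<Sum>i\<in>UNIV. heat (\<alpha>(i := \<alpha> i + 2)) t (x - y)) * f y"])
    show "integrable lborel (\<lambda>y. heat \<alpha> r (x - y) * f y)" if "\<bar>r - t\<bar> < t/2" for r
      using that t by (intro heat_conv_integrable[OF f]) linarith
    show "((\<lambda>t. heat \<alpha> t (x - y) * f y) has_real_derivative
       2 * r * (\<Sum>i\<in>UNIV. heat (\<alpha>(i := \<alpha> i + 2)) r (x - y)) * f y) (at r)" if "\<bar>r - t\<bar> < t/2" for r y
      using that t by (intro DERIV_cmult_right heat_deriv_t) auto
    show "\<bar>2 * r * (\<Sum>i\<in>UNIV. heat (\<alpha>(i := \<alpha> i + 2)) r (x - y)) * f y\<bar> \<le>
        4 * t * (\<Sum>i\<in>UNIV. C i * (exp (- c i * (norm y)\<^sup>2) * \<bar>f y\<bar>))"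
      if r: "\<bar>r - t\<bar> < t/2" for r y
    proof -
      have r': "r \<in> {t/2..2*t}" "r > 0" "r \<le> 2 * t" using r t by (auto simp: abs_if split: if_splits)
      have "\<bar>2 * r * (\<Sum>i\<in>UNIV. heat (\<alpha>(i := \<alpha> i + 2)) r (x - y)) * f y\<bar> =
          2 * r * (\<bar>\<Sum>i\<in>UNIV. heat (\<alpha>(i := \<alpha> i + 2)) r (x - y)\<bar> * \<bar>f y\<bar>)"
        using r' by (simp add: abs_mult)
      also have "\<dots> \<le> 4 * t * ((\<Sum>i\<in>UNIV. C i * exp (- c i * (norm y)\<^sup>2)) * \<bar>f y\<bar>)"
      proof (rule mult_mono)
        have "\<bar>\<Sum>i\<in>UNIV. heat (\<alpha>(i := \<alpha> i + 2)) r (x - y)\<bar> \<le> (\<Sum>i\<in>UNIV. C i * exp (- c i * (norm y)\<^sup>2))"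
          by (intro order_trans[OF sum_abs] sum_mono bnd r')
        then show "\<bar>\<Sum>i\<in>UNIV. heat (\<alpha>(i := \<alpha> i + 2)) r (x - y)\<bar> * \<bar>f y\<bar> \<le>
            (\<Sum>i\<in>UNIV. C i * exp (- c i * (norm y)\<^sup>2)) * \<bar>f y\<bar>"
          by (rule mult_right_mono) simp
      qed (use r' in auto)
      also have "\<dots> = 4 * t * (\<Sum>i\<in>UNIV. C i * (exp (- c i * (norm y)\<^sup>2) * \<bar>f y\<bar>))"
        by (simp add: sum_distrib_right mult.assoc)
      finally show ?thesis .
    qed
    have "integrable lborel (\<lambda>y. \<bar>exp (- c i * (norm y)\<^sup>2) * f y\<bar>)" for i
      using f C by (intro integrable_abs) (auto simp: gauss_integrable_def)
    then show "integrable lborel (\<lambda>y. 4 * t * (\<Sum>i\<in>UNIV. C i * (exp (- c i * (norm y)\<^sup>2) * \<bar>f y\<bar>)))"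
      by (intro integrable_mult_right Bochner_Integration.integrable_sum) (simp add: abs_mult)
    show "(\<lambda>y. 2 * t * (\<Sum>i\<in>UNIV. heat (\<alpha>(i := \<alpha> i + 2)) t (x - y)) * f y) \<in> borel_measurable lborel"
      by measurable
  qed (use t in simp)
  also have "(LINT y|lborel. 2 * t * (\<Sum>i\<in>UNIV. heat (\<alpha>(i := \<alpha> i + 2)) t (x - y)) * f y) =
     (LINT y|lborel. 2 * t * (\<Sum>i\<in>UNIV. heat (\<alpha>(i := \<alpha> i + 2)) t (x - y) * f y))"
    by (simp add: sum_distrib_right mult.assoc)
  also have "\<dots> = 2 * t * (\<Sum>i\<in>UNIV. heat_conv (\<alpha>(i := \<alpha> i + 2)) f t x)"
    unfolding heat_conv_def by (simp add: heat_conv_integrable[OF f t])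
  finally show ?thesis .
qed

lemma heat_conv_measurable:
  fixes f :: "real^'n \<Rightarrow> real"
  assumes [measurable]: "f \<in> borel_measurable borel"
  shows "(\<lambda>z. heat_conv \<alpha> f (snd z) (fst z)) \<in> borel_measurable borel"
proof -
  have "(\<lambda>z. LINT y|lborel. (case (z, y) of (z, y) \<Rightarrow> heat \<alpha> (snd z) (fst z - y) * f y))
      \<in> borel_measurable (borel :: ((real^'n) \<times> real) measure)"
    by (rule lborel.borel_measurable_lebesgue_integral) (simp add: borel_prod[symmetric])
  then show ?thesis by (simp add: heat_conv_def)
qed

lemma heat_conv_measurable_compose [measurable (raw)]:
  fixes f :: "real^'n \<Rightarrow> real"
  assumes "f \<in> borel_measurable borel" and [measurable]: "g \<in> borel_measurable M" "h \<in> borel_measurable M"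
  shows "(\<lambda>z. heat_conv \<alpha> f (g z) (h z)) \<in> borel_measurable M"
proof -
  have "(\<lambda>z. (h z, g z)) \<in> measurable M (borel :: ((real^'n) \<times> real) measure)"
    by (simp add: borel_prod[symmetric])
  from measurable_compose[OF this heat_conv_measurable[OF assms(1)]] show ?thesis by simp
qed

text \<open>Since \<open>\<partial>\<^sub>t \<partial>\<^sup>\<alpha> W\<^sub>t = 2 t \<Delta> \<partial>\<^sup>\<alpha> W\<^sub>t\<close>, every derivative of order \<open>k\<close> in \<open>(x, t)\<close> of the extension
  is a combination of the functions \<open>t\<^bsup>|\<alpha>| - k\<^esup> (\<partial>\<^sup>\<alpha> W\<^sub>t * f)\<close> with \<open>|\<alpha>| \<ge> k\<close>.\<close>

inductive deriv_rep :: "nat \<Rightarrow> ((real^'n \<Rightarrow> real) \<Rightarrow> real \<Rightarrow> real^'n \<Rightarrow> real) \<Rightarrow> bool" where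
  zero: "deriv_rep k (\<lambda>f t x. 0)"
| basic: "k \<le> msize \<alpha> \<Longrightarrow> deriv_rep k (\<lambda>f t x. c * t ^ (msize \<alpha> - k) * heat_conv \<alpha> f t x)"
| add: "deriv_rep k G \<Longrightarrow> deriv_rep k H \<Longrightarrow> deriv_rep k (\<lambda>f t x. G f t x + H f t x)"

lemma deriv_rep_sum: "finite A \<Longrightarrow> (\<And>i. i \<in> A \<Longrightarrow> deriv_rep k (G i)) \<Longrightarrow> deriv_rep k (\<lambda>f t x. \<Sum>i\<in>A. G i f t x)"
proof (induction A rule: finite_induct)
  case empty
  then show ?case by (simp add: deriv_rep.zero)
next
  case (insert a A)
  then show ?case using deriv_rep.add[of k "G a" "\<lambda>f t x. \<Sum>i\<in>A. G i f t x"] by simp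
qed

lemma deriv_rep_deriv_x:
  fixes i :: "'n::finite" and G :: "(real^'n \<Rightarrow> real) \<Rightarrow> real \<Rightarrow> real^'n \<Rightarrow> real"
  shows "deriv_rep k G \<Longrightarrow> \<exists>H. deriv_rep (Suc k) H \<and> (\<forall>f t x. gauss_integrable f \<longrightarrow> t > 0 \<longrightarrow>
     ((\<lambda>r. G f t (x + r *\<^sub>R axis i 1)) has_real_derivative H f t x) (at 0))"
proof (induction rule: deriv_rep.induct)
  case (zero k)
  show ?case by (rule exI[of _ "\<lambda>f t x. 0"]) (auto intro: deriv_rep.zero)
next
  case (basic k \<alpha> c)
  have m: "msize (\<alpha>(i := Suc (\<alpha> i))) = Suc (msize \<alpha>)" using msize_upd[of \<alpha> i 1] by simp
  show ?case
  proof (intro exI[of _ "\<lambda>f t x. c * t ^ (msize \<alpha> - k) * heat_conv (\<alpha>(i := Suc (\<alpha> i))) f t x"] conjI allI impI)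
    show "deriv_rep (Suc k) (\<lambda>f t x. c * t ^ (msize \<alpha> - k) * heat_conv (\<alpha>(i := Suc (\<alpha> i))) f t x)"
      using deriv_rep.basic[of "Suc k" "\<alpha>(i := Suc (\<alpha> i))" c] basic unfolding m by simp
    fix f :: "real^'n \<Rightarrow> real" and t :: real and x :: "real^'n" assume "gauss_integrable f" "t > 0"
    from heat_conv_deriv_x[OF this, of \<alpha> x i 0]
    show "((\<lambda>r. c * t ^ (msize \<alpha> - k) * heat_conv \<alpha> f t (x + r *\<^sub>R axis i 1)) has_real_derivative
        c * t ^ (msize \<alpha> - k) * heat_conv (\<alpha>(i := Suc (\<alpha> i))) f t x) (at 0)"
      by (intro DERIV_cmult) simp
  qed
next
  case (add k G H)
  then obtain G' H' where "deriv_rep (Suc k) G'" "deriv_rep (Suc k) H'"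
    and d: "\<And>f t x. gauss_integrable f \<Longrightarrow> t > 0 \<Longrightarrow> ((\<lambda>r. G f t (x + r *\<^sub>R axis i 1)) has_real_derivative G' f t x) (at 0)"
     "\<And>f t x. gauss_integrable f \<Longrightarrow> t > 0 \<Longrightarrow> ((\<lambda>r. H f t (x + r *\<^sub>R axis i 1)) has_real_derivative H' f t x) (at 0)"
    by blast
  then show ?case
    by (intro exI[of _ "\<lambda>f t x. G' f t x + H' f t x"] conjI deriv_rep.add allI impI DERIV_add)
qed

lemma deriv_rep_deriv_t:
  fixes G :: "(real^'n \<Rightarrow> real) \<Rightarrow> real \<Rightarrow> real^'n \<Rightarrow> real"
  shows "deriv_rep k G \<Longrightarrow> \<exists>H. deriv_rep (Suc k) H \<and> (\<forall>f t x. gauss_integrable f \<longrightarrow> t > 0 \<longrightarrow>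
     ((\<lambda>t. G f t x) has_real_derivative H f t x) (at t))"
proof (induction rule: deriv_rep.induct)
  case (zero k)
  show ?case by (rule exI[of _ "\<lambda>f t x. 0"]) (auto intro: deriv_rep.zero)
next
  case (basic k \<alpha> c)
  define p where "p = msize \<alpha> - k"
  have m: "msize (\<alpha>(i := \<alpha> i + 2)) = msize \<alpha> + 2" for i by (rule msize_upd)
  \<comment> \<open>The product rule: \<open>A\<close> differentiates the power of \<open>t\<close>,
    \<open>B\<close> the convolution. The two new space derivatives in \<open>B\<close> and the new
    factor \<open>t\<close> fit together, since \<open>(msize \<alpha> + 2) - Suc k = p + 1\<close>.
    For \<open>p = 0\<close> the coefficient in \<open>A\<close> vanishes, so the truncated exponent
    \<open>p - 1\<close> does no harm.\<close>
  define A where "A = (\<lambda>f t x. c * real p * t ^ (p - 1) * heat_conv \<alpha> f t x)"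
  define B where "B = (\<lambda>f t x. \<Sum>i\<in>UNIV. (2 * c) * t ^ (p + 1) * heat_conv (\<alpha>(i := \<alpha> i + 2)) f t x)"
  have A: "deriv_rep (Suc k) A"
  proof (cases "p = 0")
    case True
    then show ?thesis by (simp add: A_def deriv_rep.zero)
  next
    case False
    then show ?thesis using deriv_rep.basic[of "Suc k" \<alpha> "c * real p"] by (simp add: A_def p_def)
  qed
  have B: "deriv_rep (Suc k) B"
    unfolding B_def
  proof (rule deriv_rep_sum)
    fix i
    have "msize (\<alpha>(i := \<alpha> i + 2)) - Suc k = p + 1" using basic unfolding m p_def by simp
    then show "deriv_rep (Suc k) (\<lambda>f t x. 2 * c * t ^ (p + 1) * heat_conv (\<alpha>(i := \<alpha> i + 2)) f t x)"
      using deriv_rep.basic[of "Suc k" "\<alpha>(i := \<alpha> i + 2)" "2 * c"] basic m[of i] by simp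
  qed simp
  show ?case
  proof (intro exI[of _ "\<lambda>f t x. A f t x + B f t x"] conjI allI impI deriv_rep.add A B)
    fix f :: "real^'n \<Rightarrow> real" and t :: real and x :: "real^'n" assume *: "gauss_integrable f" "t > 0"
    have "((\<lambda>t. c * t ^ p) has_real_derivative c * (real p * t ^ (p - 1))) (at t)"
      by (intro DERIV_cmult) (use DERIV_pow[of p t] in simp)
    from DERIV_mult[OF this heat_conv_deriv_t[OF *, of \<alpha> x]]
    show "((\<lambda>t. c * t ^ (msize \<alpha> - k) * heat_conv \<alpha> f t x) has_real_derivative A f t x + B f t x) (at t)"
      unfolding p_def[symmetric]
      by (rule DERIV_cong) (simp add: A_def B_def sum_distrib_left sum_distrib_right mult_ac)
  qed
next
  case (add k G H)
  then obtain G' H' where "deriv_rep (Suc k) G'" "deriv_rep (Suc k) H'"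
    and d: "\<And>f t x. gauss_integrable f \<Longrightarrow> t > 0 \<Longrightarrow> ((\<lambda>t. G f t x) has_real_derivative G' f t x) (at t)"
     "\<And>f t x. gauss_integrable f \<Longrightarrow> t > 0 \<Longrightarrow> ((\<lambda>t. H f t x) has_real_derivative H' f t x) (at t)"
    by blast
  then show ?case
    by (intro exI[of _ "\<lambda>f t x. G' f t x + H' f t x"] conjI deriv_rep.add allI impI DERIV_add)
qed

text \<open>The representation \<open>G\<close> depends on \<open>bs\<close> alone and not on
  \<open>f\<close>; this is where the uniformity of the final constant comes from. The function
  \<open>F\<close> is prescribed only for \<open>t > 0\<close>, as \<open>gauss_ext\<close> is
  meaningful only there.\<close>

lemma partials_deriv_rep:
  assumes "bs \<in> lists (Basis :: ((real^'n) \<times> real) set)"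
  shows "\<exists>G. deriv_rep (length bs) G \<and> (\<forall>f F. gauss_integrable f \<longrightarrow> (\<forall>t x. t > 0 \<longrightarrow> F (x, t) = heat_conv (\<lambda>_. 0) f t x) \<longrightarrow>
     (\<forall>t x. t > 0 \<longrightarrow> partials bs F (x, t) = G f t x))"
  using assms
proof (induction bs)
  case Nil
  have "deriv_rep 0 (\<lambda>f t x. heat_conv (\<lambda>_::'n. 0) f t x)"
    using deriv_rep.basic[where k = 0 and \<alpha> = "\<lambda>_::'n. 0" and c = 1] by simp
  then show ?case by (intro exI[of _ "\<lambda>f t x. heat_conv (\<lambda>_. 0) f t x"]) auto
next
  case (Cons b bs)
  then obtain G where G: "deriv_rep (length bs) G" and eq: "\<And>f F t x. gauss_integrable f \<Longrightarrow> (\<And>t x. t > 0 \<Longrightarrow> F (x, t) = heat_conv (\<lambda>_. 0) f t x) \<Longrightarrow>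
      t > 0 \<Longrightarrow> partials bs F (x, t) = G f t x" by auto
  from Cons have "b \<in> Basis" by auto
  then consider i where "b = (axis i 1, 0)" | "b = (0, 1)"
    by (auto simp: Basis_prod_def Basis_vec_real)
  then show ?case
  proof cases
    case 1
    obtain H where H: "deriv_rep (Suc (length bs)) H" and d: "\<And>f t x. gauss_integrable f \<Longrightarrow> t > 0 \<Longrightarrow>
       ((\<lambda>r. G f t (x + r *\<^sub>R axis i 1)) has_real_derivative H f t x) (at 0)"
      using deriv_rep_deriv_x[OF G, of i] by blast
    show ?thesis
    proof (intro exI[of _ H] conjI allI impI)
      show "deriv_rep (length (b # bs)) H" using H by simp
      fix f :: "real^'n \<Rightarrow> real" and F t x assume f: "gauss_integrable f" and F: "\<forall>t x. t > 0 \<longrightarrow> F (x, t) = heat_conv (\<lambda>_. 0) f t x" and t: "t > (0::real)"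
      have "partials (b # bs) F (x, t) = deriv (\<lambda>r. G f t (x + r *\<^sub>R axis i 1)) 0"
        using F t by (simp add: partial_def 1 eq[OF f])
      also have "\<dots> = H f t x" using d[OF f t] by (rule DERIV_imp_deriv)
      finally show "partials (b # bs) F (x, t) = H f t x" .
    qed
  next
    case 2
    obtain H where H: "deriv_rep (Suc (length bs)) H" and d: "\<And>f t x. gauss_integrable f \<Longrightarrow> t > 0 \<Longrightarrow>
       ((\<lambda>t. G f t x) has_real_derivative H f t x) (at t)"
      using deriv_rep_deriv_t[OF G] by blast
    show ?thesis
    proof (intro exI[of _ H] conjI allI impI)
      show "deriv_rep (length (b # bs)) H" using H by simp
      fix f :: "real^'n \<Rightarrow> real" and F t x assume f: "gauss_integrable f" and F: "\<forall>t x. t > 0 \<longrightarrow> F (x, t) = heat_conv (\<lambda>_. 0) f t x" and t: "t > (0::real)"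
      \<comment> \<open>For a derivative in \<open>t\<close> the identity
        \<open>F = heat_conv\<close> is available only while \<open>t + r\<close> stays positive,
        which suffices for a derivative at \<open>r = 0\<close>.\<close>
      have ev: "\<forall>\<^sub>F r in nhds 0. r \<in> {-t<..<t}"
        using t by (intro eventually_nhds_in_open) auto
      have "partials (b # bs) F (x, t) = deriv (\<lambda>r. partials bs F (x, t + r)) 0"
        by (simp add: partial_def 2)
      also have "\<dots> = deriv (\<lambda>r. G f (t + r) x) 0"
        by (rule deriv_cong_ev[OF _ refl], use ev in eventually_elim) (use F in \<open>auto intro!: eq[OF f]\<close>)
      also have "\<dots> = H f t x"
      proof (rule DERIV_imp_deriv)
        show "((\<lambda>r. G f (t + r) x) has_real_derivative H f t x) (at 0)"
          using DERIV_shift[of "\<lambda>s. G f s x" "H f t x" 0 t] d[OF f t] by (simp add: add.commute)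
      qed
      finally show "partials (b # bs) F (x, t) = H f t x" .
    qed
  qed
qed

section \<open>The semigroup property\<close>

lemma gauss_integrable_integrable: "gauss_integrable f \<Longrightarrow> c > 0 \<Longrightarrow> integrable lborel (\<lambda>x. exp (- c * (norm x)\<^sup>2) * f x)"
  by (simp add: gauss_integrable_def)

lemma gauss_integrable_bounded_gauss:
  assumes [measurable]: "g \<in> borel_measurable borel" and "\<And>x. \<bar>g x\<bar> \<le> C"
  shows "gauss_integrable (g :: real^'n \<Rightarrow> real)"
  unfolding gauss_integrable_def
proof (intro conjI allI impI)
  fix c :: real assume c: "c > 0"
  show "integrable lborel (\<lambda>x. exp (- c * (norm x)\<^sup>2) * g x)"
  proof (rule Bochner_Integration.integrable_bound[OF integrable_mult_left[OF integrable_gauss[OF c], of C]])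
    have "C \<ge> 0" using assms(2)[of 0] by linarith
    then show "AE x in lborel. norm (exp (- c * (norm x)\<^sup>2) * g x) \<le> norm (exp (- c * (norm x)\<^sup>2) * C)"
      using assms(2) by (auto simp: abs_mult)
  qed measurable
qed measurable

lemma gauss_integrable_heat:
  assumes "t > 0"
  shows "gauss_integrable (heat \<alpha> t :: real^'n \<Rightarrow> real)"
proof -
  obtain C where C: "C > 0" "\<And>x. \<bar>heat \<alpha> t (x::real^'n)\<bar> \<le> C / t ^ (CARD('n) + msize \<alpha>) * exp (- (norm x)\<^sup>2 / (8 * t\<^sup>2))"
    using heat_bound[of \<alpha>] assms by blast
  have "\<bar>heat \<alpha> t (x::real^'n)\<bar> \<le> C / t ^ (CARD('n) + msize \<alpha>)" for x
    by (rule order_trans[OF C(2)]) (use C(1) assms in \<open>auto intro!: divide_right_mono\<close>)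
  then show ?thesis by (intro gauss_integrable_bounded_gauss) measurable
qed

section \<open>Multi-indices and cancellation of the differentiated kernel\<close>

lemma multi_index_induct [case_names zero step]:
  fixes P :: "('n::finite \<Rightarrow> nat) \<Rightarrow> bool"
  assumes z: "P (\<lambda>_. 0)" and s: "\<And>\<alpha> i. P \<alpha> \<Longrightarrow> P (\<alpha>(i := Suc (\<alpha> i)))"
  shows "P \<alpha>"
proof (induction "msize \<alpha>" arbitrary: \<alpha>)
  case 0
  then have "\<alpha> = (\<lambda>_. 0)" by (auto simp: fun_eq_iff)
  then show ?case using z by simp
next
  case (Suc k)
  then obtain i where i: "\<alpha> i \<noteq> 0" by (metis sum.neutral Zero_not_Suc)
  define \<beta> where "\<beta> = \<alpha>(i := \<alpha> i - 1)"
  have \<alpha>: "\<alpha> = \<beta>(i := Suc (\<beta> i))" using i by (auto simp: \<beta>_def)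
  have "msize \<alpha> = msize \<beta> + 1" using msize_upd[of \<beta> i 1] \<alpha> by simp
  then have "P \<beta>" using Suc by simp
  then show ?case using s \<alpha> by metis
qed

lemma multi_index_split:
  fixes \<gamma> :: "'n::finite \<Rightarrow> nat"
  shows "k \<le> msize \<gamma> \<Longrightarrow> \<exists>\<alpha> \<beta>. \<gamma> = (\<lambda>i. \<alpha> i + \<beta> i) \<and> msize \<beta> = k"
proof (induction k)
  case 0
  show ?case by (intro exI[of _ \<gamma>] exI[of _ "\<lambda>_. 0"]) auto
next
  case (Suc k)
  then obtain \<alpha> \<beta> where *: "\<gamma> = (\<lambda>i. \<alpha> i + \<beta> i)" "msize \<beta> = k" by auto
  have "msize \<gamma> = msize \<alpha> + k" using * by (simp add: sum.distrib)
  then have "msize \<alpha> \<noteq> 0" using Suc.prems by linarith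
  then obtain i where i: "\<alpha> i \<noteq> 0" by (metis sum.neutral)
  have "\<gamma> = (\<lambda>j. (\<alpha>(i := \<alpha> i - 1)) j + (\<beta>(i := Suc (\<beta> i))) j)" using i * by auto
  moreover have "msize (\<beta>(i := Suc (\<beta> i))) = Suc k" using msize_upd[of \<beta> i 1] * by simp
  ultimately show ?case by blast
qed

text \<open>By translation invariance the integral of \<open>heat \<beta>' t (x - y)\<close> over
  \<open>y\<close> does not depend on \<open>x\<close>; its derivative in a direction
  \<open>i\<close> with \<open>\<beta> i \<noteq> 0\<close> is the claimed integral.\<close>

lemma heat_conv_const_deriv:
  assumes "msize \<beta> > 0" "t > 0"
  shows "heat_conv \<beta> (\<lambda>_. 1) t (x::real^'n) = 0"
proof -
  obtain i where i: "\<beta> i \<noteq> 0" using assms(1) by (metis sum.neutral less_irrefl)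
  define \<beta>' where "\<beta>' = \<beta>(i := \<beta> i - 1)"
  have \<beta>: "\<beta> = \<beta>'(i := Suc (\<beta>' i))" using i by (auto simp: \<beta>'_def)
  have c: "heat_conv \<beta>' (\<lambda>_. 1) t x = heat_conv \<beta>' (\<lambda>_. 1) t 0" for x :: "real^'n"
    unfolding heat_conv_def using integral_lborel_reflect[of "\<lambda>y. heat \<beta>' t y" x] integral_lborel_reflect[of "\<lambda>y. heat \<beta>' t y" 0]
    by simp
  have "gauss_integrable (\<lambda>_::real^'n. 1)" by (rule gauss_integrable_bounded_gauss[where C = 1]) auto
  from heat_conv_deriv_x[OF this assms(2), of \<beta>' x i 0]
  have "((\<lambda>r. heat_conv \<beta>' (\<lambda>_. 1) t (x + r *\<^sub>R axis i 1)) has_real_derivative heat_conv \<beta> (\<lambda>_. 1) t x) (at 0)"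
    using \<beta> by simp
  moreover have "((\<lambda>r. heat_conv \<beta>' (\<lambda>_. 1) t (x + r *\<^sub>R axis i 1)) has_real_derivative 0) (at 0)"
    by (subst c) simp
  ultimately show ?thesis by (rule DERIV_unique)
qed

lemma heat1_0_normal: "t > 0 \<Longrightarrow> heat1 0 t y = normal_density 0 (sqrt 2 * t) y"
  by (simp add: heat1_def normal_density_def real_sqrt_mult power_mult_distrib power_divide mult.commute)

text \<open>\<open>heat1 0 t\<close> is the centred normal density of variance
  \<open>2 * t\<^sup>2\<close>. Variances add under convolution, so the scale \<open>t\<close> is
  multiplied by \<open>sqrt 2\<close>.\<close>

lemma heat1_conv:
  assumes "t > 0"
  shows "(\<integral>\<^sup>+y. ennreal (heat1 0 t (x - y) * heat1 0 t y) \<partial>lborel) = ennreal (heat1 0 (sqrt 2 * t) x)"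
proof -
  have "sqrt ((sqrt 2 * t)\<^sup>2 + (sqrt 2 * t)\<^sup>2) = sqrt 2 * (sqrt 2 * t)"
    using assms by (simp add: power_mult_distrib real_sqrt_mult)
  then show ?thesis
    using conv_normal_density_zero_mean[of "sqrt 2 * t" "sqrt 2 * t"] assms
    by (simp add: heat1_0_normal fun_eq_iff)
qed

lemma heat1_0_nonneg: "t > 0 \<Longrightarrow> heat1 0 t y \<ge> 0"
  by (simp add: heat1_def)

lemma heat_0_conv:
  assumes "t > 0"
  shows "heat_conv (\<lambda>_. 0) (heat (\<lambda>_. 0) t) t x = heat (\<lambda>_. 0) (sqrt 2 * t) (x::real^'n)"
proof -
  have nn: "heat (\<lambda>_. 0) s z \<ge> 0" if "s > 0" for s and z :: "real^'n"
    using that by (auto simp: heat_def intro!: prod_nonneg heat1_0_nonneg)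
  have "(\<integral>\<^sup>+y. ennreal (heat (\<lambda>_. 0) t (x - y) * heat (\<lambda>_. 0) t y) \<partial>lborel) =
     (\<integral>\<^sup>+y. ennreal (\<Prod>i\<in>UNIV. heat1 0 t (x $ i - y $ i) * heat1 0 t (y $ i)) \<partial>lborel)"
    by (simp add: heat_def prod.distrib)
  also have "\<dots> = (\<Prod>i\<in>UNIV. \<integral>\<^sup>+y. ennreal (heat1 0 t (x $ i - y) * heat1 0 t y) \<partial>lborel)"
    by (rule nn_integral_lborel_vec_prod) (auto intro!: mult_nonneg_nonneg heat1_0_nonneg assms)
  also have "\<dots> = (\<Prod>i\<in>UNIV. ennreal (heat1 0 (sqrt 2 * t) (x $ i)))"
    using assms by (simp add: heat1_conv)
  also have "\<dots> = ennreal (heat (\<lambda>_. 0) (sqrt 2 * t) x)"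
    unfolding heat_def using assms by (intro prod_ennreal heat1_0_nonneg) simp
  finally show ?thesis
    unfolding heat_conv_def using assms by (subst integral_eq_nn_integral) (auto simp: nn)
qed

text \<open>Differentiating the identity for the plain kernels in \<open>x\<close> puts derivatives
  on the left factor only. Commutativity of the convolution moves them to the right factor, and a
  second induction then adds \<open>\<alpha>\<close> on the left.\<close>

lemma heat_conv:
  assumes "t > 0"
  shows "heat_conv \<alpha> (heat \<beta> t) t x = heat (\<lambda>i. \<alpha> i + \<beta> i) (sqrt 2 * t) (x::real^'n)"
proof -
  have t2: "sqrt 2 * t \<noteq> 0" using assms by simp
  have stp: "heat_conv (\<alpha>(i := Suc (\<alpha> i))) (heat \<beta> t) t x = heat (\<gamma>(i := Suc (\<gamma> i))) (sqrt 2 * t) x"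
    if "\<And>x. heat_conv \<alpha> (heat \<beta> t) t x = heat \<gamma> (sqrt 2 * t) x" for \<alpha> \<beta> \<gamma> i and x :: "real^'n"
    using heat_conv_deriv_x[OF gauss_integrable_heat[OF assms] assms, of \<alpha> \<beta> x i 0] heat_deriv_x[OF t2, of \<gamma> x i 0]
    unfolding that by (auto dest: DERIV_unique)
  have 1: "heat_conv \<beta> (heat (\<lambda>_. 0) t) t x = heat \<beta> (sqrt 2 * t) x" for \<beta> and x :: "real^'n"
  proof (induction \<beta> arbitrary: x rule: multi_index_induct)
    case zero
    show ?case by (rule heat_0_conv[OF assms])
  next
    case (step \<alpha> i)
    then show ?case using stp by blast
  qed
  show ?thesis
  proof (induction \<alpha> arbitrary: x rule: multi_index_induct)
    case zero
    have "heat_conv (\<lambda>_. 0) (heat \<beta> t) t x = heat_conv \<beta> (heat (\<lambda>_. 0) t) t x"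
      unfolding heat_conv_def using integral_lborel_reflect[of "\<lambda>y. heat (\<lambda>_. 0) t (x - y) * heat \<beta> t y" x]
      by (simp add: mult.commute)
    then show ?case by (simp add: 1)
  next
    case (step \<alpha> i)
    have "(\<lambda>j. (\<alpha>(i := Suc (\<alpha> i))) j + \<beta> j) = (\<lambda>j. \<alpha> j + \<beta> j)(i := Suc ((\<lambda>j. \<alpha> j + \<beta> j) i))"
      by auto
    then show ?case
      using stp[OF step]
      by metis
  qed
qed

text \<open>Fubini reduces this to the convolution identity for the kernels. The double integrand is
  dominated by a Gaussian in \<open>x - y\<close> times a Gaussian in \<open>z\<close> weighted with
  \<open>f\<close>, a product of integrable functions.\<close>

lemma heat_conv_semigroup:
  assumes f: "gauss_integrable f" and t: "t > 0"
  shows "heat_conv (\<lambda>i. \<alpha> i + \<beta> i) f (sqrt 2 * t) x = (LINT y|lborel. heat \<alpha> t (x - y) * heat_conv \<beta> f t (y::real^'n))"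
proof -
  have [measurable]: "f \<in> borel_measurable borel" using f by (simp add: gauss_integrable_def)
  obtain A where A: "A > 0" "\<And>x. \<bar>heat \<alpha> t (x::real^'n)\<bar> \<le> A / t ^ (CARD('n) + msize \<alpha>) * exp (- (norm x)\<^sup>2 / (8 * t\<^sup>2))"
    using heat_bound[of \<alpha>] t by blast
  obtain B where B: "B > 0" "\<And>x. \<bar>heat \<beta> t (x::real^'n)\<bar> \<le> B / t ^ (CARD('n) + msize \<beta>) * exp (- (norm x)\<^sup>2 / (8 * t\<^sup>2))"
    using heat_bound[of \<beta>] t by blast
  define A' where "A' = A / t ^ (CARD('n) + msize \<alpha>)"
  define B' where "B' = B / t ^ (CARD('n) + msize \<beta>)"
  define c where "c = 1 / (8 * t\<^sup>2)"
  have c: "c > 0" using t by (simp add: c_def)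
  have AB: "A' \<ge> 0" "B' \<ge> 0" using A(1) B(1) t by (auto simp: A'_def B'_def)
  \<comment> \<open>The exponent is divided up: half of the decay in \<open>x - y\<close> is kept
    for integrating over \<open>y\<close>, while half of the decay in both variables dominates
    \<open>c / 8 * (norm z)\<^sup>2 - c / 4 * (norm x)\<^sup>2\<close> and makes \<open>f\<close>
    integrable.\<close>
  have kb: "\<bar>heat \<alpha> t (x - y) * (heat \<beta> t (y - z) * f z)\<bar> \<le> A' * B' * exp (c / 4 * (norm x)\<^sup>2) *
      (exp (- (c / 2) * (norm (x - y))\<^sup>2) * \<bar>exp (- (c / 8) * (norm z)\<^sup>2) * f z\<bar>)" for y z
  proof -
    have "(norm (x - z))\<^sup>2 \<le> (norm (x - y) + norm (y - z))\<^sup>2"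
      using norm_triangle_ineq[of "x - y" "y - z"] by (intro power_mono) auto
    also have "\<dots> \<le> 2 * (norm (x - y))\<^sup>2 + 2 * (norm (y - z))\<^sup>2"
      using zero_le_power2[of "norm (x - y) - norm (y - z)"] by (simp add: power2_sum power2_diff)
    finally have "2 * (norm (x - y))\<^sup>2 + 2 * (norm (y - z))\<^sup>2 \<ge> (norm z)\<^sup>2 / 2 - (norm x)\<^sup>2"
      using norm_diff_sq_ge[of z x] by linarith
    then have "c / 4 * ((norm z)\<^sup>2 / 2 - (norm x)\<^sup>2) \<le> c / 4 * (2 * (norm (x - y))\<^sup>2 + 2 * (norm (y - z))\<^sup>2)"
      using c by (intro mult_left_mono) auto
    moreover have "0 \<le> c * (norm (y - z))\<^sup>2" using c by simp
    ultimately have e: "- c * (norm (x - y))\<^sup>2 + (- c * (norm (y - z))\<^sup>2) \<le>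
      c / 4 * (norm x)\<^sup>2 + (- (c / 2) * (norm (x - y))\<^sup>2) + (- (c / 8) * (norm z)\<^sup>2)"
      by (simp add: algebra_simps)
    have "\<bar>heat \<alpha> t (x - y) * (heat \<beta> t (y - z) * f z)\<bar> = \<bar>heat \<alpha> t (x - y)\<bar> * \<bar>heat \<beta> t (y - z)\<bar> * \<bar>f z\<bar>"
      by (simp add: abs_mult)
    also have "\<dots> \<le> (A' * exp (- c * (norm (x - y))\<^sup>2)) * (B' * exp (- c * (norm (y - z))\<^sup>2)) * \<bar>f z\<bar>"
      using A(2)[of "x - y"] B(2)[of "y - z"] AB
      by (intro mult_mono mult_nonneg_nonneg) (auto simp: A'_def B'_def c_def)
    also have "\<dots> = A' * B' * exp (- c * (norm (x - y))\<^sup>2 + (- c * (norm (y - z))\<^sup>2)) * \<bar>f z\<bar>"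
      unfolding exp_add by (simp only: mult_ac)
    also have "\<dots> \<le> A' * B' * exp (c / 4 * (norm x)\<^sup>2 + (- (c / 2) * (norm (x - y))\<^sup>2) + (- (c / 8) * (norm z)\<^sup>2)) * \<bar>f z\<bar>"
      using e AB by (intro mult_right_mono mult_left_mono) auto
    also have "\<dots> = A' * B' * exp (c / 4 * (norm x)\<^sup>2) *
      (exp (- (c / 2) * (norm (x - y))\<^sup>2) * \<bar>exp (- (c / 8) * (norm z)\<^sup>2) * f z\<bar>)"
      unfolding exp_add abs_mult abs_exp_cancel by (simp only: mult_ac)
    finally show ?thesis .
  qed
  have gx: "integrable lborel (\<lambda>y. exp (- (c / 2) * (norm (x - y))\<^sup>2))"
    using integrable_lborel_reflect[of "\<lambda>y. exp (- (c / 2) * (norm y)\<^sup>2)" x] integrable_gauss[of "c/2"] c by simp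
  have gf: "integrable lborel (\<lambda>z. \<bar>exp (- (c / 8) * (norm z)\<^sup>2) * f z\<bar>)"
    using gauss_integrable_integrable[OF f, of "c/8"] c by (intro integrable_abs) simp
  have int: "integrable (lborel \<Otimes>\<^sub>M lborel) (\<lambda>(y, z). heat \<alpha> t (x - y) * (heat \<beta> t (y - z) * f z))"
  proof (rule Bochner_Integration.integrable_bound)
    show "integrable (lborel \<Otimes>\<^sub>M lborel) (\<lambda>(y, z). A' * B' * exp (c / 4 * (norm x)\<^sup>2) *
      (exp (- (c / 2) * (norm (x - y))\<^sup>2) * \<bar>exp (- (c / 8) * (norm z)\<^sup>2) * f z\<bar>))"
    proof (rule lborel_pair.Fubini_integrable)
      have [simp]: "\<bar>A' * B'\<bar> = A' * B'" using AB by simp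
      show "integrable lborel (\<lambda>y. LINT z|lborel. norm (case (y, z) of (y, z) \<Rightarrow> A' * B' * exp (c / 4 * (norm x)\<^sup>2) *
      (exp (- (c / 2) * (norm (x - y))\<^sup>2) * \<bar>exp (- (c / 8) * (norm z)\<^sup>2) * f z\<bar>)))"
        using gx by (simp add: abs_mult)
      show "AE y in lborel. integrable lborel (\<lambda>z. case (y, z) of (y, z) \<Rightarrow> A' * B' * exp (c / 4 * (norm x)\<^sup>2) *
      (exp (- (c / 2) * (norm (x - y))\<^sup>2) * \<bar>exp (- (c / 8) * (norm z)\<^sup>2) * f z\<bar>))"
        using gf by (intro AE_I2) (simp del: abs_mult)
    qed measurable
    show "AE p in lborel \<Otimes>\<^sub>M lborel. norm (case p of (y, z) \<Rightarrow> heat \<alpha> t (x - y) * (heat \<beta> t (y - z) * f z)) \<le>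
       norm (case p of (y, z) \<Rightarrow> A' * B' * exp (c / 4 * (norm x)\<^sup>2) *
      (exp (- (c / 2) * (norm (x - y))\<^sup>2) * \<bar>exp (- (c / 8) * (norm z)\<^sup>2) * f z\<bar>))"
    proof (rule AE_I2, clarify)
      fix y z
      show "norm (heat \<alpha> t (x - y) * (heat \<beta> t (y - z) * f z)) \<le> norm (A' * B' * exp (c / 4 * (norm x)\<^sup>2) *
      (exp (- (c / 2) * (norm (x - y))\<^sup>2) * \<bar>exp (- (c / 8) * (norm z)\<^sup>2) * f z\<bar>))"
        unfolding real_norm_def by (rule order_trans[OF kb abs_ge_self])
    qed
  qed measurable
  have inner: "(LINT y|lborel. heat \<alpha> t (x - y) * (heat \<beta> t (y - z) * f z)) = heat (\<lambda>i. \<alpha> i + \<beta> i) (sqrt 2 * t) (x - z) * f z" for z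
  proof -
    have "(LINT y|lborel. heat \<alpha> t (x - y) * (heat \<beta> t (y - z) * f z)) = (LINT y|lborel. (heat \<alpha> t (x - y) * heat \<beta> t (y - z)) * f z)"
      by (simp add: mult.assoc)
    also have "\<dots> = (LINT y|lborel. heat \<alpha> t (x - y) * heat \<beta> t (y - z)) * f z"
      by (rule integral_mult_left_zero)
    also have "(LINT y|lborel. heat \<alpha> t (x - y) * heat \<beta> t (y - z)) = heat_conv \<alpha> (heat \<beta> t) t (x - z)"
      unfolding heat_conv_def using integral_lborel_translate[of "\<lambda>y. heat \<alpha> t (x - y) * heat \<beta> t (y - z)" z]
      by (simp add: algebra_simps)
    finally show ?thesis by (simp add: heat_conv[OF t])
  qed
  have "heat_conv (\<lambda>i. \<alpha> i + \<beta> i) f (sqrt 2 * t) x = (LINT z|lborel. (LINT y|lborel. heat \<alpha> t (x - y) * (heat \<beta> t (y - z) * f z)))"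
    unfolding heat_conv_def[of "\<lambda>i. \<alpha> i + \<beta> i"] inner ..
  also have "\<dots> = (LINT y|lborel. (LINT z|lborel. heat \<alpha> t (x - y) * (heat \<beta> t (y - z) * f z)))"
    by (rule lborel_pair.Fubini_integral[OF int])
  also have "\<dots> = (LINT y|lborel. heat \<alpha> t (x - y) * heat_conv \<beta> f t y)"
    unfolding heat_conv_def by simp
  finally show ?thesis .
qed

text \<open>Scaling by \<open>t\<close>: the dominating Gaussian has mass proportional to
  \<open>t ^ CARD('n)\<close>, which cancels that power in the kernel bound.\<close>

lemma heat_L1:
  fixes \<alpha> :: "'n::finite \<Rightarrow> nat"
  shows "\<exists>C\<ge>0. \<forall>t>0. (\<integral>\<^sup>+x. ennreal \<bar>heat \<alpha> t x\<bar> \<partial>lborel) \<le> ennreal (C / t ^ msize \<alpha>)"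
proof -
  obtain A where A: "A > 0" "\<And>t x. t > 0 \<Longrightarrow> \<bar>heat \<alpha> t (x::real^'n)\<bar> \<le> A / t ^ (CARD('n) + msize \<alpha>) * exp (- (norm x)\<^sup>2 / (8 * t\<^sup>2))"
    using heat_bound[of \<alpha>] by blast
  define G where "G = (\<integral>\<^sup>+x. ennreal (exp (- (1/8) * (norm (x::real^'n))\<^sup>2)) \<partial>lborel)"
  have G: "G < \<infinity>"
    using integrable_gauss[of "1/8", where 'n = 'n] unfolding integrable_iff_bounded G_def by simp
  have "(\<integral>\<^sup>+x. ennreal \<bar>heat \<alpha> t (x::real^'n)\<bar> \<partial>lborel) \<le> ennreal (A * enn2real G / t ^ msize \<alpha>)" if t: "t > 0" for t
  proof -
    have "(\<integral>\<^sup>+x. ennreal \<bar>heat \<alpha> t (x::real^'n)\<bar> \<partial>lborel) \<le>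
       (\<integral>\<^sup>+x. ennreal (A / t ^ (CARD('n) + msize \<alpha>)) * ennreal (exp (- (norm (x::real^'n))\<^sup>2 / (8 * t\<^sup>2))) \<partial>lborel)"
      using A t by (intro nn_integral_mono) (auto simp flip: ennreal_mult intro!: ennreal_leI)
    also have "\<dots> = ennreal (A / t ^ (CARD('n) + msize \<alpha>)) * (\<integral>\<^sup>+x. ennreal (exp (- (norm (x::real^'n))\<^sup>2 / (8 * t\<^sup>2))) \<partial>lborel)"
      by (rule nn_integral_cmult) simp
    also have "(\<integral>\<^sup>+x. ennreal (exp (- (norm (x::real^'n))\<^sup>2 / (8 * t\<^sup>2))) \<partial>lborel) = ennreal (t ^ CARD('n)) * G"
      using t unfolding G_def
      by (subst nn_integral_lborel_affine[where c = t and t = 0]) (auto simp: power_mult_distrib)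
    also have "ennreal (A / t ^ (CARD('n) + msize \<alpha>)) * (ennreal (t ^ CARD('n)) * G) = ennreal (A / t ^ msize \<alpha>) * G"
      unfolding mult.assoc[symmetric]
      by (subst ennreal_mult[symmetric]) (use A t in \<open>auto simp: power_add\<close>)
    also have "G = ennreal (enn2real G)" using G by simp
    also have "ennreal (A / t ^ msize \<alpha>) * ennreal (enn2real G) = ennreal (A * enn2real G / t ^ msize \<alpha>)"
      using A t by (subst ennreal_mult[symmetric]) auto
    finally show ?thesis by simp
  qed
  then show ?thesis using A by (intro exI[of _ "A * enn2real G"]) auto
qed

text \<open>Young's inequality in L1: Tonelli and translation invariance separate the two
  factors.\<close>

lemma nn_integral_convolution_le:
  fixes k v :: "real^'n \<Rightarrow> real"
  assumes [measurable]: "k \<in> borel_measurable borel" "v \<in> borel_measurable borel"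
  shows "(\<integral>\<^sup>+x. ennreal \<bar>LINT y|lborel. k (x - y) * v y\<bar> \<partial>lborel) \<le>
     (\<integral>\<^sup>+x. ennreal \<bar>k x\<bar> \<partial>lborel) * (\<integral>\<^sup>+x. ennreal \<bar>v x\<bar> \<partial>lborel)"
proof -
  have "(\<integral>\<^sup>+x. ennreal \<bar>LINT y|lborel. k (x - y) * v y\<bar> \<partial>lborel) \<le>
      (\<integral>\<^sup>+x. \<integral>\<^sup>+y. ennreal \<bar>k (x - y)\<bar> * ennreal \<bar>v y\<bar> \<partial>lborel \<partial>lborel)"
  proof (rule nn_integral_mono)
    fix x
    show "ennreal \<bar>LINT y|lborel. k (x - y) * v y\<bar> \<le> (\<integral>\<^sup>+y. ennreal \<bar>k (x - y)\<bar> * ennreal \<bar>v y\<bar> \<partial>lborel)"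
    \<comment> \<open>Where the convolution diverges its Bochner integral is 0 by convention, so the
      inequality is trivial there.\<close>
    proof (cases "integrable lborel (\<lambda>y. k (x - y) * v y)")
      case True
      from integral_norm_bound_ennreal[OF this] show ?thesis by (simp add: abs_mult ennreal_mult)
    qed (simp add: not_integrable_integral_eq)
  qed
  also have "\<dots> = (\<integral>\<^sup>+y. \<integral>\<^sup>+x. ennreal \<bar>k (x - y)\<bar> * ennreal \<bar>v y\<bar> \<partial>lborel \<partial>lborel)"
    by (rule lborel_pair.Fubini') measurable
  also have "\<dots> = (\<integral>\<^sup>+y. (\<integral>\<^sup>+x. ennreal \<bar>k x\<bar> \<partial>lborel) * ennreal \<bar>v y\<bar> \<partial>lborel)"
  proof (rule nn_integral_cong)
    fix y
    show "(\<integral>\<^sup>+x. ennreal \<bar>k (x - y)\<bar> * ennreal \<bar>v y\<bar> \<partial>lborel) = (\<integral>\<^sup>+x. ennreal \<bar>k x\<bar> \<partial>lborel) * ennreal \<bar>v y\<bar>"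
      using nn_integral_lborel_translate[of "\<lambda>x. ennreal \<bar>k x\<bar>" "- y"]
      by (subst nn_integral_multc) (auto simp: algebra_simps)
  qed
  also have "\<dots> = (\<integral>\<^sup>+x. ennreal \<bar>k x\<bar> \<partial>lborel) * (\<integral>\<^sup>+x. ennreal \<bar>v x\<bar> \<partial>lborel)"
    by (rule nn_integral_cmult) simp
  finally show ?thesis .
qed

section \<open>Estimates by differences\<close>

definition diff_modulus :: "nat \<Rightarrow> (real^'n \<Rightarrow> real) \<Rightarrow> real^'n \<Rightarrow> ennreal" where
  "diff_modulus k g h = (\<integral>\<^sup>+x. ennreal \<bar>fdiff k h g x\<bar> \<partial>lborel)"

lemma fdiff_1: "fdiff (Suc 0) h g x = g (x + h) - g x"
  by simp

lemma fdiff_2: "fdiff 2 h g x = g (x + 2 *\<^sub>R h) - 2 * g (x + h) + g x"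
  by (simp add: numeral_2_eq_2 scaleR_2 add.assoc)

lemma fdiff_measurable:
  fixes g :: "'a::euclidean_space \<Rightarrow> real"
  assumes "g \<in> borel_measurable borel"
  shows "(\<lambda>(h, x). fdiff k h g x) \<in> borel_measurable (borel \<Otimes>\<^sub>M borel)"
proof -
  \<comment> \<open>Each step of the recursion replaces the function by one that depends on
    \<open>h\<close>, so the induction must treat families \<open>F h\<close>.\<close>
  have "(\<lambda>(h, x). fdiff k h (F h) x) \<in> borel_measurable (borel \<Otimes>\<^sub>M borel)"
    if "(\<lambda>(h, x). F h x) \<in> borel_measurable (borel \<Otimes>\<^sub>M borel)" for F :: "'a \<Rightarrow> 'a \<Rightarrow> real"
    using that
  proof (induction k arbitrary: F)
    case (Suc k)
    have "(\<lambda>p. (\<lambda>(h, x). F h x) (fst p, snd p + fst p) - (\<lambda>(h, x). F h x) p) \<in> borel_measurable (borel \<Otimes>\<^sub>M borel)"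
      using Suc.prems by measurable
    then have "(\<lambda>(h, x). F h (x + h) - F h x) \<in> borel_measurable (borel \<Otimes>\<^sub>M borel)"
      by (simp add: case_prod_beta)
    from Suc.IH[OF this] show ?case by simp
  qed simp
  from this[of "\<lambda>_. g"] assms show ?thesis by simp
qed

lemma diff_modulus_measurable [measurable]:
  fixes g :: "real^'n \<Rightarrow> real"
  assumes [measurable]: "g \<in> borel_measurable borel"
  shows "diff_modulus k g \<in> borel_measurable borel"
proof -
  have [measurable]: "(\<lambda>(h, x). fdiff k h g x) \<in> borel_measurable (borel \<Otimes>\<^sub>M borel)"
    by (rule fdiff_measurable) fact
  have "(\<lambda>h. \<integral>\<^sup>+x. ennreal \<bar>(\<lambda>(h, x). fdiff k h g x) (h, x)\<bar> \<partial>lborel) \<in> borel_measurable borel"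
    by (rule lborel.borel_measurable_nn_integral) (simp add: split_beta' cong: measurable_cong_sets)
  then show ?thesis unfolding diff_modulus_def[abs_def] by simp
qed

text \<open>The vanishing integral of the kernel allows \<open>g x\<close> to be subtracted from
  \<open>g y\<close>. With \<open>y = x + h\<close> the kernel is evaluated at \<open>- h\<close>,
  and Tonelli in \<open>x\<close> and \<open>h\<close> produces \<open>diff_modulus\<close>.\<close>

lemma heat_conv_first_difference:
  assumes g: "gauss_integrable g" and t: "t > 0" and m: "msize \<alpha> > 0"
  shows "(\<integral>\<^sup>+x. ennreal \<bar>heat_conv \<alpha> g t (x::real^'n)\<bar> \<partial>lborel) \<le> (\<integral>\<^sup>+h. ennreal \<bar>heat \<alpha> t (- h)\<bar> * diff_modulus (Suc 0) g h \<partial>lborel)"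
proof -
  have [measurable]: "g \<in> borel_measurable borel" using g by (simp add: gauss_integrable_def)
  have "(\<integral>\<^sup>+x. ennreal \<bar>heat_conv \<alpha> g t x\<bar> \<partial>lborel) \<le>
      (\<integral>\<^sup>+x. \<integral>\<^sup>+h. ennreal \<bar>heat \<alpha> t (- h)\<bar> * ennreal \<bar>fdiff (Suc 0) h g x\<bar> \<partial>lborel \<partial>lborel)"
  proof (rule nn_integral_mono)
    fix x :: "real^'n"
    have G1: "gauss_integrable (\<lambda>_::real^'n. 1)" by (rule gauss_integrable_bounded_gauss[where C = 1]) auto
    have i: "integrable lborel (\<lambda>y. heat \<alpha> t (x - y) * g y)" "integrable lborel (\<lambda>y. heat \<alpha> t (x - y))"
      using heat_conv_integrable[OF g t, of \<alpha> x] heat_conv_integrable[OF G1 t, of \<alpha> x] by simp_all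
    then have i2: "integrable lborel (\<lambda>y. heat \<alpha> t (x - y) * (g y - g x))"
      by (simp add: right_diff_distrib)
    have "heat_conv \<alpha> g t x = (LINT y|lborel. heat \<alpha> t (x - y) * g y) - (LINT y|lborel. heat \<alpha> t (x - y)) * g x"
      using heat_conv_const_deriv[OF m t, of x] by (simp add: heat_conv_def)
    also have "\<dots> = (LINT y|lborel. heat \<alpha> t (x - y) * (g y - g x))"
      using i by (simp add: right_diff_distrib)
    finally have "ennreal \<bar>heat_conv \<alpha> g t x\<bar> \<le> (\<integral>\<^sup>+y. ennreal \<bar>heat \<alpha> t (x - y) * (g y - g x)\<bar> \<partial>lborel)"
      using integral_norm_bound_ennreal[OF i2] by simp
    also have "\<dots> = (\<integral>\<^sup>+h. ennreal \<bar>heat \<alpha> t (x - (x + h)) * (g (x + h) - g x)\<bar> \<partial>lborel)"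
      by (rule nn_integral_lborel_translate[symmetric]) simp
    finally show "ennreal \<bar>heat_conv \<alpha> g t x\<bar> \<le> (\<integral>\<^sup>+h. ennreal \<bar>heat \<alpha> t (- h)\<bar> * ennreal \<bar>fdiff (Suc 0) h g x\<bar> \<partial>lborel)"
      by (simp add: abs_mult ennreal_mult)
  qed
  also have "\<dots> = (\<integral>\<^sup>+h. \<integral>\<^sup>+x. ennreal \<bar>heat \<alpha> t (- h)\<bar> * ennreal \<bar>fdiff (Suc 0) h g x\<bar> \<partial>lborel \<partial>lborel)"
    unfolding fdiff_1 by (rule lborel_pair.Fubini') measurable
  also have "\<dots> = (\<integral>\<^sup>+h. ennreal \<bar>heat \<alpha> t (- h)\<bar> * diff_modulus (Suc 0) g h \<partial>lborel)"
    unfolding diff_modulus_def fdiff_1 by (intro nn_integral_cong nn_integral_cmult) measurable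
  finally show ?thesis .
qed

text \<open>The kernel is even since \<open>msize \<alpha> = 2\<close>, so it pairs with symmetric second differences.\<close>

lemma heat_conv_second_difference:
  assumes g: "gauss_integrable g" and t: "t > 0" and m: "msize \<alpha> = 2"
  shows "(\<integral>\<^sup>+x. ennreal \<bar>heat_conv \<alpha> g t (x::real^'n)\<bar> \<partial>lborel) \<le> (\<integral>\<^sup>+h. ennreal \<bar>heat \<alpha> t h\<bar> * diff_modulus 2 g h \<partial>lborel)"
proof -
  have [measurable]: "g \<in> borel_measurable borel" using g by (simp add: gauss_integrable_def)
  have even: "heat \<alpha> t (- h) = heat \<alpha> t h" for h :: "real^'n" using heat_minus[of \<alpha> t h] m by simp
  let ?D = "\<lambda>h x. g (x + h) + g (x - h) - 2 * g x"
  have "(\<integral>\<^sup>+x. ennreal \<bar>heat_conv \<alpha> g t x\<bar> \<partial>lborel) \<le>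
      (\<integral>\<^sup>+x. \<integral>\<^sup>+h. ennreal \<bar>heat \<alpha> t h\<bar> * ennreal \<bar>?D h x\<bar> \<partial>lborel \<partial>lborel)"
  proof (rule nn_integral_mono)
    fix x :: "real^'n"
    have G1: "gauss_integrable (\<lambda>_::real^'n. 1)" by (rule gauss_integrable_bounded_gauss[where C = 1]) auto
    have i: "integrable lborel (\<lambda>y. heat \<alpha> t (x - y) * g y)" using heat_conv_integrable[OF g t, of \<alpha> x] by simp
    have p: "(LINT h|lborel. heat \<alpha> t h * g (x + h)) = heat_conv \<alpha> g t x"
      unfolding heat_conv_def using integral_lborel_translate[of "\<lambda>y. heat \<alpha> t (x - y) * g y" x] by (simp add: even)
    have ip: "integrable lborel (\<lambda>h. heat \<alpha> t h * g (x + h))"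
      using integrable_lborel_translate[of "\<lambda>y. heat \<alpha> t (x - y) * g y" x] i by (simp add: even)
    have n: "(LINT h|lborel. heat \<alpha> t h * g (x - h)) = heat_conv \<alpha> g t x"
      unfolding heat_conv_def using integral_lborel_reflect[of "\<lambda>y. heat \<alpha> t (x - y) * g y" x] by simp
    have "integrable lborel (\<lambda>h. heat \<alpha> t h * g (x - h))"
      using integrable_lborel_reflect[of "\<lambda>y. heat \<alpha> t (x - y) * g y" x] i by simp
    note in' = this
    have z: "(LINT h|lborel. heat \<alpha> t h) = 0" "integrable lborel (heat \<alpha> t :: real^'n \<Rightarrow> real)"
      using heat_conv_const_deriv[of \<alpha> t "0::real^'n"] m t heat_conv_integrable[OF G1 t, of \<alpha> 0] by (simp_all add: heat_conv_def even)
    have eq: "heat \<alpha> t h * ?D h x = (heat \<alpha> t h * g (x + h) + heat \<alpha> t h * g (x - h)) - heat \<alpha> t h * (2 * g x)" for h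
      by (simp add: algebra_simps)
    have i2: "integrable lborel (\<lambda>h. heat \<alpha> t h * ?D h x)"
      unfolding eq using ip in' z by simp
    \<comment> \<open>By evenness the forward and the backward average both equal the convolution;
      the term \<open>2 * g x\<close> integrates to 0.\<close>
    have "2 * heat_conv \<alpha> g t x = (LINT h|lborel. heat \<alpha> t h * ?D h x)"
      unfolding eq using ip in' z p n by simp
    then have "ennreal \<bar>2 * heat_conv \<alpha> g t x\<bar> \<le> (\<integral>\<^sup>+h. ennreal \<bar>heat \<alpha> t h * ?D h x\<bar> \<partial>lborel)"
      using integral_norm_bound_ennreal[OF i2] by simp
    moreover have "ennreal \<bar>heat_conv \<alpha> g t x\<bar> \<le> ennreal \<bar>2 * heat_conv \<alpha> g t x\<bar>" by (intro ennreal_leI) simp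
    ultimately show "ennreal \<bar>heat_conv \<alpha> g t x\<bar> \<le> (\<integral>\<^sup>+h. ennreal \<bar>heat \<alpha> t h\<bar> * ennreal \<bar>?D h x\<bar> \<partial>lborel)"
      by (simp add: abs_mult ennreal_mult)
  qed
  also have "\<dots> = (\<integral>\<^sup>+h. \<integral>\<^sup>+x. ennreal \<bar>heat \<alpha> t h\<bar> * ennreal \<bar>?D h x\<bar> \<partial>lborel \<partial>lborel)"
    by (rule lborel_pair.Fubini') measurable
  also have "\<dots> = (\<integral>\<^sup>+h. ennreal \<bar>heat \<alpha> t h\<bar> * diff_modulus 2 g h \<partial>lborel)"
  proof (rule nn_integral_cong)
    fix h :: "real^'n"
    \<comment> \<open>Translation by \<open>h\<close> turns the centred second difference into the
      forward one of \<open>fdiff\<close>.\<close>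
    have "(\<integral>\<^sup>+x. ennreal \<bar>?D h x\<bar> \<partial>lborel) = (\<integral>\<^sup>+x. ennreal \<bar>?D h (h + x)\<bar> \<partial>lborel)"
      by (rule nn_integral_lborel_translate[symmetric]) simp
    also have "\<dots> = diff_modulus 2 g h"
      unfolding diff_modulus_def fdiff_2 by (intro nn_integral_cong) (simp add: scaleR_2 algebra_simps)
    finally show "(\<integral>\<^sup>+x. ennreal \<bar>heat \<alpha> t h\<bar> * ennreal \<bar>?D h x\<bar> \<partial>lborel) = ennreal \<bar>heat \<alpha> t h\<bar> * diff_modulus 2 g h"
      by (subst nn_integral_cmult) auto
  qed
  finally show ?thesis .
qed

lemma heat_diff_modulus_le:
  fixes \<alpha> :: "'n::finite \<Rightarrow> nat"
  shows "\<exists>C\<ge>0. \<forall>t>0. \<forall>v\<in>borel_measurable borel. (\<integral>\<^sup>+h. ennreal \<bar>heat \<alpha> t (h::real^'n)\<bar> * v h \<partial>lborel) \<le>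
     ennreal (C / t ^ (CARD('n) + msize \<alpha>)) * (\<integral>\<^sup>+h. ennreal (exp (- (norm h)\<^sup>2 / (8 * t\<^sup>2))) * v h \<partial>lborel)"
proof -
  obtain A where A: "A > 0" "\<And>t x. t > 0 \<Longrightarrow> \<bar>heat \<alpha> t (x::real^'n)\<bar> \<le> A / t ^ (CARD('n) + msize \<alpha>) * exp (- (norm x)\<^sup>2 / (8 * t\<^sup>2))"
    using heat_bound[of \<alpha>] by blast
  have "(\<integral>\<^sup>+h. ennreal \<bar>heat \<alpha> t (h::real^'n)\<bar> * v h \<partial>lborel) \<le>
     ennreal (A / t ^ (CARD('n) + msize \<alpha>)) * (\<integral>\<^sup>+h. ennreal (exp (- (norm h)\<^sup>2 / (8 * t\<^sup>2))) * v h \<partial>lborel)"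
    if t: "t > 0" and v [measurable]: "v \<in> borel_measurable borel" for t v
  proof -
    have "(\<integral>\<^sup>+h. ennreal \<bar>heat \<alpha> t (h::real^'n)\<bar> * v h \<partial>lborel) \<le>
       (\<integral>\<^sup>+h. ennreal (A / t ^ (CARD('n) + msize \<alpha>)) * (ennreal (exp (- (norm h)\<^sup>2 / (8 * t\<^sup>2))) * v h) \<partial>lborel)"
      using A t unfolding mult.assoc[symmetric]
      by (intro nn_integral_mono mult_right_mono) (auto simp flip: ennreal_mult intro!: ennreal_leI)
    also have "\<dots> = ennreal (A / t ^ (CARD('n) + msize \<alpha>)) * (\<integral>\<^sup>+h. ennreal (exp (- (norm h)\<^sup>2 / (8 * t\<^sup>2))) * v h \<partial>lborel)"
      by (rule nn_integral_cmult) measurable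
    finally show ?thesis .
  qed
  then show ?thesis using A by (intro exI[of _ A]) auto
qed

text \<open>For \<open>k = 2\<close> an arbitrary \<open>\<alpha>\<close> need not give an even
  kernel. Both semigroup factors therefore live at \<open>s = t / sqrt 2\<close>: exactly two
  derivatives face \<open>g\<close>, and Young's inequality charges the remaining ones to the L1
  norm of the other factor.\<close>

lemma heat_conv_difference_bound:
  fixes \<alpha> :: "'n::finite \<Rightarrow> nat"
  assumes k: "k = 1 \<or> k = 2" and m: "k \<le> msize \<alpha>"
  shows "\<exists>C\<ge>0. \<forall>g t. gauss_integrable g \<longrightarrow> t > 0 \<longrightarrow> (\<integral>\<^sup>+x. ennreal \<bar>heat_conv \<alpha> g t (x::real^'n)\<bar> \<partial>lborel) \<le>
     ennreal (C / t ^ (CARD('n) + msize \<alpha>)) * (\<integral>\<^sup>+h. ennreal (exp (- (norm h)\<^sup>2 / (8 * t\<^sup>2))) * diff_modulus k g h \<partial>lborel)"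
  using k
proof
  assume k: "k = 1"
  obtain C where C: "C \<ge> 0" "\<And>t v. t > 0 \<Longrightarrow> v\<in>borel_measurable borel \<Longrightarrow> (\<integral>\<^sup>+h. ennreal \<bar>heat \<alpha> t (h::real^'n)\<bar> * v h \<partial>lborel) \<le>
     ennreal (C / t ^ (CARD('n) + msize \<alpha>)) * (\<integral>\<^sup>+h. ennreal (exp (- (norm h)\<^sup>2 / (8 * t\<^sup>2))) * v h \<partial>lborel)"
    using heat_diff_modulus_le[of \<alpha>] by blast
  have "(\<integral>\<^sup>+x. ennreal \<bar>heat_conv \<alpha> g t (x::real^'n)\<bar> \<partial>lborel) \<le>
     ennreal (C / t ^ (CARD('n) + msize \<alpha>)) * (\<integral>\<^sup>+h. ennreal (exp (- (norm h)\<^sup>2 / (8 * t\<^sup>2))) * diff_modulus k g h \<partial>lborel)"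
    if g: "gauss_integrable g" and t: "t > 0" for g t
  proof -
    have [measurable]: "g \<in> borel_measurable borel" using g by (simp add: gauss_integrable_def)
    have "\<bar>heat \<alpha> t (- h)\<bar> = \<bar>heat \<alpha> t h\<bar>" for h :: "real^'n" by (simp add: heat_minus abs_mult)
    then have "(\<integral>\<^sup>+x. ennreal \<bar>heat_conv \<alpha> g t x\<bar> \<partial>lborel) \<le> (\<integral>\<^sup>+h. ennreal \<bar>heat \<alpha> t h\<bar> * diff_modulus k g h \<partial>lborel)"
      using heat_conv_first_difference[OF g t, of \<alpha>] m k by simp
    also have "\<dots> \<le> ennreal (C / t ^ (CARD('n) + msize \<alpha>)) * (\<integral>\<^sup>+h. ennreal (exp (- (norm h)\<^sup>2 / (8 * t\<^sup>2))) * diff_modulus k g h \<partial>lborel)"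
      by (intro C(2) t) measurable
    finally show ?thesis .
  qed
  then show ?thesis using C(1) by blast
next
  assume k: "k = 2"
  then obtain \<beta> \<gamma> where \<alpha>: "\<alpha> = (\<lambda>i. \<beta> i + \<gamma> i)" and \<gamma>: "msize \<gamma> = 2"
    using multi_index_split[OF m] by auto
  have m\<alpha>: "msize \<alpha> = msize \<beta> + 2" using \<gamma> by (simp add: \<alpha> sum.distrib)
  obtain C where C: "C \<ge> 0" "\<And>t v. t > 0 \<Longrightarrow> v\<in>borel_measurable borel \<Longrightarrow> (\<integral>\<^sup>+h. ennreal \<bar>heat \<gamma> t (h::real^'n)\<bar> * v h \<partial>lborel) \<le>
     ennreal (C / t ^ (CARD('n) + msize \<gamma>)) * (\<integral>\<^sup>+h. ennreal (exp (- (norm h)\<^sup>2 / (8 * t\<^sup>2))) * v h \<partial>lborel)"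
    using heat_diff_modulus_le[of \<gamma>] by blast
  obtain D where D: "D \<ge> 0" "\<And>t. t > 0 \<Longrightarrow> (\<integral>\<^sup>+x. ennreal \<bar>heat \<beta> t (x::real^'n)\<bar> \<partial>lborel) \<le> ennreal (D / t ^ msize \<beta>)"
    using heat_L1[of \<beta>] by blast
  \<comment> \<open>The powers of \<open>s\<close> combine to
    \<open>s ^ (CARD('n) + msize \<alpha>)\<close>; rewriting them in \<open>t\<close> gives the
    power of \<open>sqrt 2\<close>.\<close>
  define E where "E = D * C * sqrt 2 ^ (CARD('n) + msize \<alpha>)"
  have "(\<integral>\<^sup>+x. ennreal \<bar>heat_conv \<alpha> g t (x::real^'n)\<bar> \<partial>lborel) \<le>
     ennreal (E / t ^ (CARD('n) + msize \<alpha>)) * (\<integral>\<^sup>+h. ennreal (exp (- (norm h)\<^sup>2 / (8 * t\<^sup>2))) * diff_modulus k g h \<partial>lborel)"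
    if g: "gauss_integrable g" and t: "t > 0" for g t
  proof -
    have [measurable]: "g \<in> borel_measurable borel" using g by (simp add: gauss_integrable_def)
    define s where "s = t / sqrt 2"
    have s: "s > 0" "t = sqrt 2 * s" using t by (auto simp: s_def)
    have "s\<^sup>2 \<le> t\<^sup>2" by (simp add: s_def power_divide)
    have "(\<integral>\<^sup>+x. ennreal \<bar>heat_conv \<alpha> g t (x::real^'n)\<bar> \<partial>lborel) = (\<integral>\<^sup>+x. ennreal \<bar>LINT y|lborel. heat \<beta> s (x - y) * heat_conv \<gamma> g s y\<bar> \<partial>lborel)"
      unfolding s(2) \<alpha> by (simp add: heat_conv_semigroup[OF g s(1)])
    also have "\<dots> \<le> (\<integral>\<^sup>+x. ennreal \<bar>heat \<beta> s (x::real^'n)\<bar> \<partial>lborel) * (\<integral>\<^sup>+x. ennreal \<bar>heat_conv \<gamma> g s x\<bar> \<partial>lborel)"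
      by (rule nn_integral_convolution_le) measurable
    also have "\<dots> \<le> ennreal (D / s ^ msize \<beta>) * (ennreal (C / s ^ (CARD('n) + msize \<gamma>)) *
        (\<integral>\<^sup>+h. ennreal (exp (- (norm h)\<^sup>2 / (8 * s\<^sup>2))) * diff_modulus k g h \<partial>lborel))"
    proof (intro mult_mono D(2) s)
      show "(\<integral>\<^sup>+x. ennreal \<bar>heat_conv \<gamma> g s x\<bar> \<partial>lborel) \<le> ennreal (C / s ^ (CARD('n) + msize \<gamma>)) *
        (\<integral>\<^sup>+h. ennreal (exp (- (norm h)\<^sup>2 / (8 * s\<^sup>2))) * diff_modulus k g h \<partial>lborel)"
        unfolding k
        by (rule order_trans[OF heat_conv_second_difference[OF g s(1) \<gamma>]], intro C(2) s) measurable
    qed simp_all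
    also have "\<dots> = ennreal (E / t ^ (CARD('n) + msize \<alpha>)) *
        (\<integral>\<^sup>+h. ennreal (exp (- (norm h)\<^sup>2 / (8 * s\<^sup>2))) * diff_modulus k g h \<partial>lborel)"
    proof -
      have "D / s ^ msize \<beta> * (C / s ^ (CARD('n) + msize \<gamma>)) = E / t ^ (CARD('n) + msize \<alpha>)"
        using s(1) by (simp add: E_def m\<alpha> \<gamma> s(2) power_add power_mult_distrib)
      then show ?thesis
        unfolding mult.assoc[symmetric] using C(1) D(1) s(1) by (subst ennreal_mult[symmetric]) auto
    qed
    also have "\<dots> \<le> ennreal (E / t ^ (CARD('n) + msize \<alpha>)) *
        (\<integral>\<^sup>+h. ennreal (exp (- (norm h)\<^sup>2 / (8 * t\<^sup>2))) * diff_modulus k g h \<partial>lborel)"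
    \<comment> \<open>Since \<open>s\<close> is smaller than \<open>t\<close>, the Gaussian of scale
      \<open>s\<close> lies below that of scale \<open>t\<close>.\<close>
    proof (intro mult_left_mono nn_integral_mono mult_right_mono ennreal_leI)
      fix h :: "real^'n"
      have "(norm h)\<^sup>2 / (8 * t\<^sup>2) \<le> (norm h)\<^sup>2 / (8 * s\<^sup>2)"
        using \<open>s\<^sup>2 \<le> t\<^sup>2\<close> s(1) t by (intro divide_left_mono) auto
      then show "exp (- (norm h)\<^sup>2 / (8 * s\<^sup>2)) \<le> exp (- (norm h)\<^sup>2 / (8 * t\<^sup>2))" by simp
    qed auto
    finally show ?thesis .
  qed
  moreover have "E \<ge> 0" using C(1) D(1) by (simp add: E_def)
  ultimately show ?thesis by blast
qed

section \<open>The integral in t and the weight of the seminorm\<close>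

lemma power_div_fact_le_exp:
  assumes "x \<ge> (0::real)" shows "x ^ n / fact n \<le> exp x"
proof -
  have "(\<Sum>k\<in>{n}. x ^ k /\<^sub>R fact k) \<le> (\<Sum>k. x ^ k /\<^sub>R fact k)"
    using assms exp_converges[of x] by (intro sum_le_suminf) (auto simp: sums_iff)
  then show ?thesis using exp_converges[of x] by (simp add: sums_iff divide_inverse mult.commute)
qed

lemma inverse_square_integrable: "(\<integral>\<^sup>+x. ennreal (1 / (1 + x\<^sup>2)) * indicator {0::real..} x \<partial>lborel) < \<infinity>"
proof -
  have "(\<integral>\<^sup>+x. ennreal (1 / (1 + x\<^sup>2)) * indicator {0::real..} x \<partial>lborel) = ennreal (pi / 2 - arctan 0)"
  proof (rule nn_integral_FTC_atLeast)
    show "DERIV arctan x :> 1 / (1 + x\<^sup>2)" for x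
      by (auto intro!: derivative_eq_intros simp: divide_inverse)
    show "(arctan \<longlongrightarrow> pi / 2) at_top" by (rule tendsto_arctan_at_top)
  qed auto
  then show ?thesis by simp
qed

text \<open>The substitution \<open>t = r * \<tau>\<close> extracts \<open>1 / r powr p\<close> and
  leaves an integral \<open>I\<close> independent of \<open>r\<close>. It is finite because the
  integrand lies below a multiple of \<open>1 / (1 + \<tau>\<^sup>2)\<close>: by the power for large
  \<open>\<tau>\<close>, and near 0 because the exponential beats every power.\<close>

lemma time_integral:
  fixes p :: real
  assumes p: "p \<ge> 1"
  shows "\<exists>C\<ge>0. \<forall>r>0. (\<integral>\<^sup>+t\<in>{0<..}. ennreal (t powr (- p - 1) * exp (- r\<^sup>2 / (8 * t\<^sup>2))) \<partial>lborel) \<le> ennreal (C / r powr p)"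
proof -
  \<comment> \<open>\<open>N\<close> is chosen so that the bound
    \<open>exp (- u) \<le> fact N / u ^ N\<close>, which behaves like
    \<open>\<tau> ^ (2 * N)\<close>, compensates \<open>\<tau> powr (- p - 1)\<close> near
    0.\<close>
  define N :: nat where "N = nat \<lceil>p + 1\<rceil>"
  have N: "real (2 * N) \<ge> p + 1" using p unfolding N_def by simp linarith
  \<comment> \<open>The factor \<open>8 ^ N\<close> comes from
    \<open>u = 1 / (8 * \<tau>\<^sup>2)\<close>, and 2 from
    \<open>1 / (1 + \<tau>\<^sup>2) \<ge> 1 / 2\<close> on \<open>\<tau> \<le> 1\<close>. For
    \<open>\<tau> \<ge> 1\<close> only \<open>B \<ge> 2\<close> is used.\<close>
  define B :: real where "B = 2 * (fact N * 8 ^ N)"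
  have B: "B \<ge> 2" unfolding B_def using mult_mono[of 1 "fact N" 1 "8^N::real"] by simp
  have bnd: "\<tau> powr (- p - 1) * exp (- 1 / (8 * \<tau>\<^sup>2)) \<le> B * (1 / (1 + \<tau>\<^sup>2))" if \<tau>: "\<tau> > 0" for \<tau> :: real
  proof (cases "\<tau> \<ge> 1")
    case True
    have "\<tau> powr (- p - 1) \<le> \<tau> powr (-2)" using True p by (intro powr_mono) auto
    also have "\<dots> = 1 / \<tau>\<^sup>2" using \<tau> by (simp add: powr_minus_divide powr_numeral)
    also have "\<dots> \<le> 2 * (1 / (1 + \<tau>\<^sup>2))"
    proof -
      have "1 \<le> \<tau>\<^sup>2" using True by (simp add: one_le_power)
      then show ?thesis using \<tau> by (simp add: field_simps)
    qed
    also have "\<dots> \<le> B * (1 / (1 + \<tau>\<^sup>2))" using B by (intro mult_right_mono) auto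
    finally have "\<tau> powr (- p - 1) \<le> B * (1 / (1 + \<tau>\<^sup>2))" .
    moreover have "\<tau> powr (- p - 1) * exp (- 1 / (8 * \<tau>\<^sup>2)) \<le> \<tau> powr (- p - 1) * 1"
      by (intro mult_left_mono) auto
    ultimately show ?thesis by linarith
  next
    case False
    define u where "u = 1 / (8 * \<tau>\<^sup>2)"
    have u: "u > 0" using \<tau> by (simp add: u_def)
    have "exp (- u) \<le> fact N / u ^ N"
      using power_div_fact_le_exp[of u N] u by (simp add: exp_minus field_simps)
    also have "\<dots> = fact N * 8 ^ N * \<tau> ^ (2 * N)"
      using \<tau> by (simp add: u_def power_divide power_mult_distrib power_mult)
    also have "\<tau> ^ (2 * N) = \<tau> powr real (2 * N)" by (rule powr_realpow[OF \<tau>, symmetric])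
    also have "\<tau> powr real (2 * N) \<le> \<tau> powr (p + 1)" using False N \<tau> by (intro powr_mono') auto
    finally have e: "exp (- u) \<le> fact N * 8 ^ N * \<tau> powr (p + 1)" by simp
    have "\<tau> powr (- p - 1) * exp (- u) \<le> \<tau> powr (- p - 1) * (fact N * 8 ^ N * \<tau> powr (p + 1))"
      by (rule mult_left_mono[OF e]) simp
    also have "\<dots> = B / 2 * (\<tau> powr (- p - 1) * \<tau> powr (p + 1))" by (simp add: B_def)
    also have "\<tau> powr (- p - 1) * \<tau> powr (p + 1) = 1" using \<tau> by (simp flip: powr_add)
    also have "B / 2 * 1 \<le> B * (1 / (1 + \<tau>\<^sup>2))"
    proof -
      have "\<tau>\<^sup>2 \<le> 1" using False \<tau> by (simp add: power_le_one)
      then have "1 / 2 \<le> 1 / (1 + \<tau>\<^sup>2)" by (intro divide_left_mono) (auto simp: add_pos_nonneg)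
      from mult_left_mono[OF this, of B] show ?thesis using B by simp
    qed
    finally show ?thesis by (simp add: u_def)
  qed
  define I where "I = (\<integral>\<^sup>+\<tau>\<in>{0<..}. ennreal (\<tau> powr (- p - 1) * exp (- 1 / (8 * \<tau>\<^sup>2))) \<partial>lborel)"
  have "I \<le> (\<integral>\<^sup>+\<tau>. ennreal B * (ennreal (1 / (1 + \<tau>\<^sup>2)) * indicator {0::real..} \<tau>) \<partial>lborel)"
    unfolding I_def
  proof (rule nn_integral_mono)
    fix \<tau> :: real
    show "ennreal (\<tau> powr (- p - 1) * exp (- 1 / (8 * \<tau>\<^sup>2))) * indicator {0<..} \<tau> \<le>
       ennreal B * (ennreal (1 / (1 + \<tau>\<^sup>2)) * indicator {0::real..} \<tau>)"
    proof (cases "\<tau> > 0")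
      case True
      have "ennreal (\<tau> powr (- p - 1) * exp (- 1 / (8 * \<tau>\<^sup>2))) \<le> ennreal (B * (1 / (1 + \<tau>\<^sup>2)))"
        by (rule ennreal_leI[OF bnd[OF True]])
      also have "\<dots> = ennreal B * ennreal (1 / (1 + \<tau>\<^sup>2))" using B by (intro ennreal_mult) auto
      finally show ?thesis using True by simp
    qed auto
  qed
  also have "\<dots> = ennreal B * (\<integral>\<^sup>+\<tau>. (ennreal (1 / (1 + \<tau>\<^sup>2)) * indicator {0::real..} \<tau>) \<partial>lborel)"
    by (rule nn_integral_cmult) measurable
  also have "\<dots> < \<infinity>" using inverse_square_integrable by (simp add: ennreal_mult_less_top)
  finally have I: "I < \<infinity>" .
  have "(\<integral>\<^sup>+t\<in>{0<..}. ennreal (t powr (- p - 1) * exp (- r\<^sup>2 / (8 * t\<^sup>2))) \<partial>lborel) \<le> ennreal (enn2real I / r powr p)"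
    if r: "r > 0" for r
  proof -
    have "(\<integral>\<^sup>+t\<in>{0<..}. ennreal (t powr (- p - 1) * exp (- r\<^sup>2 / (8 * t\<^sup>2))) \<partial>lborel) =
      ennreal \<bar>r\<bar> * (\<integral>\<^sup>+\<tau>. ennreal ((0 + r * \<tau>) powr (- p - 1) * exp (- r\<^sup>2 / (8 * (0 + r * \<tau>)\<^sup>2))) * indicator {0<..} (0 + r * \<tau>) \<partial>lborel)"
      using r by (intro nn_integral_real_affine) auto
    also have "(\<integral>\<^sup>+\<tau>. ennreal ((0 + r * \<tau>) powr (- p - 1) * exp (- r\<^sup>2 / (8 * (0 + r * \<tau>)\<^sup>2))) * indicator {0<..} (0 + r * \<tau>) \<partial>lborel)
       = (\<integral>\<^sup>+\<tau>. ennreal (r powr (- p - 1)) * (ennreal (\<tau> powr (- p - 1) * exp (- 1 / (8 * \<tau>\<^sup>2))) * indicator {0<..} \<tau>) \<partial>lborel)"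
    proof (rule nn_integral_cong)
      fix \<tau> :: real
      show "ennreal ((0 + r * \<tau>) powr (- p - 1) * exp (- r\<^sup>2 / (8 * (0 + r * \<tau>)\<^sup>2))) * indicator {0<..} (0 + r * \<tau>) =
        ennreal (r powr (- p - 1)) * (ennreal (\<tau> powr (- p - 1) * exp (- 1 / (8 * \<tau>\<^sup>2))) * indicator {0<..} \<tau>)"
      proof (cases "\<tau> > 0")
        case True
        have "- r\<^sup>2 / (8 * (r * \<tau>)\<^sup>2) = - 1 / (8 * \<tau>\<^sup>2)"
          using r by (simp add: power_mult_distrib)
        then have "(0 + r * \<tau>) powr (- p - 1) * exp (- r\<^sup>2 / (8 * (0 + r * \<tau>)\<^sup>2)) =
            r powr (- p - 1) * (\<tau> powr (- p - 1) * exp (- 1 / (8 * \<tau>\<^sup>2)))"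
          using r True by (simp add: powr_mult)
        then show ?thesis using True r by (simp add: ennreal_mult)
      next
        case False
        then show ?thesis using r by (auto simp: indicator_def zero_less_mult_iff)
      qed
    qed
    also have "\<dots> = ennreal (r powr (- p - 1)) * I"
      unfolding I_def by (rule nn_integral_cmult) measurable
    also have "ennreal \<bar>r\<bar> * (ennreal (r powr (- p - 1)) * I) = ennreal (r * r powr (- p - 1)) * I"
      using r by (simp add: ennreal_mult mult.assoc)
    also have "r * r powr (- p - 1) = 1 / r powr p"
      using r by (simp add: powr_minus_divide powr_diff powr_add divide_simps flip: powr_minus_divide)
    also have "I = ennreal (enn2real I)" using I by simp
    also have "ennreal (1 / r powr p) * ennreal (enn2real I) = ennreal (enn2real I / r powr p)"
      by (subst ennreal_mult[symmetric]) auto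
    finally show ?thesis by simp
  qed
  then show ?thesis by (intro exI[of _ "enn2real I"]) auto
qed

text \<open>For \<open>k = nat \<lfloor>\<sigma>\<rfloor> + 1\<close> and Borel \<open>g\<close>
  this is \<open>besov_seminorm_le1 \<sigma> 1 g\<close>; with \<open>k\<close> kept apart from
  \<open>\<sigma>\<close>, the orders 1 and 2 can be treated together.\<close>

definition besov_int :: "nat \<Rightarrow> real \<Rightarrow> (real^'n \<Rightarrow> real) \<Rightarrow> ennreal" where
  "besov_int k \<sigma> g = (\<integral>\<^sup>+h. diff_modulus k g h / ennreal (norm h powr (real CARD('n) + \<sigma>)) \<partial>lborel)"

text \<open>The weight exponent is chosen so that it combines with
  \<open>t ^ (CARD('n) + msize \<alpha>)\<close> to \<open>t powr (- p - 1)\<close>, where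
  \<open>p = real CARD('n) + \<sigma>\<close>, independently of \<open>\<alpha>\<close>. Tonelli
  then allows \<open>t\<close> to be integrated first.\<close>

lemma core_estimate:
  fixes \<alpha> :: "'n::finite \<Rightarrow> nat"
  assumes k: "k = 1 \<or> k = 2" and m: "k \<le> msize \<alpha>" and \<sigma>: "\<sigma> > 0"
  shows "\<exists>C\<ge>0. \<forall>g. gauss_integrable g \<longrightarrow> (\<integral>\<^sup>+t\<in>{0<..}. (\<integral>\<^sup>+x. ennreal (t powr (real (msize \<alpha>) - \<sigma> - 1) * \<bar>heat_conv \<alpha> g t (x::real^'n)\<bar>) \<partial>lborel) \<partial>lborel) \<le>
     ennreal C * besov_int k \<sigma> g"
proof -
  obtain C where C: "C \<ge> 0" "\<And>g t. gauss_integrable g \<Longrightarrow> t > 0 \<Longrightarrow> (\<integral>\<^sup>+x. ennreal \<bar>heat_conv \<alpha> g t (x::real^'n)\<bar> \<partial>lborel) \<le>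
     ennreal (C / t ^ (CARD('n) + msize \<alpha>)) * (\<integral>\<^sup>+h. ennreal (exp (- (norm h)\<^sup>2 / (8 * t\<^sup>2))) * diff_modulus k g h \<partial>lborel)"
    using heat_conv_difference_bound[OF k m] by blast
  define p where "p = real CARD('n) + \<sigma>"
  have "CARD('n) \<ge> 1" by (simp add: Suc_leI)
  then have p: "p \<ge> 1" using \<sigma> unfolding p_def by linarith
  obtain D where D: "D \<ge> 0" "\<And>r. r > 0 \<Longrightarrow> (\<integral>\<^sup>+t\<in>{0<..}. ennreal (t powr (- p - 1) * exp (- r\<^sup>2 / (8 * t\<^sup>2))) \<partial>lborel) \<le> ennreal (D / r powr p)"
    using time_integral[OF p] by blast
  have "(\<integral>\<^sup>+t\<in>{0<..}. (\<integral>\<^sup>+x. ennreal (t powr (real (msize \<alpha>) - \<sigma> - 1) * \<bar>heat_conv \<alpha> g t (x::real^'n)\<bar>) \<partial>lborel) \<partial>lborel) \<le>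
     ennreal (C * D) * besov_int k \<sigma> g" if g: "gauss_integrable g" for g
  proof -
    have [measurable]: "g \<in> borel_measurable borel" using g by (simp add: gauss_integrable_def)
    let ?F = "\<lambda>t h. ennreal C * (diff_modulus k g h * (ennreal (t powr (- p - 1) * exp (- (norm h)\<^sup>2 / (8 * t\<^sup>2))) * indicator {0<..} t))"
    have "(\<integral>\<^sup>+t\<in>{0<..}. (\<integral>\<^sup>+x. ennreal (t powr (real (msize \<alpha>) - \<sigma> - 1) * \<bar>heat_conv \<alpha> g t (x::real^'n)\<bar>) \<partial>lborel) \<partial>lborel) \<le>
      (\<integral>\<^sup>+t. \<integral>\<^sup>+h. ?F t h \<partial>lborel \<partial>lborel)"
    proof (rule nn_integral_mono)
      fix t :: real
      let ?e = "t powr (real (msize \<alpha>) - \<sigma> - 1)"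
      show "(\<integral>\<^sup>+x. ennreal (?e * \<bar>heat_conv \<alpha> g t (x::real^'n)\<bar>) \<partial>lborel) * indicator {0<..} t \<le> (\<integral>\<^sup>+h. ?F t h \<partial>lborel)"
      proof (cases "t > 0")
        case True
        have "(\<integral>\<^sup>+x. ennreal (?e * \<bar>heat_conv \<alpha> g t (x::real^'n)\<bar>) \<partial>lborel) = ennreal ?e * (\<integral>\<^sup>+x. ennreal \<bar>heat_conv \<alpha> g t (x::real^'n)\<bar> \<partial>lborel)"
          by (subst nn_integral_cmult[symmetric]) (auto simp: ennreal_mult)
        also have "\<dots> \<le> ennreal ?e * (ennreal (C / t ^ (CARD('n) + msize \<alpha>)) * (\<integral>\<^sup>+h. ennreal (exp (- (norm h)\<^sup>2 / (8 * t\<^sup>2))) * diff_modulus k g h \<partial>lborel))"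
          by (intro mult_left_mono C(2) g True) simp
        also have "\<dots> = ennreal (C * t powr (- p - 1)) * (\<integral>\<^sup>+h. ennreal (exp (- (norm h)\<^sup>2 / (8 * t\<^sup>2))) * diff_modulus k g h \<partial>lborel)"
        proof -
          have "?e * (C / t ^ (CARD('n) + msize \<alpha>)) = C * (?e / t powr real (CARD('n) + msize \<alpha>))"
            unfolding powr_realpow[OF True] by (simp only: times_divide_eq_right times_divide_eq_left mult.commute)
          also have "?e / t powr real (CARD('n) + msize \<alpha>) = t powr (- p - 1)"
          proof -
            have "real (msize \<alpha>) - \<sigma> - 1 - real (CARD('n) + msize \<alpha>) = - p - 1" by (simp add: p_def)
            then show ?thesis by (metis powr_diff)
          qed
          finally show ?thesis
            unfolding mult.assoc[symmetric] using C(1) True by (subst ennreal_mult[symmetric]) auto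
        qed
        also have "\<dots> = (\<integral>\<^sup>+h. ?F t h \<partial>lborel)"
          using True C(1) by (subst nn_integral_cmult[symmetric]) (auto simp: ennreal_mult mult_ac)
        finally show ?thesis using True by simp
      qed auto
    qed
    also have "\<dots> = (\<integral>\<^sup>+h. \<integral>\<^sup>+t. ?F t h \<partial>lborel \<partial>lborel)"
      by (rule lborel_pair.Fubini') measurable
    also have "\<dots> \<le> (\<integral>\<^sup>+h. ennreal (C * D) * (diff_modulus k g h / ennreal (norm h powr p)) \<partial>lborel)"
    \<comment> \<open>The point \<open>h = 0\<close>, where the weight is singular and
      \<open>time_integral\<close> does not apply, is a null set.\<close>
    proof (rule nn_integral_mono_AE, rule AE_mp[OF AE_lborel_singleton[of 0]], intro AE_I2 impI)
      fix h :: "real^'n" assume h: "h \<noteq> 0"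
      have "(\<integral>\<^sup>+t. ?F t h \<partial>lborel) = ennreal C * (diff_modulus k g h * (\<integral>\<^sup>+t\<in>{0<..}. ennreal (t powr (- p - 1) * exp (- (norm h)\<^sup>2 / (8 * t\<^sup>2))) \<partial>lborel))"
        by (simp add: nn_integral_cmult)
      also have "\<dots> \<le> ennreal C * (diff_modulus k g h * ennreal (D / norm h powr p))"
        by (intro mult_left_mono D(2)) (use h in auto)
      also have "ennreal (D / norm h powr p) = ennreal D / ennreal (norm h powr p)"
        using h D(1) by (intro divide_ennreal[symmetric]) auto
      also have "ennreal C * (diff_modulus k g h * (ennreal D / ennreal (norm h powr p))) = ennreal (C * D) * (diff_modulus k g h / ennreal (norm h powr p))"
        using C(1) D(1) by (simp add: ennreal_mult divide_ennreal_def mult_ac)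
      finally show "(\<integral>\<^sup>+t. ?F t h \<partial>lborel) \<le> ennreal (C * D) * (diff_modulus k g h / ennreal (norm h powr p))" .
    qed
    also have "\<dots> = ennreal (C * D) * besov_int k \<sigma> g"
      unfolding besov_int_def p_def by (rule nn_integral_cmult) measurable
    finally show ?thesis .
  qed
  then show ?thesis using C(1) D(1) by (intro exI[of _ "C * D"]) auto
qed

section \<open>Growth from the Besov seminorm\<close>

lemma cball_borel [measurable]: "cball (x::'a::metric_space) r \<in> sets borel"
  by (intro borel_closed closed_cball)

text \<open>Borel counterpart of \<open>Lp_loc 1\<close>, tested on balls since these exhaust the
  space.\<close>

definition loc_int :: "('a::euclidean_space \<Rightarrow> real) \<Rightarrow> bool" where
  "loc_int f \<longleftrightarrow> f \<in> borel_measurable borel \<and> (\<forall>R. (\<integral>\<^sup>+x\<in>cball 0 R. ennreal \<bar>f x\<bar> \<partial>lborel) < \<infinity>)"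

lemma powr_gauss_bound:
  fixes p c :: real
  assumes "p \<ge> 0" "c > 0"
  shows "\<exists>M>0. \<forall>r\<ge>0. r powr p * exp (- c * r\<^sup>2) \<le> M"
proof -
  define N :: nat where "N = nat \<lceil>p\<rceil>"
  have N: "p \<le> real (2 * N)" using assms unfolding N_def by simp linarith
  define M :: real where "M = 1 + fact N / c ^ N"
  have "r powr p * exp (- c * r\<^sup>2) \<le> M" if r: "r \<ge> 0" for r
  proof (cases "r \<ge> 1")
    case True
    define u where "u = c * r\<^sup>2"
    have u: "u > 0" using True assms by (simp add: u_def)
    have "r powr p \<le> r powr real (2 * N)" using True N by (intro powr_mono) auto
    also have "\<dots> = r ^ (2 * N)" using True by (intro powr_realpow) auto
    also have "\<dots> = u ^ N / c ^ N" using assms by (simp add: u_def power_mult_distrib power_mult)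
    finally have "r powr p * exp (- u) \<le> u ^ N / c ^ N * exp (- u)" by (intro mult_right_mono) auto
    also have "\<dots> = (u ^ N / fact N * exp (- u)) * (fact N / c ^ N)" by simp
    also have "\<dots> \<le> (exp u * exp (- u)) * (fact N / c ^ N)"
      using power_div_fact_le_exp[of u N] u assms by (intro mult_right_mono) auto
    also have "\<dots> \<le> M" by (simp add: M_def flip: exp_add)
    finally show ?thesis by (simp add: u_def)
  next
    case False
    have "r powr p * exp (- c * r\<^sup>2) \<le> 1 * 1"
      using False r assms by (intro mult_mono powr_le1) auto
    also have "\<dots> \<le> M" using assms by (simp add: M_def)
    finally show ?thesis by simp
  qed
  moreover have "M > 0" using assms by (auto simp: M_def intro!: add_pos_pos)
  ultimately show ?thesis by blast
qed

lemma gauss_integrable_from_nn: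
  assumes [measurable]: "f \<in> borel_measurable borel"
    and "\<And>c. c > 0 \<Longrightarrow> (\<integral>\<^sup>+x. ennreal (\<bar>f x\<bar> * exp (- c * (norm x)\<^sup>2)) \<partial>lborel) < \<infinity>"
  shows "gauss_integrable (f :: real^'n \<Rightarrow> real)"
  unfolding gauss_integrable_def integrable_iff_bounded using assms(2) by (auto simp: abs_mult mult.commute)

lemma emeasure_unit_ball:
  "0 < emeasure lborel (cball (0::'a::euclidean_space) 1)" "emeasure lborel (cball (0::'a) 1) < \<infinity>"
  by (simp_all add: emeasure_cball unit_ball_vol_pos)

lemma gauss_shift_bound:
  fixes y h :: "real^'n"
  assumes "norm y \<le> 1" "c > 0"
  shows "exp (- c * (norm (y + h))\<^sup>2) \<le> exp c * exp (- (c/2) * (norm h)\<^sup>2)"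
proof -
  have "(norm y)\<^sup>2 \<le> 1" using assms(1) by (simp add: power_le_one)
  moreover have "(norm h)\<^sup>2 / 2 - (norm y)\<^sup>2 \<le> (norm (y + h))\<^sup>2"
    using norm_diff_sq_ge[of "-h" y] norm_diff_sq_ge[where x = y and y = "-h"] by simp
  ultimately have "(norm h)\<^sup>2 / 2 - 1 \<le> (norm (y + h))\<^sup>2" by linarith
  then have "c * ((norm h)\<^sup>2 / 2 - 1) \<le> c * (norm (y + h))\<^sup>2" using assms(2) by (intro mult_left_mono) auto
  then have "- c * (norm (y + h))\<^sup>2 \<le> c + (- (c/2) * (norm h)\<^sup>2)" by (simp add: algebra_simps)
  then have "exp (- c * (norm (y + h))\<^sup>2) \<le> exp (c + (- (c/2) * (norm h)\<^sup>2))" by simp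
  then show ?thesis by (simp only: exp_add)
qed

text \<open>The part of the average over \<open>y\<close> in the unit ball controlled by the Besov integral;
  \<open>j\<close> is the number of steps \<open>h\<close> leading from \<open>y\<close> to the point where the Gaussian is evaluated.\<close>

lemma difference_part_bound:
  fixes f :: "real^'n \<Rightarrow> real"
  assumes f [measurable]: "f \<in> borel_measurable borel" and fin: "besov_int k \<sigma> f < \<infinity>" and \<sigma>: "\<sigma> > 0" and c: "c > 0" and j: "j \<ge> 1"
  shows "(\<integral>\<^sup>+y\<in>cball 0 1. (\<integral>\<^sup>+h. ennreal (\<bar>fdiff k h f y\<bar> * exp (- c * (norm (y + j *\<^sub>R h))\<^sup>2)) \<partial>lborel) \<partial>lborel) < \<infinity>"
proof -
  have [measurable]: "(\<lambda>(h, x). fdiff k h f x) \<in> borel_measurable (borel \<Otimes>\<^sub>M borel)"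
    by (rule fdiff_measurable) fact
  have [measurable]: "(\<lambda>(x, h). fdiff k h f x) \<in> borel_measurable (borel \<Otimes>\<^sub>M borel)"
    by (subst measurable_pair_swap_iff) simp
  define p where "p = real CARD('n) + \<sigma>"
  have p: "p \<ge> 0" using \<sigma> by (simp add: p_def)
  \<comment> \<open>\<open>M\<close> converts Gaussian decay in \<open>h\<close> into the weight
    \<open>norm h powr (- p)\<close> of the Besov integral.\<close>
  obtain M where M: "M > 0" "\<And>r. r \<ge> 0 \<Longrightarrow> r powr p * exp (- (c/2) * r\<^sup>2) \<le> M"
    using powr_gauss_bound[OF p, of "c/2"] c by auto
  have "(\<integral>\<^sup>+y\<in>cball 0 1. (\<integral>\<^sup>+h. ennreal (\<bar>fdiff k h f y\<bar> * exp (- c * (norm (y + j *\<^sub>R h))\<^sup>2)) \<partial>lborel) \<partial>lborel)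
     \<le> (\<integral>\<^sup>+y. \<integral>\<^sup>+h. ennreal (exp c * M) * (ennreal \<bar>fdiff k h f y\<bar> / ennreal (norm h powr p)) \<partial>lborel \<partial>lborel)"
  proof (rule nn_integral_mono)
    fix y :: "real^'n"
    show "(\<integral>\<^sup>+h. ennreal (\<bar>fdiff k h f y\<bar> * exp (- c * (norm (y + j *\<^sub>R h))\<^sup>2)) \<partial>lborel) * indicator (cball 0 1) y \<le>
       (\<integral>\<^sup>+h. ennreal (exp c * M) * (ennreal \<bar>fdiff k h f y\<bar> / ennreal (norm h powr p)) \<partial>lborel)"
    proof (cases "y \<in> cball 0 1")
      case True
      have "(\<integral>\<^sup>+h. ennreal (\<bar>fdiff k h f y\<bar> * exp (- c * (norm (y + j *\<^sub>R h))\<^sup>2)) \<partial>lborel) \<le>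
       (\<integral>\<^sup>+h. ennreal (exp c * M) * (ennreal \<bar>fdiff k h f y\<bar> / ennreal (norm h powr p)) \<partial>lborel)"
      proof (rule nn_integral_mono_AE, rule AE_mp[OF AE_lborel_singleton[of 0]], intro AE_I2 impI)
        fix h :: "real^'n" assume h: "h \<noteq> 0"
        then have hp: "norm h powr p > 0" by simp
        \<comment> \<open>Since \<open>j \<ge> 1\<close>, decay in \<open>j *\<^sub>R h\<close> is
          at least as strong as decay in \<open>h\<close>.\<close>
        have "norm h \<le> norm (j *\<^sub>R h)" using j by (simp add: mult_le_cancel_right1)
        then have "(norm h)\<^sup>2 \<le> (norm (j *\<^sub>R h))\<^sup>2" by (intro power_mono) auto
        then have "exp (- (c/2) * (norm (j *\<^sub>R h))\<^sup>2) \<le> exp (- (c/2) * (norm h)\<^sup>2)" using c by simp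
        also have "\<dots> \<le> M / norm h powr p"
          using M(2)[of "norm h"] hp by (simp add: pos_le_divide_eq mult.commute)
        finally have "exp c * exp (- (c/2) * (norm (j *\<^sub>R h))\<^sup>2) \<le> exp c * (M / norm h powr p)"
          by (intro mult_left_mono) auto
        with gauss_shift_bound[of y c "j *\<^sub>R h"] True c
        have "exp (- c * (norm (y + j *\<^sub>R h))\<^sup>2) \<le> exp c * (M / norm h powr p)" by simp
        then have "\<bar>fdiff k h f y\<bar> * exp (- c * (norm (y + j *\<^sub>R h))\<^sup>2) \<le> \<bar>fdiff k h f y\<bar> * (exp c * (M / norm h powr p))"
          by (intro mult_left_mono) auto
        also have "\<dots> = (exp c * M) * (\<bar>fdiff k h f y\<bar> / norm h powr p)" by simp
        finally have "ennreal (\<bar>fdiff k h f y\<bar> * exp (- c * (norm (y + j *\<^sub>R h))\<^sup>2)) \<le>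
            ennreal ((exp c * M) * (\<bar>fdiff k h f y\<bar> / norm h powr p))" by (rule ennreal_leI)
        also have "\<dots> = ennreal (exp c * M) * (ennreal \<bar>fdiff k h f y\<bar> / ennreal (norm h powr p))"
          unfolding divide_ennreal[OF abs_ge_zero hp] using M(1) hp by (intro ennreal_mult) auto
        finally show "ennreal (\<bar>fdiff k h f y\<bar> * exp (- c * (norm (y + j *\<^sub>R h))\<^sup>2)) \<le>
          ennreal (exp c * M) * (ennreal \<bar>fdiff k h f y\<bar> / ennreal (norm h powr p))" .
      qed
      then show ?thesis using True by simp
    qed simp
  qed
  also have "\<dots> = (\<integral>\<^sup>+h. \<integral>\<^sup>+y. ennreal (exp c * M) * (ennreal \<bar>fdiff k h f y\<bar> / ennreal (norm h powr p)) \<partial>lborel \<partial>lborel)"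
    by (rule lborel_pair.Fubini') measurable
  also have "\<dots> = (\<integral>\<^sup>+h. ennreal (exp c * M) * (diff_modulus k f h / ennreal (norm h powr p)) \<partial>lborel)"
    unfolding diff_modulus_def
  proof (rule nn_integral_cong)
    fix h :: "real^'n"
    have [measurable]: "(\<lambda>y. fdiff k h f y) \<in> borel_measurable borel"
      using measurable_compose[OF measurable_Pair1'[of h borel borel] fdiff_measurable[OF f, of k]] by simp
    show "(\<integral>\<^sup>+y. ennreal (exp c * M) * (ennreal \<bar>fdiff k h f y\<bar> / ennreal (norm h powr p)) \<partial>lborel) =
        ennreal (exp c * M) * ((\<integral>\<^sup>+y. ennreal \<bar>fdiff k h f y\<bar> \<partial>lborel) / ennreal (norm h powr p))"
      by (simp add: nn_integral_cmult nn_integral_divide)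
  qed
  also have "\<dots> = ennreal (exp c * M) * besov_int k \<sigma> f"
    unfolding besov_int_def p_def by (rule nn_integral_cmult) measurable
  also have "\<dots> < \<infinity>" using fin by (simp add: ennreal_mult_less_top)
  finally show ?thesis .
qed

lemma loc_gauss_finite:
  fixes f :: "real^'n \<Rightarrow> real"
  assumes f: "loc_int f" and c: "c > 0"
  shows "(\<integral>\<^sup>+y\<in>cball 0 1. (\<integral>\<^sup>+x. ennreal (\<bar>f y\<bar> * exp (- c * (norm (x::real^'n))\<^sup>2)) \<partial>lborel) \<partial>lborel) < \<infinity>"
proof -
  have [measurable]: "f \<in> borel_measurable borel" using f by (simp add: loc_int_def)
  have "(\<integral>\<^sup>+y\<in>cball 0 1. (\<integral>\<^sup>+x. ennreal (\<bar>f y\<bar> * exp (- c * (norm (x::real^'n))\<^sup>2)) \<partial>lborel) \<partial>lborel) =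
     (\<integral>\<^sup>+y. (ennreal \<bar>f y\<bar> * indicator (cball 0 1) y) * (\<integral>\<^sup>+x. ennreal (exp (- c * (norm (x::real^'n))\<^sup>2)) \<partial>lborel) \<partial>lborel)"
    by (intro nn_integral_cong) (simp add: ennreal_mult nn_integral_cmult mult_ac)
  also have "\<dots> = (\<integral>\<^sup>+y\<in>cball 0 1. ennreal \<bar>f y\<bar> \<partial>lborel) * (\<integral>\<^sup>+x. ennreal (exp (- c * (norm (x::real^'n))\<^sup>2)) \<partial>lborel)"
    by (rule nn_integral_multc) measurable
  also have "\<dots> < \<infinity>"
    using f integrable_gauss[OF c, where 'n = 'n] by (simp add: loc_int_def ennreal_mult_less_top integrable_iff_bounded)
  finally show ?thesis .
qed

text \<open>The inequality \<open>\<bar>f x\<bar> \<le> \<bar>f y\<bar> + \<bar>f x - f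
  y\<bar>\<close> is integrated against the Gaussian in \<open>x\<close> and over \<open>y\<close>
  in the unit ball. The left-hand side only picks up the volume of the ball; on the right, local
  integrability controls the first term and the Besov integral the second.\<close>

lemma gauss_integrable_first_difference:
  fixes f :: "real^'n \<Rightarrow> real"
  assumes f: "loc_int f" and fin: "besov_int (Suc 0) \<sigma> f < \<infinity>" and \<sigma>: "\<sigma> > 0"
  shows "gauss_integrable f"
proof (rule gauss_integrable_from_nn)
  show m [measurable]: "f \<in> borel_measurable borel" using f by (simp add: loc_int_def)
  fix c :: real assume c: "c > 0"
  let ?b = "emeasure lborel (cball (0::real^'n) 1)"
  let ?A = "\<integral>\<^sup>+x. ennreal (\<bar>f x\<bar> * exp (- c * (norm x)\<^sup>2)) \<partial>lborel"
  have "?b * ?A = (\<integral>\<^sup>+y. ?A * indicator (cball (0::real^'n) 1) y \<partial>lborel)"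
    by (subst nn_integral_cmult) (auto simp: mult.commute)
  also have "\<dots> \<le> (\<integral>\<^sup>+y. (\<integral>\<^sup>+x. ennreal (\<bar>f y\<bar> * exp (- c * (norm (x::real^'n))\<^sup>2)) \<partial>lborel) * indicator (cball 0 1) y +
      (\<integral>\<^sup>+h. ennreal (\<bar>fdiff (Suc 0) h f y\<bar> * exp (- c * (norm (y + 1 *\<^sub>R h))\<^sup>2)) \<partial>lborel) * indicator (cball 0 1) y \<partial>lborel)"
  proof (rule nn_integral_mono)
    fix y :: "real^'n"
    have "(\<integral>\<^sup>+x. ennreal (\<bar>f x\<bar> * exp (- c * (norm x)\<^sup>2)) \<partial>lborel) \<le>
        (\<integral>\<^sup>+x. ennreal (\<bar>f y\<bar> * exp (- c * (norm x)\<^sup>2)) + ennreal (\<bar>f x - f y\<bar> * exp (- c * (norm x)\<^sup>2)) \<partial>lborel)"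
    proof (rule nn_integral_mono)
      fix x :: "real^'n"
      have "\<bar>f x\<bar> * exp (- c * (norm x)\<^sup>2) \<le> (\<bar>f y\<bar> + \<bar>f x - f y\<bar>) * exp (- c * (norm x)\<^sup>2)"
        by (intro mult_right_mono) auto
      from ennreal_leI[OF this] show "ennreal (\<bar>f x\<bar> * exp (- c * (norm x)\<^sup>2)) \<le>
         ennreal (\<bar>f y\<bar> * exp (- c * (norm x)\<^sup>2)) + ennreal (\<bar>f x - f y\<bar> * exp (- c * (norm x)\<^sup>2))"
        unfolding distrib_right by (subst (asm) ennreal_plus) simp_all
    qed
    also have "\<dots> = (\<integral>\<^sup>+x. ennreal (\<bar>f y\<bar> * exp (- c * (norm (x::real^'n))\<^sup>2)) \<partial>lborel) +
        (\<integral>\<^sup>+x. ennreal (\<bar>f x - f y\<bar> * exp (- c * (norm x)\<^sup>2)) \<partial>lborel)"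
      by (rule nn_integral_add) measurable
    also have "(\<integral>\<^sup>+x. ennreal (\<bar>f x - f y\<bar> * exp (- c * (norm x)\<^sup>2)) \<partial>lborel) =
        (\<integral>\<^sup>+h. ennreal (\<bar>f (y + h) - f y\<bar> * exp (- c * (norm (y + h))\<^sup>2)) \<partial>lborel)"
      by (rule nn_integral_lborel_translate[symmetric]) measurable
    finally show "?A * indicator (cball (0::real^'n) 1) y \<le> (\<integral>\<^sup>+x. ennreal (\<bar>f y\<bar> * exp (- c * (norm (x::real^'n))\<^sup>2)) \<partial>lborel) * indicator (cball 0 1) y +
      (\<integral>\<^sup>+h. ennreal (\<bar>fdiff (Suc 0) h f y\<bar> * exp (- c * (norm (y + 1 *\<^sub>R h))\<^sup>2)) \<partial>lborel) * indicator (cball 0 1) y"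
      by (cases "y \<in> cball 0 1") simp_all
  qed
  also have "\<dots> = (\<integral>\<^sup>+y\<in>cball 0 1. (\<integral>\<^sup>+x. ennreal (\<bar>f y\<bar> * exp (- c * (norm (x::real^'n))\<^sup>2)) \<partial>lborel) \<partial>lborel) +
      (\<integral>\<^sup>+y\<in>cball 0 1. (\<integral>\<^sup>+h. ennreal (\<bar>fdiff (Suc 0) h f y\<bar> * exp (- c * (norm (y + 1 *\<^sub>R h))\<^sup>2)) \<partial>lborel) \<partial>lborel)"
    by (rule nn_integral_add) (simp_all add: fdiff_1)
  also have "\<dots> < \<infinity>"
    using loc_gauss_finite[OF f c] difference_part_bound[OF m fin \<sigma> c, of 1] by (simp add: fdiff_1)
  finally have "?b * ?A < \<infinity>" .
  then show "?A < \<infinity>" using emeasure_unit_ball[where 'a = "real^'n"] by (auto simp: ennreal_mult_less_top)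
qed

text \<open>Here \<open>x\<close> is joined to \<open>y\<close> in the unit ball through the midpoint \<open>v\<close>. The Gaussian gains decay in
  passing from \<open>x\<close> to \<open>v\<close>, so on balls of radius \<open>R\<close> the midpoint term is absorbed into half of
  the left-hand side.\<close>

lemma gauss_integrable_second_difference:
  fixes f :: "real^'n \<Rightarrow> real"
  assumes f: "loc_int f" and fin: "besov_int 2 \<sigma> f < \<infinity>" and \<sigma>: "\<sigma> > 0"
  shows "gauss_integrable f"
proof (rule gauss_integrable_from_nn)
  show m [measurable]: "f \<in> borel_measurable borel" using f by (simp add: loc_int_def)
  fix c :: real assume c: "c > 0"
  let ?b = "emeasure lborel (cball (0::real^'n) 1)"
  let ?E = "\<lambda>x::real^'n. exp (- c * (norm x)\<^sup>2)"
  \<comment> \<open>Collects \<open>2 ^ CARD('n)\<close> from the Jacobian of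
    \<open>x = 2 v - y\<close>, the coefficient 2 of the midpoint in the second difference, and
    \<open>exp c\<close> from \<open>gauss_shift_bound\<close>.\<close>
  define q where "q = 2 ^ (CARD('n) + 1) * exp c"
  have q: "q > 0" by (simp add: q_def)
  \<comment> \<open>The radius beyond which the surplus Gaussian factor brings the midpoint term
    down to one half; inside it, local integrability suffices.\<close>
  define V where "V = sqrt (max 0 (ln (2 * q) / c))"
  have V: "q * ?E v \<le> 1/2" if "norm v \<ge> V" for v :: "real^'n"
  proof -
    have "V\<^sup>2 \<le> (norm v)\<^sup>2" using that by (intro power_mono) (auto simp: V_def)
    moreover have "ln (2 * q) / c \<le> V\<^sup>2" by (simp add: V_def)
    ultimately have "ln (2 * q) / c \<le> (norm v)\<^sup>2" by linarith
    then have "ln (2 * q) \<le> (norm v)\<^sup>2 * c" using c by (simp only: pos_divide_le_eq)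
    then have "- c * (norm v)\<^sup>2 \<le> - ln (2 * q)" by (simp add: mult.commute)
    then have "?E v \<le> exp (- ln (2 * q))" by simp
    also have "\<dots> = 1 / (2 * q)" using q by (simp only: exp_minus exp_ln inverse_eq_divide zero_less_mult_iff zero_less_numeral simp_thms)
    finally have "q * ?E v \<le> q * (1 / (2 * q))" using q by (intro mult_left_mono) auto
    then show ?thesis using q by simp
  qed
  \<comment> \<open>Truncation to a ball makes the quantity finite, so that a multiple of it may be
    absorbed.\<close>
  define A where "A R = (\<integral>\<^sup>+x. ennreal (\<bar>f x\<bar> * ?E x) * indicator (cball 0 R) x \<partial>lborel)" for R
  define S1 where "S1 = (\<integral>\<^sup>+y\<in>cball 0 1. (\<integral>\<^sup>+x. ennreal (\<bar>f y\<bar> * ?E x) \<partial>lborel) \<partial>lborel)"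
  define S2 where "S2 = ennreal (2 ^ CARD('n)) * (\<integral>\<^sup>+y\<in>cball 0 1. (\<integral>\<^sup>+h. ennreal (\<bar>fdiff 2 h f y\<bar> * ?E (y + 2 *\<^sub>R h)) \<partial>lborel) \<partial>lborel)"
  define F where "F = (\<integral>\<^sup>+v. ennreal (q * \<bar>f v\<bar>) * indicator (cball 0 V) v \<partial>lborel)"
  have S1: "S1 < \<infinity>" unfolding S1_def by (rule loc_gauss_finite[OF f c])
  have S2: "S2 < \<infinity>" unfolding S2_def using difference_part_bound[OF m fin \<sigma> c, of 2] by (simp add: ennreal_mult_less_top)
  have F: "F < \<infinity>"
  proof -
    have "F = (\<integral>\<^sup>+v. ennreal q * (ennreal \<bar>f v\<bar> * indicator (cball 0 V) v) \<partial>lborel)"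
      unfolding F_def using q by (simp add: ennreal_mult mult.assoc)
    also have "\<dots> = ennreal q * (\<integral>\<^sup>+v. ennreal \<bar>f v\<bar> * indicator (cball 0 V) v \<partial>lborel)"
      by (rule nn_integral_cmult) measurable
    finally show ?thesis using f by (simp add: loc_int_def ennreal_mult_less_top)
  qed
  have A_fin: "A R < \<infinity>" for R
  proof -
    have "A R \<le> (\<integral>\<^sup>+x. ennreal \<bar>f x\<bar> * indicator (cball 0 R) x \<partial>lborel)"
      unfolding A_def using c by (intro nn_integral_mono mult_right_mono ennreal_leI) (auto intro!: mult_left_le)
    also have "\<dots> < \<infinity>" using f by (simp add: loc_int_def)
    finally show ?thesis .
  qed
  have main: "?b * A R \<le> S1 + S2 + ?b * (ennreal (1/2) * A R + F)" if R: "R \<ge> 1" for R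
  proof -
    have pt: "A R * indicator (cball (0::real^'n) 1) y \<le>
        (\<integral>\<^sup>+x. ennreal (\<bar>f y\<bar> * ?E x) \<partial>lborel) * indicator (cball 0 1) y +
        ennreal (2 ^ CARD('n)) * ((\<integral>\<^sup>+h. ennreal (\<bar>fdiff 2 h f y\<bar> * ?E (y + 2 *\<^sub>R h)) \<partial>lborel) * indicator (cball 0 1) y) +
        (ennreal (1/2) * A R + F) * indicator (cball 0 1) y" for y :: "real^'n"
    proof (cases "y \<in> cball 0 1")
      case True
      let ?mid = "\<lambda>x. (1/2) *\<^sub>R (x + y)"
      let ?D = "\<lambda>x. f x - 2 * f (?mid x) + f y"
      have "A R \<le> (\<integral>\<^sup>+x. ennreal (\<bar>f y\<bar> * ?E x) + ennreal (\<bar>?D x\<bar> * ?E x) +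
          ennreal (2 * \<bar>f (?mid x)\<bar> * ?E x) * indicator (cball 0 R) x \<partial>lborel)"
        unfolding A_def
      proof (rule nn_integral_mono)
        fix x :: "real^'n"
        have "\<bar>f x\<bar> * ?E x \<le> (\<bar>f y\<bar> + \<bar>?D x\<bar> + 2 * \<bar>f (?mid x)\<bar>) * ?E x"
          by (intro mult_right_mono) auto
        from ennreal_leI[OF this]
        have "ennreal (\<bar>f x\<bar> * ?E x) \<le> ennreal (\<bar>f y\<bar> * ?E x) + ennreal (\<bar>?D x\<bar> * ?E x) + ennreal (2 * \<bar>f (?mid x)\<bar> * ?E x)"
          unfolding distrib_right by (subst (asm) ennreal_plus, simp, simp, subst (asm) ennreal_plus) simp_all
        then show "ennreal (\<bar>f x\<bar> * ?E x) * indicator (cball 0 R) x \<le> ennreal (\<bar>f y\<bar> * ?E x) + ennreal (\<bar>?D x\<bar> * ?E x) +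
          ennreal (2 * \<bar>f (?mid x)\<bar> * ?E x) * indicator (cball 0 R) x"
          by (cases "x \<in> cball 0 R") simp_all
      qed
      also have "\<dots> = (\<integral>\<^sup>+x. ennreal (\<bar>f y\<bar> * ?E x) \<partial>lborel) + (\<integral>\<^sup>+x. ennreal (\<bar>?D x\<bar> * ?E x) \<partial>lborel) +
          (\<integral>\<^sup>+x. ennreal (2 * \<bar>f (?mid x)\<bar> * ?E x) * indicator (cball 0 R) x \<partial>lborel)"
        by (subst nn_integral_add, simp, simp, subst nn_integral_add) simp_all
      also have "(\<integral>\<^sup>+x. ennreal (\<bar>?D x\<bar> * ?E x) \<partial>lborel) =
          ennreal (2 ^ CARD('n)) * (\<integral>\<^sup>+h. ennreal (\<bar>fdiff 2 h f y\<bar> * ?E (y + 2 *\<^sub>R h)) \<partial>lborel)"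
      proof -
        have "(1/2) *\<^sub>R (y + 2 *\<^sub>R h + y) = y + h" for h :: "real^'n"
        proof -
          have "y + 2 *\<^sub>R h + y = 2 *\<^sub>R (y + h)" by (simp add: scaleR_2 algebra_simps)
          then show ?thesis by simp
        qed
        then show ?thesis
          by (subst nn_integral_lborel_affine[where c = 2 and t = y]) (simp_all add: fdiff_2)
      qed
      \<comment> \<open>The midpoint \<open>v\<close> becomes the integration variable, that is,
        \<open>x = - y + 2 *\<^sub>R v\<close>.\<close>
      also have "(\<integral>\<^sup>+x. ennreal (2 * \<bar>f (?mid x)\<bar> * ?E x) * indicator (cball 0 R) x \<partial>lborel) =
          ennreal (2 ^ CARD('n)) * (\<integral>\<^sup>+v. ennreal (2 * \<bar>f v\<bar> * ?E (- y + 2 *\<^sub>R v)) * indicator (cball 0 R) (- y + 2 *\<^sub>R v) \<partial>lborel)"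
      proof -
        have "(1/2) *\<^sub>R (- y + 2 *\<^sub>R v + y) = v" for v :: "real^'n" by simp
        then show ?thesis
          by (subst nn_integral_lborel_affine[where c = 2 and t = "- y"]) simp_all
      qed
      also have "\<dots> = (\<integral>\<^sup>+v. ennreal (2 ^ CARD('n)) * (ennreal (2 * \<bar>f v\<bar> * ?E (- y + 2 *\<^sub>R v)) * indicator (cball 0 R) (- y + 2 *\<^sub>R v)) \<partial>lborel)"
        by (rule nn_integral_cmult[symmetric]) measurable
      also have "\<dots> \<le> (\<integral>\<^sup>+v. ennreal (1/2) * (ennreal (\<bar>f v\<bar> * ?E v) * indicator (cball 0 R) v) +
           ennreal (q * \<bar>f v\<bar>) * indicator (cball 0 V) v \<partial>lborel)"
      proof (rule nn_integral_mono)
        fix v :: "real^'n"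
        show "ennreal (2 ^ CARD('n)) * (ennreal (2 * \<bar>f v\<bar> * ?E (- y + 2 *\<^sub>R v)) * indicator (cball 0 R) (- y + 2 *\<^sub>R v))
           \<le> ennreal (1/2) * (ennreal (\<bar>f v\<bar> * ?E v) * indicator (cball 0 R) v) + ennreal (q * \<bar>f v\<bar>) * indicator (cball 0 V) v"
        proof (cases "- y + 2 *\<^sub>R v \<in> cball 0 R")
          case In: True
          have "norm (2 *\<^sub>R v) \<le> norm (- y + 2 *\<^sub>R v) + norm y"
            using norm_triangle_ineq[of "- y + 2 *\<^sub>R v" y] by simp
          \<comment> \<open>\<open>2 * norm v \<le> R + 1 \<le> 2 * R\<close>: this is where
            \<open>R \<ge> 1\<close> keeps the midpoint inside the truncated ball.\<close>
          then have vR: "norm v \<le> R" using In True R by simp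
          have "?E (- y + 2 *\<^sub>R v) \<le> exp c * exp (- (c/2) * (norm (2 *\<^sub>R v))\<^sup>2)"
            by (rule gauss_shift_bound) (use True c in auto)
          \<comment> \<open>Doubling \<open>v\<close> quadruples the exponent, which after the loss
            of one half leaves two Gaussian factors: one reproduces \<open>A R\<close>, the other is
            the gain that is small outside \<open>V\<close>.\<close>
          also have "- (c/2) * (norm (2 *\<^sub>R v))\<^sup>2 = - c * (norm v)\<^sup>2 + (- c * (norm v)\<^sup>2)"
            by (simp add: power_mult_distrib)
          finally have e: "?E (- y + 2 *\<^sub>R v) \<le> exp c * (?E v * ?E v)" unfolding exp_add .
          have "2 ^ CARD('n) * (2 * \<bar>f v\<bar> * ?E (- y + 2 *\<^sub>R v)) \<le> 2 ^ CARD('n) * (2 * \<bar>f v\<bar> * (exp c * (?E v * ?E v)))"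
            by (intro mult_left_mono e) auto
          also have "\<dots> = q * \<bar>f v\<bar> * ?E v * ?E v" by (simp add: q_def mult_ac)
          finally have le: "2 ^ CARD('n) * (2 * \<bar>f v\<bar> * ?E (- y + 2 *\<^sub>R v)) \<le> q * \<bar>f v\<bar> * ?E v * ?E v" .
          have lhs: "ennreal (2 ^ CARD('n)) * (ennreal (2 * \<bar>f v\<bar> * ?E (- y + 2 *\<^sub>R v)) * indicator (cball 0 R) (- y + 2 *\<^sub>R v)) \<le>
              ennreal (q * \<bar>f v\<bar> * ?E v * ?E v)"
            using In ennreal_leI[OF le] by (simp add: ennreal_mult)
          show ?thesis
          proof (cases "norm v \<le> V")
            case True
            have "?E v * ?E v \<le> 1" using c by (intro mult_le_one) auto
            then have "q * \<bar>f v\<bar> * (?E v * ?E v) \<le> q * \<bar>f v\<bar> * 1" using q by (intro mult_left_mono) auto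
            then have "ennreal (q * \<bar>f v\<bar> * ?E v * ?E v) \<le> ennreal (q * \<bar>f v\<bar>)" by (intro ennreal_leI) (simp only: mult.assoc mult_1_right)
            also have "\<dots> \<le> ennreal (1/2) * (ennreal (\<bar>f v\<bar> * ?E v) * indicator (cball 0 R) v) + ennreal (q * \<bar>f v\<bar>) * indicator (cball 0 V) v"
              using True by simp
            finally show ?thesis using lhs by (rule order_trans[rotated])
          next
            case False
            then have "(\<bar>f v\<bar> * ?E v) * (q * ?E v) \<le> (\<bar>f v\<bar> * ?E v) * (1/2)"
              using V[of v] by (intro mult_left_mono) auto
            then have "q * \<bar>f v\<bar> * ?E v * ?E v \<le> 1/2 * (\<bar>f v\<bar> * ?E v)"
              by (simp only: mult_ac)
            from ennreal_leI[OF this] have "ennreal (q * \<bar>f v\<bar> * ?E v * ?E v) \<le> ennreal (1/2) * ennreal (\<bar>f v\<bar> * ?E v)"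
              by (subst ennreal_mult[symmetric]) auto
            also have "\<dots> \<le> ennreal (1/2) * (ennreal (\<bar>f v\<bar> * ?E v) * indicator (cball 0 R) v) + ennreal (q * \<bar>f v\<bar>) * indicator (cball 0 V) v"
              using vR by simp
            finally show ?thesis using lhs by (rule order_trans[rotated])
          qed
        qed simp
      qed
      also have "\<dots> = ennreal (1/2) * A R + F"
        unfolding A_def F_def by (subst nn_integral_add, simp, simp, subst nn_integral_cmult) simp_all
      finally show ?thesis using True by (simp add: add_left_mono)
    qed simp
    have "?b * A R = (\<integral>\<^sup>+y. A R * indicator (cball (0::real^'n) 1) y \<partial>lborel)"
      by (subst nn_integral_cmult) (auto simp: mult.commute)
    also have "\<dots> \<le> (\<integral>\<^sup>+y. (\<integral>\<^sup>+x. ennreal (\<bar>f y\<bar> * ?E x) \<partial>lborel) * indicator (cball 0 1) y +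
        ennreal (2 ^ CARD('n)) * ((\<integral>\<^sup>+h. ennreal (\<bar>fdiff 2 h f y\<bar> * ?E (y + 2 *\<^sub>R h)) \<partial>lborel) * indicator (cball 0 1) y) +
        (ennreal (1/2) * A R + F) * indicator (cball 0 1) y \<partial>lborel)"
      by (intro nn_integral_mono pt)
    also have "\<dots> = S1 + S2 + ?b * (ennreal (1/2) * A R + F)"
    proof -
      have 1: "(\<integral>\<^sup>+y. (ennreal (1/2) * A R + F) * indicator (cball (0::real^'n) 1) y \<partial>lborel) = ?b * (ennreal (1/2) * A R + F)"
        by (subst nn_integral_cmult) (auto simp: mult.commute)
      show ?thesis
        unfolding S1_def S2_def fdiff_2 1[symmetric]
        by (subst nn_integral_cmult[symmetric], simp, subst nn_integral_add[symmetric], simp, simp,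
            subst nn_integral_add[symmetric]) simp_all
    qed
    finally show ?thesis .
  qed
  obtain b where b: "?b = ennreal b" "b > 0"
    using emeasure_unit_ball[where 'a = "real^'n"] by (cases ?b) auto
  obtain s where s: "S1 + S2 = ennreal s" "s \<ge> 0" using S1 S2 by (cases "S1 + S2") auto
  obtain r where r: "F = ennreal r" "r \<ge> 0" using F by (cases F) auto
  \<comment> \<open>Solves \<open>b * a \<le> s + b * (a / 2 + r)\<close> for \<open>a\<close>,
    which is legitimate because \<open>a\<close> is finite. The resulting bound no longer involves
    \<open>R\<close>, so Fatou's lemma extends it to the whole space.\<close>
  have A_le: "A R \<le> ennreal (2 * (s / b + r))" if R: "R \<ge> 1" for R
  proof -
    obtain a where a: "A R = ennreal a" "a \<ge> 0" using A_fin[of R] by (cases "A R") auto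
    have "ennreal (b * a) \<le> ennreal (s + b * (1/2 * a + r))"
    proof -
      have "ennreal (1/2) * ennreal a + ennreal r = ennreal (1/2 * a + r)"
        using a r by (simp only: ennreal_mult[symmetric] ennreal_plus[symmetric] zero_le_mult_iff) simp
      then have "ennreal b * ennreal a \<le> ennreal s + ennreal b * ennreal (1/2 * a + r)"
        using main[OF R] unfolding a(1) b(1) s(1) r(1) by simp
      moreover have "ennreal s + ennreal b * ennreal (1/2 * a + r) = ennreal (s + b * (1/2 * a + r))"
        using a b s r by (subst ennreal_mult[symmetric]) auto
      ultimately show ?thesis using a b by (simp only: ennreal_mult[symmetric] less_imp_le)
    qed
    then have "b * a \<le> s + b * (1/2 * a + r)" using a b s r by (subst (asm) ennreal_le_iff) auto
    then have "a \<le> 2 * (s / b + r)" using b by (simp add: field_simps)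
    then show ?thesis unfolding a(1) by (rule ennreal_leI)
  qed
  have "(\<integral>\<^sup>+x. ennreal (\<bar>f x\<bar> * ?E x) \<partial>lborel) \<le> liminf (\<lambda>N. A (real N))"
  proof -
    have "ennreal (\<bar>f x\<bar> * ?E x) = liminf (\<lambda>N. ennreal (\<bar>f x\<bar> * ?E x) * indicator (cball 0 (real N)) x)" for x
    proof (rule lim_imp_Liminf[symmetric])
      obtain N0 :: nat where N0: "norm x \<le> real N0" using real_arch_simple by blast
      show "(\<lambda>N. ennreal (\<bar>f x\<bar> * ?E x) * indicator (cball 0 (real N)) x) \<longlonglongrightarrow> ennreal (\<bar>f x\<bar> * ?E x)"
      proof (rule tendsto_eventually, rule eventually_sequentiallyI[of N0])
        fix N assume "N \<ge> N0"
        then have "x \<in> cball 0 (real N)" using N0 by simp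
        then show "ennreal (\<bar>f x\<bar> * ?E x) * indicator (cball 0 (real N)) x = ennreal (\<bar>f x\<bar> * ?E x)" by simp
      qed
    qed simp
    then show ?thesis unfolding A_def
      using nn_integral_liminf[of "\<lambda>N x. ennreal (\<bar>f x\<bar> * ?E x) * indicator (cball 0 (real N)) x" lborel] by simp
  qed
  also have "\<dots> \<le> ennreal (2 * (s / b + r))"
  proof (rule order_trans[OF Liminf_le_Limsup Limsup_bounded], simp, rule eventually_sequentiallyI[of 1])
    show "A (real N) \<le> ennreal (2 * (s / b + r))" if "1 \<le> N" for N using A_le[of "real N"] that by simp
  qed
  finally show "(\<integral>\<^sup>+x. ennreal (\<bar>f x\<bar> * ?E x) \<partial>lborel) < \<infinity>" by (rule le_less_trans) simp
qed

section \<open>Weak derivatives and tensor products\<close>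

text \<open>A smooth function of one variable is represented by the sequence of all its derivatives.\<close>

definition deriv_seq :: "(nat \<Rightarrow> real \<Rightarrow> real) \<Rightarrow> bool" where
  "deriv_seq G \<longleftrightarrow> (\<forall>k y. (G k has_real_derivative G (Suc k) y) (at y))"

definition test_seq :: "(nat \<Rightarrow> real \<Rightarrow> real) \<Rightarrow> bool" where
  "test_seq G \<longleftrightarrow> deriv_seq G \<and> (\<exists>R. \<forall>k y. \<bar>y\<bar> > R \<longrightarrow> G k y = 0)"

lemma deriv_seq_continuous: "deriv_seq G \<Longrightarrow> continuous_on UNIV (G k)"
  by (rule DERIV_continuous_on[where D = "G (Suc k)"]) (simp add: deriv_seq_def)

lemma deriv_seq_measurable [measurable_dest]: "deriv_seq G \<Longrightarrow> G k \<in> borel_measurable borel"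
  by (intro borel_measurable_continuous_onI deriv_seq_continuous)

lemma test_seq_bounded:
  assumes "test_seq G"
  shows "\<exists>B\<ge>0. \<forall>y. \<bar>G k y\<bar> \<le> B"
proof -
  obtain R where R: "\<And>k y. \<bar>y\<bar> > R \<Longrightarrow> G k y = 0" using assms unfolding test_seq_def by blast
  have "compact (G k ` {-R..R})"
    using assms by (intro compact_continuous_image continuous_on_subset[OF deriv_seq_continuous]) (auto simp: test_seq_def)
  then have "bounded (G k ` {-R..R})" by (rule compact_imp_bounded)
  then obtain B where "\<forall>x\<in>G k ` {-R..R}. norm x \<le> B" unfolding bounded_iff by blast
  then have B: "\<And>y. y \<in> {-R..R} \<Longrightarrow> \<bar>G k y\<bar> \<le> B" by auto
  have "\<bar>G k y\<bar> \<le> max B 0" for y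
  proof (cases "y \<in> {-R..R}")
    case True
    then show ?thesis using B[of y] by simp
  next
    case False
    then have "\<bar>y\<bar> > R" by auto
    then show ?thesis using R[of y k] by simp
  qed
  then show ?thesis by (intro exI[of _ "max B 0"]) auto
qed

lemma test_seq_integrable:
  assumes "test_seq G"
  shows "integrable lborel (G k)"
proof -
  obtain R where R: "\<And>k y. \<bar>y\<bar> > R \<Longrightarrow> G k y = 0" using assms unfolding test_seq_def by blast
  obtain B where B: "B \<ge> 0" "\<And>y. \<bar>G k y\<bar> \<le> B" using test_seq_bounded[OF assms] by blast
  have [measurable]: "G k \<in> borel_measurable borel" using assms by (simp add: test_seq_def deriv_seq_measurable)
  show ?thesis
  proof (rule Bochner_Integration.integrable_bound)
    show "integrable lborel (\<lambda>y. B * indicator {-R..R} y :: real)"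
      by (intro integrable_mult_right integrable_real_indicator) (auto simp: emeasure_lborel_Icc_eq)
    show "AE y in lborel. norm (G k y) \<le> norm (B * indicator {-R..R} y :: real)"
      using B R by (intro AE_I2) (force simp: indicator_def abs_if split: if_splits)
  qed simp
qed

lemma deriv_seq_affine: "deriv_seq G \<Longrightarrow> deriv_seq (\<lambda>k y. d * a ^ k * G k (a * y + b))"
  unfolding deriv_seq_def
proof (intro allI)
  fix k y assume *: "\<forall>k y. (G k has_real_derivative G (Suc k) y) (at y)"
  have "((\<lambda>y. a * y + b) has_real_derivative a) (at y)" by (auto intro!: derivative_eq_intros)
  from DERIV_chain2[where f = "G k" and g = "\<lambda>y. a * y + b", OF *[rule_format] this]
  show "((\<lambda>y. d * a ^ k * G k (a * y + b)) has_real_derivative d * a ^ Suc k * G (Suc k) (a * y + b)) (at y)"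
    by (rule DERIV_cong[OF DERIV_cmult]) simp
qed

text \<open>The \<open>k\<close>-th derivative of a product, without binomial coefficients.\<close>

fun leibniz :: "nat \<Rightarrow> (nat \<Rightarrow> real \<Rightarrow> real) \<Rightarrow> (nat \<Rightarrow> real \<Rightarrow> real) \<Rightarrow> real \<Rightarrow> real" where
  "leibniz 0 G H y = G 0 y * H 0 y"
| "leibniz (Suc k) G H y = leibniz k (\<lambda>j. G (Suc j)) H y + leibniz k G (\<lambda>j. H (Suc j)) y"

lemma deriv_seq_leibniz:
  assumes "deriv_seq G" "deriv_seq H"
  shows "deriv_seq (\<lambda>k. leibniz k G H)"
proof -
  have "(leibniz k G H has_real_derivative leibniz (Suc k) G H y) (at y)" if "deriv_seq G" "deriv_seq H" for k G H y
    using that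
  proof (induction k arbitrary: G H)
    case 0
    then show ?case
      using DERIV_mult[of "G 0" "G 1 y" y UNIV "H 0" "H 1 y"]
      by (simp add: deriv_seq_def leibniz.simps[abs_def] mult.commute)
  next
    case (Suc k)
    have s: "deriv_seq (\<lambda>j. G (Suc j))" "deriv_seq (\<lambda>j. H (Suc j))" using Suc.prems by (auto simp: deriv_seq_def)
    from DERIV_add[OF Suc.IH[OF s(1) Suc.prems(2)] Suc.IH[OF Suc.prems(1) s(2)]]
    show ?case by (simp add: leibniz.simps(2)[abs_def])
  qed
  with assms show ?thesis by (simp add: deriv_seq_def)
qed

lemma leibniz_zero: "(\<And>j. G j y = 0) \<Longrightarrow> leibniz k G H y = 0"
proof (induction k arbitrary: G H)
  case (Suc k)
  then show ?case by simp
qed simp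

lemma test_seq_leibniz:
  assumes "test_seq G" "deriv_seq H"
  shows "test_seq (\<lambda>k. leibniz k G H)"
  using assms deriv_seq_leibniz[of G H] leibniz_zero[of G _ _ H] unfolding test_seq_def by metis

lemma leibniz_bound:
  assumes "\<And>j. j \<le> k \<Longrightarrow> \<bar>G j y\<bar> \<le> a" "\<And>j. j \<le> k \<Longrightarrow> \<bar>H j y\<bar> \<le> b"
  shows "\<bar>leibniz k G H y\<bar> \<le> 2 ^ k * (a * b)"
  using assms
proof (induction k arbitrary: G H)
  case 0
  then show ?case by (simp add: abs_mult) (meson abs_ge_zero mult_mono order_trans)
next
  case (Suc k)
  have "\<bar>leibniz k (\<lambda>j. G (Suc j)) H y\<bar> \<le> 2 ^ k * (a * b)" "\<bar>leibniz k G (\<lambda>j. H (Suc j)) y\<bar> \<le> 2 ^ k * (a * b)"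
    by (rule Suc.IH; use Suc.prems in simp)+
  then show ?case by simp
qed

lemma leibniz_tendsto_0:
  assumes "\<And>j. ((\<lambda>N. G N j y) \<longlongrightarrow> 0) F"
  shows "((\<lambda>N. leibniz k (G N) H y) \<longlongrightarrow> 0) F"
  using assms
proof (induction k arbitrary: G H)
  case 0
  then show ?case by (simp add: tendsto_mult_left_zero)
next
  case (Suc k)
  then show ?case using tendsto_add[OF Suc.IH[of "\<lambda>N j. G N (Suc j)" H] Suc.IH[of G "\<lambda>j. H (Suc j)"]] by simp
qed

text \<open>Of all terms of the Leibniz rule only the one without a derivative on the cutoff
  survives in the limit.\<close>

lemma leibniz_tendsto:
  assumes "((\<lambda>N. G N 0 y) \<longlongrightarrow> 1) F" "\<And>j. ((\<lambda>N. G N (Suc j) y) \<longlongrightarrow> 0) F"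
  shows "((\<lambda>N. leibniz k (G N) H y) \<longlongrightarrow> H k y) F"
  using assms
proof (induction k arbitrary: H)
  case 0
  then show ?case using tendsto_mult[of "\<lambda>N. G N 0 y" 1 F "\<lambda>_. H 0 y" "H 0 y"] by simp
next
  case (Suc k)
  then show ?case using tendsto_add[OF leibniz_tendsto_0[of "\<lambda>N j. G N (Suc j)" y F k H] Suc.IH[of "\<lambda>j. H (Suc j)"]] by simp
qed

text \<open>The derivatives of \<open>exp (- 1 / u)\<close>, extended by \<open>0\<close> to \<open>u \<le> 0\<close>.\<close>

fun flat_poly :: "nat \<Rightarrow> real poly" where
  "flat_poly 0 = 1"
| "flat_poly (Suc k) = [:0, 0, 1:] * (flat_poly k - pderiv (flat_poly k))"

definition flat_exp :: "nat \<Rightarrow> real \<Rightarrow> real" where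
  "flat_exp k u = (if u \<le> 0 then 0 else poly (flat_poly k) (1 / u) * exp (- 1 / u))"

lemma poly_exp_tendsto_0: "((\<lambda>v::real. poly p v * exp (- v)) \<longlongrightarrow> 0) at_top"
proof -
  have "((\<lambda>v::real. \<Sum>i\<le>degree p. coeff p i * (v ^ i / exp v)) \<longlongrightarrow> (\<Sum>i\<le>degree p. coeff p i * 0)) at_top"
    by (intro tendsto_sum tendsto_mult_left tendsto_power_div_exp_0)
  then show ?thesis by (simp add: poly_altdef exp_minus divide_inverse sum_distrib_right mult.assoc)
qed

text \<open>For \<open>u > 0\<close> the derivative of \<open>p (1 / u) * exp (- 1 / u)\<close> is
  \<open>(p - p') (1 / u) * exp (- 1 / u) / u\<^sup>2\<close>, which is the recurrence of
  \<open>flat_poly\<close>. At 0 the right-hand difference quotient is again a polynomial in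
  \<open>1 / u\<close> times \<open>exp (- 1 / u)\<close>, and so tends to 0.\<close>

lemma deriv_seq_flat_exp: "deriv_seq flat_exp"
  unfolding deriv_seq_def
proof (intro allI)
  fix k and u :: real
  consider "u < 0" | "u > 0" | "u = 0" by linarith
  then show "(flat_exp k has_real_derivative flat_exp (Suc k) u) (at u)"
  proof cases
    case 1
    have "\<forall>\<^sub>F v in nhds u. v \<in> {..<0}" using 1 by (intro eventually_nhds_in_open) auto
    then have "\<forall>\<^sub>F v in nhds u. flat_exp k v = 0" by eventually_elim (simp add: flat_exp_def)
    from DERIV_cong_ev[OF refl this refl, THEN iffD2, OF DERIV_const]
    have "(flat_exp k has_real_derivative 0) (at u)" .
    then show ?thesis using 1 by (simp add: flat_exp_def)
  next
    case 2
    have "\<forall>\<^sub>F v in nhds u. v \<in> {0<..}" using 2 by (intro eventually_nhds_in_open) auto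
    then have ev: "\<forall>\<^sub>F v in nhds u. flat_exp k v = poly (flat_poly k) (1 / v) * exp (- 1 / v)"
      by eventually_elim (simp add: flat_exp_def)
    have i: "((\<lambda>v. 1 / v) has_real_derivative - 1 / u\<^sup>2) (at u)"
      using 2 by (auto intro!: derivative_eq_intros simp: power2_eq_square)
    have p: "((\<lambda>v. poly (flat_poly k) (1 / v)) has_real_derivative poly (pderiv (flat_poly k)) (1 / u) * (- 1 / u\<^sup>2)) (at u)"
      by (rule DERIV_chain2[OF poly_DERIV i])
    have e: "((\<lambda>v. exp (- 1 / v)) has_real_derivative exp (- 1 / u) * (1 / u\<^sup>2)) (at u)"
      using 2 by (auto intro!: derivative_eq_intros simp: power2_eq_square)
    have "((\<lambda>v. poly (flat_poly k) (1 / v) * exp (- 1 / v)) has_real_derivative flat_exp (Suc k) u) (at u)"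
      by (rule DERIV_cong[OF DERIV_mult[OF p e]]) (use 2 in \<open>simp add: flat_exp_def power2_eq_square algebra_simps\<close>)
    then show ?thesis by (subst DERIV_cong_ev[OF refl ev refl])
  next
    case 3
    have "((\<lambda>h. flat_exp k h / h) \<longlongrightarrow> 0) (at_left 0)"
      by (rule tendsto_eventually) (auto simp: eventually_at_filter flat_exp_def)
    moreover have "((\<lambda>h. flat_exp k h / h) \<longlongrightarrow> 0) (at_right 0)"
    proof -
      have "((\<lambda>h. poly ([:0, 1:] * flat_poly k) (inverse h) * exp (- inverse h)) \<longlongrightarrow> 0) (at_right (0::real))"
        by (rule filterlim_compose[OF poly_exp_tendsto_0 filterlim_inverse_at_top_right])
      then show ?thesis
        by (rule Lim_transform_eventually) (auto simp: eventually_at_filter flat_exp_def divide_inverse)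
    qed
    ultimately have "((\<lambda>h. flat_exp k h / h) \<longlongrightarrow> 0) (at 0)"
      by (simp add: filterlim_at_split)
    then show ?thesis unfolding 3 DERIV_def by (simp add: flat_exp_def)
  qed
qed

section \<open>Bump functions and cutoffs\<close>

text \<open>The derivatives of \<open>exp (2 - 1 / (1 - y) - 1 / (1 + y))\<close> on the interval
  from -1 to 1, extended by 0; \<open>exp 2\<close> normalises the value at 0 to 1. The redundant
  factors put both functions into the shape of \<open>deriv_seq_affine\<close>.\<close>

definition bump :: "nat \<Rightarrow> real \<Rightarrow> real" where
  "bump k = leibniz k (\<lambda>k y. exp 2 * (- 1) ^ k * flat_exp k ((- 1) * y + 1)) (\<lambda>k y. 1 * 1 ^ k * flat_exp k (1 * y + 1))"

lemma deriv_seq_bump: "deriv_seq bump"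
  unfolding bump_def[abs_def] by (intro deriv_seq_leibniz deriv_seq_affine deriv_seq_flat_exp)

lemma bump_0: "bump 0 y = (if \<bar>y\<bar> < 1 then exp 2 * (exp (- 1 / (1 - y)) * exp (- 1 / (1 + y))) else 0)"
  by (auto simp: bump_def flat_exp_def abs_if)

lemma leibniz_zero_right: "(\<And>j. H j y = 0) \<Longrightarrow> leibniz k G H y = 0"
proof (induction k arbitrary: G H)
  case (Suc k)
  then show ?case by simp
qed simp

lemma bump_supp: "\<bar>y\<bar> > 1 \<Longrightarrow> bump k y = 0"
  unfolding bump_def by (cases "y > 0") (rule leibniz_zero, simp add: flat_exp_def, rule leibniz_zero_right, simp add: flat_exp_def)

lemma test_seq_bump: "test_seq bump"
  using deriv_seq_bump bump_supp unfolding test_seq_def by blast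

lemma bump_at_0: "bump 0 0 = 1"
  by (simp add: bump_0 flip: exp_add)

lemma bump_range: "0 \<le> bump 0 y" "bump 0 y \<le> 1"
proof -
  show "0 \<le> bump 0 y" by (simp add: bump_0)
  show "bump 0 y \<le> 1"
  proof (cases "\<bar>y\<bar> < 1")
    case True
    then have p: "1 - y > 0" "1 + y > 0" by auto
    have "2 \<le> 1 / (1 - y) + 1 / (1 + y)"
    proof -
      have "1 / (1 - y) + 1 / (1 + y) = 2 / ((1 - y) * (1 + y))" using p by (simp add: add_divide_eq_iff divide_add_eq_iff)
      moreover have "(1 - y) * (1 + y) \<le> 1" by (simp add: algebra_simps)
      moreover have "2 / 1 \<le> 2 / ((1 - y) * (1 + y))"
        using p \<open>(1 - y) * (1 + y) \<le> 1\<close> by (intro divide_left_mono) auto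
      ultimately show ?thesis by simp
    qed
    then have "exp (2 + (- 1 / (1 - y) + - 1 / (1 + y))) \<le> 1" by simp
    then show ?thesis using True unfolding bump_0 exp_add by simp
  qed (simp add: bump_0)
qed

text \<open>The derivatives of the dilated bump, as a cutoff: as \<open>N\<close> grows it tends to
  1 and its derivatives tend to 0 pointwise, with bounds uniform in \<open>N\<close>.\<close>

definition bump_at_scale :: "nat \<Rightarrow> nat \<Rightarrow> real \<Rightarrow> real" where
  "bump_at_scale N k y = 1 * (1 / real (Suc N)) ^ k * bump k ((1 / real (Suc N)) * y + 0)"

lemma test_seq_bump_at_scale: "test_seq (bump_at_scale N)"
  unfolding test_seq_def
proof (intro conjI exI[of _ "real (Suc N)"] allI impI)
  show "deriv_seq (bump_at_scale N)" unfolding bump_at_scale_def[abs_def] by (intro deriv_seq_affine deriv_seq_bump)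
  fix k and y :: real assume "\<bar>y\<bar> > real (Suc N)"
  then show "bump_at_scale N k y = 0"
    unfolding bump_at_scale_def by (subst bump_supp) (auto simp: abs_mult field_simps)
qed

lemma bump_at_scale_bound: "\<exists>B\<ge>0. \<forall>N y j. j \<le> k \<longrightarrow> \<bar>bump_at_scale N j y\<bar> \<le> B"
proof -
  have "\<forall>j. \<exists>B\<ge>0. \<forall>y. \<bar>bump j y\<bar> \<le> B" using test_seq_bounded[OF test_seq_bump] by blast
  then obtain B where B: "\<And>j. B j \<ge> 0" "\<And>j y. \<bar>bump j y\<bar> \<le> B j" by metis
  have "\<bar>bump_at_scale N j y\<bar> \<le> (\<Sum>j\<le>k. B j)" if "j \<le> k" for N j y
  proof -
    have "\<bar>bump_at_scale N j y\<bar> = (1 / real (Suc N)) ^ j * \<bar>bump j ((1 / real (Suc N)) * y + 0)\<bar>"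
      by (simp add: bump_at_scale_def abs_mult)
    also have "\<dots> \<le> 1 * B j" by (intro mult_mono power_le_one B) auto
    also have "\<dots> \<le> (\<Sum>j\<le>k. B j)" using that B by (simp add: member_le_sum)
    finally show ?thesis .
  qed
  then show ?thesis using B(1) by (intro exI[of _ "\<Sum>j\<le>k. B j"]) (auto intro!: sum_nonneg)
qed

lemma bump_at_scale_tendsto:
  "(\<lambda>N. bump_at_scale N 0 y) \<longlonglongrightarrow> 1" "(\<lambda>N. bump_at_scale N (Suc j) y) \<longlonglongrightarrow> 0"
proof -
  have i: "(\<lambda>N. 1 / real (Suc N)) \<longlonglongrightarrow> 0" using LIMSEQ_inverse_real_of_nat by (simp add: inverse_eq_divide)
  have b: "(\<lambda>N. bump k ((1 / real (Suc N)) * y + 0)) \<longlonglongrightarrow> bump k (0 * y + 0)" for k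
    by (rule continuous_on_tendsto_compose[OF deriv_seq_continuous[OF deriv_seq_bump] tendsto_add[OF tendsto_mult[OF i tendsto_const] tendsto_const]]) auto
  from b[of 0] show "(\<lambda>N. bump_at_scale N 0 y) \<longlonglongrightarrow> 1"
    unfolding bump_at_scale_def by (simp add: bump_at_0 del: of_nat_Suc)
  have "(\<lambda>N. 1 * (1 / real (Suc N)) ^ Suc j * bump (Suc j) ((1 / real (Suc N)) * y + 0)) \<longlonglongrightarrow> 1 * 0 ^ Suc j * bump (Suc j) (0 * y + 0)"
    by (intro tendsto_mult tendsto_power tendsto_const i b)
  then show "(\<lambda>N. bump_at_scale N (Suc j) y) \<longlonglongrightarrow> 0" by (simp add: bump_at_scale_def)
qed

text \<open>Tensor products suffice as test functions throughout, and their derivatives are explicit.\<close>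

definition tensor_weak_deriv :: "('n::finite \<Rightarrow> nat) \<Rightarrow> (real^'n \<Rightarrow> real) \<Rightarrow> (real^'n \<Rightarrow> real) \<Rightarrow> bool" where
  "tensor_weak_deriv \<alpha> f g \<longleftrightarrow> (\<forall>G. (\<forall>i. test_seq (G i)) \<longrightarrow>
     (LINT x|lborel. f x * (\<Prod>i\<in>UNIV. G i (\<alpha> i) (x $ i))) =
     (-1) ^ msize \<alpha> * (LINT x|lborel. g x * (\<Prod>i\<in>UNIV. G i 0 (x $ i))))"

text \<open>Shifting the \<open>i\<close>-th sequence of a tensor test function by one
  differentiates it in direction \<open>i\<close> and again gives a test function. Testing
  \<open>f\<close> with it in two ways relates \<open>g\<close> and \<open>h\<close>; the common
  sign cancels.\<close>

lemma tensor_weak_deriv_step: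
  assumes "tensor_weak_deriv \<alpha> f g" "tensor_weak_deriv (\<alpha>(i := Suc (\<alpha> i))) f h"
  shows "tensor_weak_deriv ((\<lambda>_. 0)(i := 1)) g h"
  unfolding tensor_weak_deriv_def
proof (intro allI impI)
  fix G :: "'a \<Rightarrow> nat \<Rightarrow> real \<Rightarrow> real" assume G: "\<forall>i. test_seq (G i)"
  define G' where "G' j = (if j = i then (\<lambda>k. G j (Suc k)) else G j)" for j
  have "test_seq (\<lambda>k. G i (Suc k))" using G by (fastforce simp: test_seq_def deriv_seq_def)
  then have G': "\<forall>j. test_seq (G' j)" using G by (simp add: G'_def)
  let ?e = "(\<lambda>_. 0)(i := 1) :: 'a \<Rightarrow> nat"
  have e: "msize ?e = 1" using msize_upd[of "\<lambda>_. 0" i 1] by simp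
  have m: "msize (\<alpha>(i := Suc (\<alpha> i))) = Suc (msize \<alpha>)" using msize_upd[of \<alpha> i 1] by simp
  have 1: "G' j (\<alpha> j) = G j ((\<alpha>(i := Suc (\<alpha> i))) j)" for j by (simp add: G'_def)
  have 2: "G' j 0 = G j (?e j)" for j by (simp add: G'_def)
  have "(-1) ^ msize \<alpha> * (LINT x|lborel. g x * (\<Prod>j\<in>UNIV. G j (?e j) (x $ j))) =
     (-1) ^ msize \<alpha> * (- (LINT x|lborel. h x * (\<Prod>j\<in>UNIV. G j 0 (x $ j))))"
    using assms(1)[unfolded tensor_weak_deriv_def, rule_format, of G'] assms(2)[unfolded tensor_weak_deriv_def, rule_format, of G] G G'
    unfolding 1 2 m by simp
  then have "(LINT x|lborel. g x * (\<Prod>j\<in>UNIV. G j (?e j) (x $ j))) = - (LINT x|lborel. h x * (\<Prod>j\<in>UNIV. G j 0 (x $ j)))"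
    by (subst (asm) mult_cancel_left) simp
  then show "(LINT x|lborel. g x * (\<Prod>j\<in>UNIV. G j (?e j) (x $ j))) =
     (-1) ^ msize ?e * (LINT x|lborel. h x * (\<Prod>j\<in>UNIV. G j 0 (x $ j)))"
    unfolding e by simp
qed

lemma partials_tensor:
  assumes "\<And>i. deriv_seq (G i)"
  shows "partials (map (\<lambda>i. axis i 1) js) (\<lambda>x::real^'n. \<Prod>i\<in>UNIV. G i (k i) (x $ i)) =
     (\<lambda>x. \<Prod>i\<in>UNIV. G i (k i + count_list js i) (x $ i))"
proof (induction js)
  case (Cons j js)
  let ?g = "\<lambda>i. G i (k i + count_list js i)"
  have "partial (axis j 1) (\<lambda>x. \<Prod>i\<in>UNIV. ?g i (x $ i)) x = (\<Prod>i\<in>UNIV. G i (k i + count_list (j # js) i) (x $ i))" for x :: "real^'n"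
  proof -
    have "((\<lambda>r. \<Prod>i\<in>UNIV. ?g i ((x + r *\<^sub>R axis j 1) $ i)) has_real_derivative
       G j (Suc (k j + count_list js j)) (x $ j + 0) * (\<Prod>i\<in>UNIV-{j}. ?g i ((x + 0 *\<^sub>R axis j 1) $ i))) (at 0)"
      by (rule tensor_deriv[where g = ?g]) (use assms in \<open>simp add: deriv_seq_def\<close>)
    then have "partial (axis j 1) (\<lambda>x. \<Prod>i\<in>UNIV. ?g i (x $ i)) x =
       G j (Suc (k j + count_list js j)) (x $ j + 0) * (\<Prod>i\<in>UNIV-{j}. ?g i ((x + 0 *\<^sub>R axis j 1) $ i))"
      unfolding partial_def by (rule DERIV_imp_deriv)
    also have "(\<Prod>i\<in>UNIV-{j}. ?g i ((x + 0 *\<^sub>R axis j 1) $ i)) = (\<Prod>i\<in>UNIV-{j}. G i (k i + count_list (j # js) i) (x $ i))"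
      by (rule prod.cong) auto
    also have "G j (Suc (k j + count_list js j)) (x $ j + 0) * \<dots> = (\<Prod>i\<in>UNIV. G i (k i + count_list (j # js) i) (x $ i))"
      by (subst prod.remove[of UNIV j]) auto
    finally show ?thesis .
  qed
  then have "partial (axis j 1) (\<lambda>x. \<Prod>i\<in>UNIV. ?g i (x $ i)) = (\<lambda>x. \<Prod>i\<in>UNIV. G i (k i + count_list (j # js) i) (x $ i))" ..
  then show ?case by (simp only: list.map foldr.simps comp_apply Cons)
qed simp

lemma lists_Basis_vec: "bs \<in> lists (Basis :: (real^'n) set) \<Longrightarrow> \<exists>js. bs = map (\<lambda>i. axis i 1) js"
proof (induction bs)
  case (Cons b bs)
  then obtain js where "bs = map (\<lambda>i. axis i 1) js" by auto
  moreover obtain i where "b = axis i 1" using Cons.prems by (auto simp: Basis_vec_real)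
  ultimately show ?case by (intro exI[of _ "i # js"]) simp
qed simp

lemma tensor_differentiable:
  assumes "\<And>i y. (g i has_real_derivative g' i y) (at y)"
  shows "(\<lambda>x::real^'n. \<Prod>i\<in>UNIV. g i (x $ i)) differentiable (at x)"
proof -
  have 1: "(\<lambda>x::real^'n. g i (x $ i)) differentiable (at x)" for i
  proof -
    have "((\<lambda>x::real^'n. x $ i) has_derivative (\<lambda>x. x $ i)) (at x)"
      by (intro bounded_linear.has_derivative[OF bounded_linear_vec_nth] has_derivative_ident)
    from has_derivative_compose[OF this assms[of i, unfolded has_field_derivative_def]]
    show ?thesis unfolding differentiable_def by blast
  qed
  have "(\<lambda>x::real^'n. \<Prod>i\<in>A. g i (x $ i)) differentiable (at x)" for A
    by (induction A rule: infinite_finite_induct) (auto intro!: differentiable_mult 1)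
  then show ?thesis .
qed

lemma test_fun_tensor:
  assumes "\<And>i. test_seq (G i)"
  shows "test_fun (\<lambda>x::real^'n. \<Prod>i\<in>UNIV. G i 0 (x $ i))"
  unfolding test_fun_def smooth_def
proof (intro conjI ballI)
  have s: "\<And>i. deriv_seq (G i)" using assms by (simp add: test_seq_def)
  fix bs assume "bs \<in> lists (Basis :: (real^'n) set)"
  then obtain js where bs: "bs = map (\<lambda>i. axis i 1) js" using lists_Basis_vec by blast
  have "partials bs (\<lambda>x::real^'n. \<Prod>i\<in>UNIV. G i 0 (x $ i)) = (\<lambda>x. \<Prod>i\<in>UNIV. G i (count_list js i) (x $ i))"
    unfolding bs using partials_tensor[OF s, where k = "\<lambda>_. 0"] by simp
  then show "partials bs (\<lambda>x::real^'n. \<Prod>i\<in>UNIV. G i 0 (x $ i)) differentiable_on UNIV"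
    using s by (auto simp: differentiable_on_def deriv_seq_def intro!: tensor_differentiable)
next
  have "\<forall>i. \<exists>R. \<forall>y. \<bar>y\<bar> > R \<longrightarrow> G i 0 y = 0" using assms unfolding test_seq_def by blast
  then obtain R where R: "\<And>i y. \<bar>y\<bar> > R i \<Longrightarrow> G i 0 y = 0" by metis
  have "norm x \<le> (\<Sum>i\<in>UNIV. \<bar>R i\<bar>)" if "(\<Prod>i\<in>UNIV. G i 0 (x $ i)) \<noteq> 0" for x :: "real^'n"
  proof -
    have "\<bar>x $ i\<bar> \<le> \<bar>R i\<bar>" for i
      using that R[of i "x $ i"] by (force simp: not_less)
    then show ?thesis by (intro order_trans[OF norm_le_l1_cart] sum_mono)
  qed
  then have "bounded {x::real^'n. (\<Prod>i\<in>UNIV. G i 0 (x $ i)) \<noteq> 0}"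
    unfolding bounded_iff by blast
  then show "compact (closure {x::real^'n. (\<Prod>i\<in>UNIV. G i 0 (x $ i)) \<noteq> 0})" by simp
qed

lemma count_list_surj: "\<exists>js. count_list js = (\<alpha> :: 'n::finite \<Rightarrow> nat)"
proof (induction \<alpha> rule: multi_index_induct)
  case zero
  show ?case by (rule exI[of _ "[]"]) auto
next
  case (step \<alpha> i)
  then obtain js where "count_list js = \<alpha>" by blast
  then have "count_list (i # js) = \<alpha>(i := Suc (\<alpha> i))" by (auto simp: fun_eq_iff)
  then show ?case by blast
qed

lemma tensor_measurable:
  fixes g :: "'n::finite \<Rightarrow> real \<Rightarrow> real"
  assumes "\<And>i. g i \<in> borel_measurable borel"
  shows "(\<lambda>x::real^'n. \<Prod>i\<in>UNIV. g i (x $ i)) \<in> borel_measurable borel"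
proof -
  have "(\<lambda>x::real^'n. x $ i) \<in> borel_measurable borel" for i
    by (intro borel_measurable_continuous_onI continuous_intros)
  then have m: "(\<lambda>x::real^'n. g i (x $ i)) \<in> borel_measurable borel" for i
    using measurable_compose assms by blast
  show ?thesis by (rule borel_measurable_prod) (rule m)
qed

lemma lebesgue_integral_AE_borel:
  fixes f f' h :: "real^'n \<Rightarrow> real"
  assumes f: "f \<in> borel_measurable lebesgue" and f' [measurable]: "f' \<in> borel_measurable borel"
    and ae: "AE x in lborel. f x = f' x" and h [measurable]: "h \<in> borel_measurable borel"
  shows "(LINT x|lebesgue. f x * h x) = (LINT x|lborel. f' x * h x)"
proof -
  have "h \<in> borel_measurable lebesgue" "f' \<in> borel_measurable lebesgue"
    by (intro measurable_completion; simp)+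
  then have "(LINT x|lebesgue. f x * h x) = (LINT x|lebesgue. f' x * h x)"
    using f AE_completion[OF ae] by (intro integral_cong_AE) (auto elim!: eventually_mono)
  also have "\<dots> = (LINT x|lborel. f' x * h x)" by (rule integral_completion) simp
  finally show ?thesis .
qed

text \<open>The list \<open>js\<close> realises \<open>\<alpha>\<close> as an order of
  differentiation of a tensor product; a.e. equality lets Borel representatives replace
  \<open>f\<close> and \<open>g\<close> under the integrals.\<close>

lemma is_weak_deriv_imp_tensor:
  assumes wd: "is_weak_deriv \<alpha> f g"
    and f: "f \<in> borel_measurable lebesgue" "f' \<in> borel_measurable borel" "AE x in lborel. f x = f' x"
    and g: "g \<in> borel_measurable lebesgue" "g' \<in> borel_measurable borel" "AE x in lborel. g x = g' x"
  shows "tensor_weak_deriv \<alpha> f' g'"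
  unfolding tensor_weak_deriv_def
proof (intro allI impI)
  fix G :: "'a \<Rightarrow> nat \<Rightarrow> real \<Rightarrow> real" assume G: "\<forall>i. test_seq (G i)"
  then have s: "\<And>i. deriv_seq (G i)" by (simp add: test_seq_def)
  have m: "(\<lambda>x::real^'a. \<Prod>i\<in>UNIV. G i (k i) (x $ i)) \<in> borel_measurable borel" for k
    by (rule tensor_measurable) (rule deriv_seq_measurable[OF s])
  obtain js where js: "count_list js = \<alpha>" using count_list_surj by blast
  have p: "partials (map (\<lambda>i. axis i 1) js) (\<lambda>x::real^'a. \<Prod>i\<in>UNIV. G i 0 (x $ i)) = (\<lambda>x. \<Prod>i\<in>UNIV. G i (\<alpha> i) (x $ i))"
    using partials_tensor[OF s, where k = "\<lambda>_. 0" and js = js] js by simp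
  have t: "test_fun (\<lambda>x::real^'a. \<Prod>i\<in>UNIV. G i 0 (x $ i))"
    by (rule test_fun_tensor) (use G in blast)
  from wd[unfolded is_weak_deriv_def, THEN spec, THEN spec, THEN mp, OF conjI[OF t js]]
  have "(LINT x|lebesgue. f x * (\<Prod>i\<in>UNIV. G i (\<alpha> i) (x $ i))) =
     (-1) ^ msize \<alpha> * (LINT x|lebesgue. g x * (\<Prod>i\<in>UNIV. G i 0 (x $ i)))"
    unfolding p .
  then show "(LINT x|lborel. f' x * (\<Prod>i\<in>UNIV. G i (\<alpha> i) (x $ i))) =
     (-1) ^ msize \<alpha> * (LINT x|lborel. g' x * (\<Prod>i\<in>UNIV. G i 0 (x $ i)))"
    using lebesgue_integral_AE_borel[OF f m[of \<alpha>]] lebesgue_integral_AE_borel[OF g m[of "\<lambda>_. 0"]] by simp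
qed

section \<open>Moving weak derivatives through the convolution\<close>

lemma heat1_dom:
  assumes "t > 0"
  shows "\<exists>C\<ge>0. \<forall>y. \<forall>j\<le>k. \<bar>heat1 (b + j) t (x - y)\<bar> \<le> C * exp (- (1 / (16 * t\<^sup>2)) * y\<^sup>2)"
proof -
  have "\<forall>l. \<exists>C>0. \<forall>y. \<bar>heat1 l t y\<bar> \<le> C / t ^ (l + 1) * exp (- y\<^sup>2 / (8 * t\<^sup>2))"
    using heat1_bound assms by metis
  then obtain C where C: "\<And>l. C l > 0" "\<And>l y. \<bar>heat1 l t y\<bar> \<le> C l / t ^ (l + 1) * exp (- y\<^sup>2 / (8 * t\<^sup>2))"
    by metis
  define D where "D = (\<Sum>j\<le>k. C (b + j) / t ^ (b + j + 1))"
  have Dj: "C (b + j) / t ^ (b + j + 1) \<le> D" if "j \<le> k" for j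
    unfolding D_def using that assms C(1) by (intro member_le_sum) (auto intro: less_imp_le)
  have D: "D \<ge> 0" unfolding D_def using C(1) assms by (intro sum_nonneg) (auto intro: less_imp_le)
  have "\<bar>heat1 (b + j) t (x - y)\<bar> \<le> D * exp (x\<^sup>2 / (8 * t\<^sup>2)) * exp (- (1 / (16 * t\<^sup>2)) * y\<^sup>2)" if "j \<le> k" for j y
  proof -
    have "y\<^sup>2 / 2 - x\<^sup>2 \<le> (x - y)\<^sup>2" using norm_diff_sq_ge[of y x] by simp
    then have "(y\<^sup>2 / 2 - x\<^sup>2) / (8 * t\<^sup>2) \<le> (x - y)\<^sup>2 / (8 * t\<^sup>2)" by (intro divide_right_mono) auto
    then have "- (x - y)\<^sup>2 / (8 * t\<^sup>2) \<le> x\<^sup>2 / (8 * t\<^sup>2) + (- (1 / (16 * t\<^sup>2)) * y\<^sup>2)"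
      by (simp add: diff_divide_distrib)
    then have "C (b + j) / t ^ (b + j + 1) * exp (- (x - y)\<^sup>2 / (8 * t\<^sup>2)) \<le> D * exp (x\<^sup>2 / (8 * t\<^sup>2) + (- (1 / (16 * t\<^sup>2)) * y\<^sup>2))"
      using Dj[OF that] D by (intro mult_mono) auto
    then show ?thesis unfolding exp_add using C(2)[of "b + j" "x - y"] by (simp only: mult.assoc)
  qed
  then show ?thesis using D by (intro exI[of _ "D * exp (x\<^sup>2 / (8 * t\<^sup>2))"]) auto
qed

text \<open>The kernel is not an admissible test function, since its support is not compact. It is
  cut off in each coordinate by \<open>bump_at_scale N\<close>, and \<open>N\<close> tends to
  infinity by dominated convergence; the majorant uses the Gaussian integrability of both
  \<open>f\<close> and \<open>g\<close>.\<close>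

lemma heat_conv_weak_deriv:
  fixes f g :: "real^'n \<Rightarrow> real"
  assumes wd: "tensor_weak_deriv \<alpha> f g" and f: "gauss_integrable f" and g: "gauss_integrable g" and t: "t > 0"
  shows "heat_conv (\<lambda>i. \<beta> i + \<alpha> i) f t x = heat_conv \<beta> g t x"
proof -
  \<comment> \<open>The \<open>k\<close>-th derivative in \<open>y\<close> of the
    \<open>i\<close>-th factor of \<open>heat \<beta> t (x - y)\<close>, hence the sign
    \<open>(-1) ^ k\<close>.\<close>
  define H where "H i k y = 1 * (-1) ^ k * heat1 (\<beta> i + k) t ((-1) * y + x $ i)" for i k y
  have "deriv_seq (\<lambda>k. heat1 (b + k) t)" for b unfolding deriv_seq_def using heat1_deriv_y[of t] t by auto
  then have H: "deriv_seq (H i)" for i unfolding H_def[abs_def] by (intro deriv_seq_affine)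
  define G where "G N i k = leibniz k (bump_at_scale N) (H i)" for N i k
  have bG: "test_seq (G N i)" for N i
    unfolding G_def[abs_def] by (intro test_seq_leibniz test_seq_bump_at_scale H)
  define c where "c = 1 / (16 * t\<^sup>2)"
  have c: "c > 0" using t by (simp add: c_def)
  have lim: "(\<lambda>N. LINT y|lborel. v y * (\<Prod>i\<in>UNIV. G N i (\<gamma> i) (y $ i))) \<longlonglongrightarrow>
      (LINT y|lborel. v y * (\<Prod>i\<in>UNIV. H i (\<gamma> i) (y $ i)))" if v: "gauss_integrable v" for v \<gamma>
  proof -
    have [measurable]: "v \<in> borel_measurable borel" using v by (simp add: gauss_integrable_def)
    have "\<forall>i. \<exists>C\<ge>0. \<forall>N y. \<bar>G N i (\<gamma> i) y\<bar> \<le> C * exp (- c * y\<^sup>2)"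
    proof
      fix i
      obtain B where B: "B \<ge> 0" "\<And>N y j. j \<le> \<gamma> i \<Longrightarrow> \<bar>bump_at_scale N j y\<bar> \<le> B"
        using bump_at_scale_bound by blast
      obtain C where C: "C \<ge> 0" "\<And>y j. j \<le> \<gamma> i \<Longrightarrow> \<bar>heat1 (\<beta> i + j) t (x $ i - y)\<bar> \<le> C * exp (- c * y\<^sup>2)"
        using heat1_dom[OF t, of "\<gamma> i" "\<beta> i" "x $ i"] unfolding c_def by blast
      have "\<bar>H i j y\<bar> \<le> C * exp (- c * y\<^sup>2)" if "j \<le> \<gamma> i" for j y
        using C(2)[OF that, of y] by (simp add: H_def abs_mult power_abs add.commute)
      then have "\<bar>G N i (\<gamma> i) y\<bar> \<le> 2 ^ \<gamma> i * (B * (C * exp (- c * y\<^sup>2)))" for N y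
        unfolding G_def by (intro leibniz_bound B(2))
      then show "\<exists>C\<ge>0. \<forall>N y. \<bar>G N i (\<gamma> i) y\<bar> \<le> C * exp (- c * y\<^sup>2)"
        using B(1) C(1) by (intro exI[of _ "2 ^ \<gamma> i * (B * C)"]) (auto simp: mult.assoc)
    qed
    then obtain C where C: "\<And>i. C i \<ge> 0" "\<And>i N y. \<bar>G N i (\<gamma> i) y\<bar> \<le> C i * exp (- c * y\<^sup>2)" by metis
    show ?thesis
    proof (rule integral_dominated_convergence[where w = "\<lambda>y. (\<Prod>i\<in>UNIV. C i) * \<bar>exp (- c * (norm y)\<^sup>2) * v y\<bar>"])
      show "(\<lambda>y. v y * (\<Prod>i\<in>UNIV. H i (\<gamma> i) (y $ i))) \<in> borel_measurable lborel"
        "\<And>N. (\<lambda>y. v y * (\<Prod>i\<in>UNIV. G N i (\<gamma> i) (y $ i))) \<in> borel_measurable lborel"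
        using H bG by (auto intro!: borel_measurable_times tensor_measurable deriv_seq_measurable simp: test_seq_def)
      show "integrable lborel (\<lambda>y. (\<Prod>i\<in>UNIV. C i) * \<bar>exp (- c * (norm y)\<^sup>2) * v y\<bar>)"
        using gauss_integrable_integrable[OF v c] by (intro integrable_mult_right integrable_abs)
      show "AE y in lborel. (\<lambda>N. v y * (\<Prod>i\<in>UNIV. G N i (\<gamma> i) (y $ i))) \<longlonglongrightarrow> v y * (\<Prod>i\<in>UNIV. H i (\<gamma> i) (y $ i))"
        unfolding G_def by (intro AE_I2 tendsto_mult_left tendsto_prod leibniz_tendsto bump_at_scale_tendsto)
      show "AE y in lborel. norm (v y * (\<Prod>i\<in>UNIV. G N i (\<gamma> i) (y $ i))) \<le> (\<Prod>i\<in>UNIV. C i) * \<bar>exp (- c * (norm y)\<^sup>2) * v y\<bar>" for N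
      proof (rule AE_I2)
        fix y :: "real^'n"
        have "\<bar>\<Prod>i\<in>UNIV. G N i (\<gamma> i) (y $ i)\<bar> \<le> (\<Prod>i\<in>UNIV. C i * exp (- c * (y $ i)\<^sup>2))"
          unfolding abs_prod by (intro prod_mono conjI C) auto
        also have "\<dots> = (\<Prod>i\<in>UNIV. C i) * exp (- c * (norm y)\<^sup>2)"
          by (simp add: prod.distrib norm_sq_vec sum_distrib_left sum_negf flip: exp_sum)
        finally have "\<bar>v y\<bar> * \<bar>\<Prod>i\<in>UNIV. G N i (\<gamma> i) (y $ i)\<bar> \<le> \<bar>v y\<bar> * ((\<Prod>i\<in>UNIV. C i) * exp (- c * (norm y)\<^sup>2))"
          by (intro mult_left_mono) auto
        then show "norm (v y * (\<Prod>i\<in>UNIV. G N i (\<gamma> i) (y $ i))) \<le> (\<Prod>i\<in>UNIV. C i) * \<bar>exp (- c * (norm y)\<^sup>2) * v y\<bar>"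
          by (simp add: abs_mult mult_ac)
      qed
    qed
  qed
  have eqN: "(LINT y|lborel. f y * (\<Prod>i\<in>UNIV. G N i (\<alpha> i) (y $ i))) =
      (-1) ^ msize \<alpha> * (LINT y|lborel. g y * (\<Prod>i\<in>UNIV. G N i 0 (y $ i)))" for N
    using wd bG unfolding tensor_weak_deriv_def by simp
  have "(\<lambda>N. (-1) ^ msize \<alpha> * (LINT y|lborel. g y * (\<Prod>i\<in>UNIV. G N i 0 (y $ i)))) \<longlonglongrightarrow>
     (-1) ^ msize \<alpha> * (LINT y|lborel. g y * (\<Prod>i\<in>UNIV. H i 0 (y $ i)))"
    by (intro tendsto_mult_left lim g)
  then have main: "(LINT y|lborel. f y * (\<Prod>i\<in>UNIV. H i (\<alpha> i) (y $ i))) =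
     (-1) ^ msize \<alpha> * (LINT y|lborel. g y * (\<Prod>i\<in>UNIV. H i 0 (y $ i)))"
    using lim[OF f, of \<alpha>] unfolding eqN by (intro LIMSEQ_unique)
  \<comment> \<open>The signs from differentiating in \<open>y\<close> instead of \<open>x\<close>
    amount to \<open>(-1) ^ msize \<alpha>\<close> and cancel the sign of the integration by
    parts.\<close>
  have "(\<Prod>i\<in>UNIV. H i (\<gamma> i) (y $ i)) = (-1) ^ msize \<gamma> * heat (\<lambda>i. \<beta> i + \<gamma> i) t (x - y)" for \<gamma> y
    unfolding H_def heat_def prod.distrib power_sum by simp
  from this[of \<alpha>] this[of "\<lambda>_. 0"] main
  have "(LINT y|lborel. (-1) ^ msize \<alpha> * (heat (\<lambda>i. \<beta> i + \<alpha> i) t (x - y) * f y)) =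
     (-1) ^ msize \<alpha> * (LINT y|lborel. heat \<beta> t (x - y) * g y)"
    by (simp add: mult_ac)
  then show ?thesis unfolding heat_conv_def by simp
qed

section \<open>Antiderivatives with Gaussian decay\<close>

definition primitive :: "(real \<Rightarrow> real) \<Rightarrow> real \<Rightarrow> real" where
  "primitive h z = (LINT y|lborel. indicator {..z} y * h y)"

lemma integrable_indicator_mult:
  fixes h :: "real \<Rightarrow> real"
  assumes h: "integrable lborel h" and [measurable]: "A \<in> sets borel"
  shows "integrable lborel (\<lambda>y. indicator A y * h y)"
proof (rule Bochner_Integration.integrable_bound[OF h])
  have [measurable]: "h \<in> borel_measurable borel" using h by auto
  show "(\<lambda>y. indicator A y * h y) \<in> borel_measurable lborel" by measurable
qed (auto simp: indicator_def)

text \<open>The vanishing integral is what makes the antiderivative vanish to the right of the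
  support as well. Prefixing it to the sequence shifts all orders by one.\<close>

lemma test_seq_primitive:
  assumes G: "test_seq G" and 0: "(LINT y|lborel. G 0 y) = 0"
  shows "test_seq (\<lambda>l. case l of 0 \<Rightarrow> primitive (G 0) | Suc l \<Rightarrow> G l)"
proof -
  obtain R0 where "\<And>k y. \<bar>y\<bar> > R0 \<Longrightarrow> G k y = 0" using G unfolding test_seq_def by blast
  then obtain R where R: "R \<ge> 0" "\<And>k y. \<bar>y\<bar> > R \<Longrightarrow> G k y = 0"
    by (metis max.cobounded2 max.strict_boundedE max.absorb_iff2 linorder_not_less nle_le)
  have cont: "continuous_on A (G 0)" for A
    using G by (auto simp: test_seq_def intro: continuous_on_subset[OF deriv_seq_continuous])
  \<comment> \<open>The lower limit lies one unit to the left of the support: for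
    \<open>z > - R - 1\<close> the fundamental theorem applies at an interior point, and for all
    other \<open>z\<close> the primitive vanishes nearby.\<close>
  have primitive_eq: "primitive (G 0) z = integral {-R-1..z} (G 0)" for z
  proof -
    have "primitive (G 0) z = (LBINT y:{-R-1..z}. G 0 y)"
      unfolding primitive_def set_lebesgue_integral_def
      by (rule Bochner_Integration.integral_cong) (use R(2)[where k = 0] in \<open>auto simp: indicator_def\<close>)
    also have "\<dots> = integral {-R-1..z} (G 0)"
      by (rule set_borel_integral_eq_integral) (rule borel_integrable_atLeastAtMost', rule cont)
    finally show ?thesis .
  qed
  have "(primitive (G 0) has_real_derivative G 0 z) (at z)" for z
  proof (cases "z > - R - 1")
    case True
    have "((\<lambda>x. integral {-R-1..x} (G 0)) has_real_derivative G 0 z) (at z within {-R-1..z+1})"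
      by (rule integral_has_real_derivative[OF cont]) (use True in auto)
    moreover have "at z within {-R-1..z+1} = at z"
      using True by (intro at_within_interior) auto
    ultimately show ?thesis unfolding primitive_eq[abs_def] by simp
  next
    case False
    have ev: "\<forall>\<^sub>F x in nhds z. x \<in> {..< - R}" using False by (intro eventually_nhds_in_open) auto
    have "\<forall>\<^sub>F x in nhds z. primitive (G 0) x = 0"
      using ev
    proof eventually_elim
      case (elim x)
      have "(\<lambda>y. indicator {..x} y * G 0 y) = (\<lambda>_. 0)" using elim R(2)[where k = 0] by (auto simp: fun_eq_iff indicator_def)
      then show ?case by (simp add: primitive_def)
    qed
    from DERIV_cong_ev[OF refl this refl, THEN iffD2, OF DERIV_const]
    show ?thesis using R(2)[of z 0] R(1) False by simp
  qed
  then have s: "deriv_seq (\<lambda>l. case l of 0 \<Rightarrow> primitive (G 0) | Suc l \<Rightarrow> G l)"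
    using G unfolding deriv_seq_def test_seq_def by (auto split: nat.split)
  have "primitive (G 0) y = 0" if "\<bar>y\<bar> > R" for y
  proof (cases "y > 0")
    case True
    then have "(\<lambda>x. indicator {..y} x * G 0 x) = G 0" using that R(2)[where k = 0] by (auto simp: fun_eq_iff indicator_def)
    then show ?thesis using 0 by (simp add: primitive_def)
  next
    case False
    then have "(\<lambda>x. indicator {..y} x * G 0 x) = (\<lambda>_. 0)" using that R(2)[where k = 0] by (auto simp: fun_eq_iff indicator_def)
    then show ?thesis by (simp add: primitive_def)
  qed
  then have "\<forall>k y. \<bar>y\<bar> > R \<longrightarrow> (case k of 0 \<Rightarrow> primitive (G 0) | Suc l \<Rightarrow> G l) y = 0"
    using R(2) by (auto split: nat.split)
  then show ?thesis using s unfolding test_seq_def by blast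
qed

lemma gauss_integrable_real: "c > 0 \<Longrightarrow> integrable lborel (\<lambda>y::real. exp (- c * y\<^sup>2))"
  using integrable_gauss_1d[of c] by (auto simp: integrable_iff_bounded)

text \<open>The integral is taken over the tail pointing away from 0, which for \<open>z > 0\<close>
  uses the vanishing mean. On that tail \<open>z * (y - z) \<ge> 0\<close>, so
  \<open>y\<^sup>2 \<ge> z\<^sup>2 + (y - z)\<^sup>2\<close>. The exponent \<open>c\<close> is thus
  preserved, so the step can be iterated over the coordinates.\<close>

lemma primitive_gauss_bound:
  assumes h: "integrable lborel h" and 0: "(LINT y|lborel. h y) = 0" and c: "c > 0"
    and b: "\<And>y. \<bar>h y\<bar> \<le> B * exp (- c * y\<^sup>2)"
  shows "\<bar>primitive h z\<bar> \<le> B * (LINT y|lborel. exp (- c * y\<^sup>2)) * exp (- c * z\<^sup>2)"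
proof -
  have B: "B \<ge> 0" using b[of 0] by simp
  let ?g = "\<lambda>y. B * exp (- c * z\<^sup>2) * exp (- c * (y - z)\<^sup>2)"
  have ig: "integrable lborel ?g"
    using integrable_lborel_translate[of "\<lambda>y. exp (- c * y\<^sup>2)" "- z"] gauss_integrable_real[OF c] by simp
  have g: "(LINT y|lborel. ?g y) = B * (LINT y|lborel. exp (- c * y\<^sup>2)) * exp (- c * z\<^sup>2)"
    using integral_lborel_translate[of "\<lambda>y. exp (- c * y\<^sup>2)" "- z"] by simp
  have *: "\<bar>LINT y|lborel. indicator A y * h y\<bar> \<le> (LINT y|lborel. ?g y)"
    if A [measurable]: "A \<in> sets borel" and le: "\<And>y. y \<in> A \<Longrightarrow> z\<^sup>2 + (y - z)\<^sup>2 \<le> y\<^sup>2" for A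
  proof -
    have "\<bar>LINT y|lborel. indicator A y * h y\<bar> \<le> (LINT y|lborel. \<bar>indicator A y * h y\<bar>)"
      by (rule integral_abs_bound)
    also have "\<dots> \<le> (LINT y|lborel. ?g y)"
    proof (rule integral_mono)
      show "integrable lborel (\<lambda>y. \<bar>indicator A y * h y\<bar>)" by (intro integrable_abs integrable_indicator_mult h A)
      show "integrable lborel ?g" by (rule ig)
      fix y
      show "\<bar>indicator A y * h y\<bar> \<le> ?g y"
      proof (cases "y \<in> A")
        case True
        have "c * (z\<^sup>2 + (y - z)\<^sup>2) \<le> c * y\<^sup>2" using le[OF True] c by (intro mult_left_mono) auto
        then have "- c * y\<^sup>2 \<le> - c * z\<^sup>2 + (- c * (y - z)\<^sup>2)" by (simp add: algebra_simps)
        then have "B * exp (- c * y\<^sup>2) \<le> B * exp (- c * z\<^sup>2 + (- c * (y - z)\<^sup>2))" using B by (intro mult_left_mono) auto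
        also have "\<dots> = ?g y" unfolding exp_add by (simp only: mult.assoc)
        finally show ?thesis using b[of y] True by simp
      qed (use B in simp)
    qed
    finally show ?thesis .
  qed
  show ?thesis
  proof (cases "z \<le> 0")
    case True
    have "z\<^sup>2 + (y - z)\<^sup>2 \<le> y\<^sup>2" if "y \<in> {..z}" for y
    proof -
      have "0 \<le> z * (y - z)" using that True by (intro mult_nonpos_nonpos) auto
      then show ?thesis by (simp add: power2_eq_square algebra_simps)
    qed
    then show ?thesis unfolding primitive_def g[symmetric] by (intro *) auto
  next
    case False
    have "z\<^sup>2 + (y - z)\<^sup>2 \<le> y\<^sup>2" if "y \<in> {z<..}" for y
    proof -
      have "0 \<le> z * (y - z)" using that False by (intro mult_nonneg_nonneg) auto
      then show ?thesis by (simp add: power2_eq_square algebra_simps)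
    qed
    then have 1: "\<bar>LINT y|lborel. indicator {z<..} y * h y\<bar> \<le> (LINT y|lborel. ?g y)" by (intro *) auto
    have "(LINT y|lborel. h y) = (LINT y|lborel. indicator {..z} y * h y + indicator {z<..} y * h y)"
      by (rule Bochner_Integration.integral_cong) (auto simp: indicator_def)
    also have "\<dots> = primitive h z + (LINT y|lborel. indicator {z<..} y * h y)"
      unfolding primitive_def by (intro Bochner_Integration.integral_add integrable_indicator_mult h) auto
    finally have "primitive h z = - (LINT y|lborel. indicator {z<..} y * h y)" using 0 by simp
    then show ?thesis using 1 unfolding g by simp
  qed
qed

section \<open>Finite sums of tensor products\<close>

lemma test_seq_scale: "test_seq G \<Longrightarrow> test_seq (\<lambda>l y. d * G l y)"
  using deriv_seq_affine[of G d 1 0] unfolding test_seq_def by auto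

lemma deriv_seq_add: "deriv_seq G \<Longrightarrow> deriv_seq H \<Longrightarrow> deriv_seq (\<lambda>l y. G l y + H l y)"
  unfolding deriv_seq_def by (auto intro: DERIV_add)

lemma test_seq_add:
  assumes "test_seq G" "test_seq H" shows "test_seq (\<lambda>l y. G l y + H l y)"
proof -
  obtain R R' where "\<And>k y. \<bar>y\<bar> > R \<Longrightarrow> G k y = 0" "\<And>k y. \<bar>y\<bar> > R' \<Longrightarrow> H k y = 0" using assms unfolding test_seq_def by blast
  then have "\<forall>k y. \<bar>y\<bar> > max R R' \<longrightarrow> G k y + H k y = 0" by simp
  then show ?thesis using assms deriv_seq_add unfolding test_seq_def by blast
qed

text \<open>A class of smooth compactly supported functions that is stable under averaging in one
  coordinate and under multiplication by polynomials; the duality argument rests on both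
  operations.\<close>

inductive tensor_sum :: "(real^'n \<Rightarrow> real) \<Rightarrow> bool" where
  zero: "tensor_sum (\<lambda>x. 0)"
| step: "tensor_sum S \<Longrightarrow> (\<And>i. test_seq (G i)) \<Longrightarrow> tensor_sum (\<lambda>x. S x + (\<Prod>i\<in>UNIV. G i 0 (x $ i)))"

lemma tensor_sum_tensor: "(\<And>i. test_seq (G i)) \<Longrightarrow> tensor_sum (\<lambda>x. \<Prod>i\<in>UNIV. G i 0 (x $ i))"
  using tensor_sum.step[OF tensor_sum.zero, of G] by simp

lemma tensor_sum_add: "tensor_sum T \<Longrightarrow> tensor_sum S \<Longrightarrow> tensor_sum (\<lambda>x. S x + T x)"
proof (induction rule: tensor_sum.induct)
  case (step T G)
  from tensor_sum.step[OF step.IH[OF step.prems] step.hyps(2)] show ?case by (simp add: add.assoc)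
qed simp

lemma tensor_sum_sum: "finite A \<Longrightarrow> (\<And>k. k \<in> A \<Longrightarrow> tensor_sum (S k)) \<Longrightarrow> tensor_sum (\<lambda>x. \<Sum>k\<in>A. S k x)"
proof (induction A rule: finite_induct)
  case empty
  then show ?case by (simp add: tensor_sum.zero)
next
  case (insert a A)
  then show ?case using tensor_sum_add[of "\<lambda>x. \<Sum>k\<in>A. S k x" "S a"] by simp
qed

lemma tensor_sum_rep:
  "tensor_sum S \<Longrightarrow> \<exists>N::nat. \<exists>G. (\<forall>k i. test_seq (G k i)) \<and> (\<forall>x. S x = (\<Sum>k<N. \<Prod>i\<in>UNIV. G k i 0 (x $ i)))"
proof (induction rule: tensor_sum.induct)
  case zero
  show ?case by (intro exI[of _ 0] exI[of _ "\<lambda>_ _. bump"]) (simp add: test_seq_bump)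
next
  case (step S G)
  then obtain N G' where "\<forall>k i. test_seq (G' k i)" "\<forall>x. S x = (\<Sum>k<N::nat. \<Prod>i\<in>UNIV. G' k i 0 (x $ i))" by blast
  then show ?case using step.hyps(2) by (intro exI[of _ "Suc N"] exI[of _ "G'(N := G)"]) simp
qed

lemma tensor_sum_mult_coord:
  assumes "tensor_sum S" shows "tensor_sum (\<lambda>x. x $ i * S x)"
  using assms
proof (induction rule: tensor_sum.induct)
  case zero
  then show ?case by (simp add: tensor_sum.zero)
next
  case (step S G)
  \<comment> \<open>The identity function with its derivatives, so that the Leibniz rule multiplies
    one factor by its coordinate.\<close>
  define X :: "nat \<Rightarrow> real \<Rightarrow> real" where "X k y = (if k = 0 then y else if k = 1 then 1 else 0)" for k y
  have X: "deriv_seq X"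
    unfolding deriv_seq_def
  proof (intro allI)
    fix k y show "(X k has_real_derivative X (Suc k) y) (at y)"
      by (cases "k = 0") (auto simp: X_def[abs_def])
  qed
  define G' where "G' j = (if j = i then (\<lambda>k. leibniz k (G i) X) else G j)" for j
  have "test_seq (G' j)" for j using step.hyps(2) X by (simp add: G'_def test_seq_leibniz)
  from tensor_sum.step[OF step.IH this]
  have "tensor_sum (\<lambda>x. x $ i * S x + (\<Prod>j\<in>UNIV. G' j 0 (x $ j)))" .
  moreover have "(\<Prod>j\<in>UNIV. G' j 0 (x $ j)) = x $ i * (\<Prod>j\<in>UNIV. G j 0 (x $ j))" for x
  proof -
    have "(\<Prod>j\<in>UNIV. G' j 0 (x $ j)) = G' i 0 (x $ i) * (\<Prod>j\<in>UNIV-{i}. G j 0 (x $ j))"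
      by (subst prod.remove[of UNIV i]) (auto simp: G'_def intro!: prod.cong)
    also have "\<dots> = x $ i * (\<Prod>j\<in>UNIV. G j 0 (x $ j))"
      by (subst prod.remove[of UNIV i]) (auto simp: G'_def X_def)
    finally show ?thesis .
  qed
  ultimately show ?case by (simp add: distrib_left)
qed

lemma tensor_sum_scale: assumes "tensor_sum S" shows "tensor_sum (\<lambda>x. d * S (x::real^'n))"
  using assms
proof (induction rule: tensor_sum.induct)
  case zero
  then show ?case by (simp add: tensor_sum.zero)
next
  case (step S G)
  \<comment> \<open>Any coordinate can absorb the scalar; the index type is nonempty.\<close>
  define i :: 'n where "i = undefined"
  define G' where "G' j = (if j = i then (\<lambda>k y. d * G i k y) else G j)" for j
  have "test_seq (G' j)" for j using step.hyps(2) by (simp add: G'_def test_seq_scale)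
  from tensor_sum.step[OF step.IH this]
  have "tensor_sum (\<lambda>x. d * S x + (\<Prod>j\<in>UNIV. G' j 0 (x $ j)))" .
  moreover have "(\<Prod>j\<in>UNIV. G' j 0 (x $ j)) = d * (\<Prod>j\<in>UNIV. G j 0 (x $ j))" for x :: "real^'n"
  proof -
    have "(\<Prod>j\<in>UNIV. G' j 0 (x $ j)) = G' i 0 (x $ i) * (\<Prod>j\<in>UNIV-{i}. G j 0 (x $ j))"
      by (subst prod.remove[of UNIV i]) (auto simp: G'_def intro!: prod.cong)
    also have "\<dots> = d * (\<Prod>j\<in>UNIV. G j 0 (x $ j))"
      by (subst prod.remove[of UNIV i]) (auto simp: G'_def)
    finally show ?thesis .
  qed
  ultimately show ?case by (simp add: distrib_left)
qed

text \<open>Makes Stone-Weierstrass usable: a polynomial times a cut-off Gaussian is an admissible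
  test function.\<close>

lemma tensor_sum_mult_poly:
  assumes "real_polynomial_function p"
  shows "tensor_sum S \<Longrightarrow> tensor_sum (\<lambda>x::real^'n. p x * S x)"
  using assms
proof (induction p arbitrary: S rule: real_polynomial_function.induct)
  case (linear f)
  have "f x = (\<Sum>i\<in>UNIV. f (axis i 1) * x $ i)" for x
  proof -
    have "f x = f (\<Sum>i\<in>UNIV. x $ i *\<^sub>R axis i 1)"
      by (simp only: basis_expansion[of x, unfolded scalar_mult_eq_scaleR])
    also have "\<dots> = (\<Sum>i\<in>UNIV. x $ i *\<^sub>R f (axis i 1))"
      by (simp only: linear_sum[OF bounded_linear.linear[OF linear(1)]] linear_scale[OF bounded_linear.linear[OF linear(1)]])
    finally show ?thesis by (simp only: real_scaleR_def mult.commute)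
  qed
  note expand = this
  have "(\<lambda>x. f x * S x) = (\<lambda>x. \<Sum>i\<in>UNIV. f (axis i 1) * (x $ i * S x))"
    by (rule ext) (subst expand, simp only: sum_distrib_right mult.assoc)
  moreover have "tensor_sum (\<lambda>x. \<Sum>i\<in>UNIV. f (axis i 1) * (x $ i * S x))"
    by (intro tensor_sum_sum tensor_sum_scale tensor_sum_mult_coord linear.prems) simp
  ultimately show ?case by simp
next
  case (const c)
  then show ?case by (rule tensor_sum_scale)
next
  case (add f g)
  have "tensor_sum (\<lambda>x. f x * S x + g x * S x)" by (intro tensor_sum_add add)
  then show ?case by (simp add: distrib_right)
next
  case (mult f g)
  have "tensor_sum (\<lambda>x. f x * (g x * S x))" by (intro mult)
  then show ?case by (simp add: mult.assoc)
qed

lemma tensor_sum_measurable: "tensor_sum S \<Longrightarrow> S \<in> borel_measurable borel"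
proof (induction rule: tensor_sum.induct)
  case (step S G)
  have "(\<lambda>x::real^'a. \<Prod>i\<in>UNIV. G i 0 (x $ i)) \<in> borel_measurable borel"
    by (rule tensor_measurable) (use step.hyps(2) in \<open>simp add: test_seq_def deriv_seq_measurable\<close>)
  then show ?case by (rule borel_measurable_add[OF step.IH])
qed simp

lemma tensor_sum_bounded: "tensor_sum S \<Longrightarrow> \<exists>B\<ge>0. \<exists>R. \<forall>x. \<bar>S x\<bar> \<le> B \<and> (norm x > R \<longrightarrow> S x = 0)"
proof (induction rule: tensor_sum.induct)
  case zero
  show ?case by (intro exI[of _ 0]) auto
next
  case (step S G)
  then obtain B R where B: "B \<ge> 0" "\<And>x. \<bar>S x\<bar> \<le> B" "\<And>x. norm x > R \<Longrightarrow> S x = 0" by blast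
  have "\<forall>i. \<exists>b\<ge>0. \<forall>y. \<bar>G i 0 y\<bar> \<le> b" using test_seq_bounded[OF step.hyps(2)] by blast
  then obtain b where b: "\<And>i. b i \<ge> 0" "\<And>i y. \<bar>G i 0 y\<bar> \<le> b i" by metis
  have "\<forall>i. \<exists>R. \<forall>y. \<bar>y\<bar> > R \<longrightarrow> G i 0 y = 0" using step.hyps(2) unfolding test_seq_def by blast
  then obtain r where r: "\<And>i y. \<bar>y\<bar> > r i \<Longrightarrow> G i 0 y = 0" by metis
  have 1: "norm x \<le> (\<Sum>i\<in>UNIV. \<bar>r i\<bar>)" if "(\<Prod>i\<in>UNIV. G i 0 (x $ i)) \<noteq> 0" for x
  proof -
    have "\<bar>x $ i\<bar> \<le> \<bar>r i\<bar>" for i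
      using that r[of i "x $ i"] by (force simp: not_less)
    then show ?thesis by (intro order_trans[OF norm_le_l1_cart] sum_mono)
  qed
  have 2: "\<bar>\<Prod>i\<in>UNIV. G i 0 (x $ i)\<bar> \<le> (\<Prod>i\<in>UNIV. b i)" for x
    unfolding abs_prod by (intro prod_mono conjI b) auto
  have "(\<Prod>i\<in>UNIV. b i) \<ge> 0" by (intro prod_nonneg b)
  moreover have "\<bar>S x + (\<Prod>i\<in>UNIV. G i 0 (x $ i))\<bar> \<le> B + (\<Prod>i\<in>UNIV. b i)" for x
    using B(2)[of x] 2[of x] by linarith
  moreover have "S x + (\<Prod>i\<in>UNIV. G i 0 (x $ i)) = 0" if "norm x > max R (\<Sum>i\<in>UNIV. \<bar>r i\<bar>)" for x
  proof -
    have "(\<Prod>i\<in>UNIV. G i 0 (x $ i)) = 0" using 1[of x] that by (meson le_less_trans max.cobounded2 not_less)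
    then show ?thesis using B(3)[of x] that by simp
  qed
  ultimately show ?case using B(1) by (intro exI[of _ "B + (\<Prod>i\<in>UNIV. b i)"] conjI exI[of _ "max R (\<Sum>i\<in>UNIV. \<bar>r i\<bar>)"]) auto
qed

lemma loc_int_integrable:
  assumes f: "loc_int f" and [measurable]: "S \<in> borel_measurable borel" and B: "\<And>x. \<bar>S x\<bar> \<le> B" "\<And>x. norm x > R \<Longrightarrow> S x = 0"
  shows "integrable lborel (\<lambda>x. f x * S x)"
proof -
  have [measurable]: "f \<in> borel_measurable borel" using f by (simp add: loc_int_def)
  have B0: "B \<ge> 0" using B(1)[of 0] by linarith
  have "(\<integral>\<^sup>+x. ennreal (norm (f x * S x)) \<partial>lborel) \<le> (\<integral>\<^sup>+x. ennreal B * (ennreal \<bar>f x\<bar> * indicator (cball 0 R) x) \<partial>lborel)"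
  proof (rule nn_integral_mono)
    fix x
    show "ennreal (norm (f x * S x)) \<le> ennreal B * (ennreal \<bar>f x\<bar> * indicator (cball 0 R) x)"
    proof (cases "norm x > R")
      case False
      have "norm (f x * S x) \<le> B * \<bar>f x\<bar>" using B(1)[of x] by (simp add: abs_mult mult.commute mult_right_mono)
      from ennreal_leI[OF this] show ?thesis using False B0 by (simp add: ennreal_mult)
    qed (use B(2) in simp)
  qed
  also have "\<dots> = ennreal B * (\<integral>\<^sup>+x\<in>cball 0 R. ennreal \<bar>f x\<bar> \<partial>lborel)"
    by (rule nn_integral_cmult) measurable
  also have "\<dots> < \<infinity>" using f by (simp add: loc_int_def ennreal_mult_less_top)
  finally show ?thesis by (simp add: integrable_iff_bounded)
qed

lemma tensor_sum_integrable:
  assumes "loc_int f" "tensor_sum S" shows "integrable lborel (\<lambda>x. f x * S x)"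
  using loc_int_integrable[OF assms(1) tensor_sum_measurable[OF assms(2)]] tensor_sum_bounded[OF assms(2)] by metis

lemma gauss_integrable_loc_int: assumes g: "gauss_integrable g" shows "loc_int g"
  unfolding loc_int_def
proof (intro conjI allI)
  show m [measurable]: "g \<in> borel_measurable borel" using g by (simp add: gauss_integrable_def)
  fix R
  have "(\<integral>\<^sup>+x\<in>cball 0 R. ennreal \<bar>g x\<bar> \<partial>lborel) \<le> (\<integral>\<^sup>+x. ennreal (exp (R\<^sup>2)) * ennreal (norm (exp (- 1 * (norm x)\<^sup>2) * g x)) \<partial>lborel)"
  proof (rule nn_integral_mono)
    fix x
    show "ennreal \<bar>g x\<bar> * indicator (cball 0 R) x \<le> ennreal (exp (R\<^sup>2)) * ennreal (norm (exp (- 1 * (norm x)\<^sup>2) * g x))"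
    proof (cases "x \<in> cball 0 R")
      case True
      then have "(norm x)\<^sup>2 \<le> R\<^sup>2" by (intro power_mono) auto
      then have "1 \<le> exp (R\<^sup>2 + (- 1 * (norm x)\<^sup>2))" by simp
      then have "1 * \<bar>g x\<bar> \<le> exp (R\<^sup>2 + (- 1 * (norm x)\<^sup>2)) * \<bar>g x\<bar>" by (intro mult_right_mono) auto
      also have "\<dots> = exp (R\<^sup>2) * norm (exp (- 1 * (norm x)\<^sup>2) * g x)" unfolding exp_add by (simp add: abs_mult)
      finally have "ennreal \<bar>g x\<bar> \<le> ennreal (exp (R\<^sup>2) * norm (exp (- 1 * (norm x)\<^sup>2) * g x))" by (intro ennreal_leI) simp
      then show ?thesis using True by (simp add: ennreal_mult)
    qed simp
  qed
  also have "\<dots> = ennreal (exp (R\<^sup>2)) * (\<integral>\<^sup>+x. ennreal (norm (exp (- 1 * (norm x)\<^sup>2) * g x)) \<partial>lborel)"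
    by (rule nn_integral_cmult) measurable
  also have "\<dots> < \<infinity>"
    using gauss_integrable_integrable[OF g, of 1] by (simp add: integrable_iff_bounded ennreal_mult_less_top)
  finally show "(\<integral>\<^sup>+x\<in>cball 0 R. ennreal \<bar>g x\<bar> \<partial>lborel) < \<infinity>" .
qed

section \<open>Growth from weak derivatives\<close>

lemma bump_integral_pos: "(LINT y|lborel. bump 0 y) > 0"
proof -
  have "exp (- 2) * indicator {-1/2..1/2} y \<le> bump 0 y" for y :: real
  proof (cases "y \<in> {-1/2..1/2}")
    case True
    then have "1 / (1 - y) \<le> 2" "1 / (1 + y) \<le> 2" by (auto simp: field_simps)
    then have "exp (- 2) \<le> exp (2 + (- 1 / (1 - y) + - 1 / (1 + y)))" by simp
    also have "\<dots> = bump 0 y" using True unfolding exp_add bump_0 by auto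
    finally show ?thesis using True by simp
  qed (simp add: bump_range)
  moreover have i: "integrable lborel (\<lambda>y::real. exp (- 2) * indicator {-1/2..1/2} y :: real)"
    by (intro integrable_mult_right integrable_real_indicator) (auto simp: emeasure_lborel_Icc_eq)
  ultimately have "(LINT y|lborel. exp (- 2) * indicator {-1/2..1/2::real} y :: real) \<le> (LINT y|lborel. bump 0 y)"
    by (intro integral_mono[OF i] test_seq_integrable test_seq_bump)
  moreover have "(LINT y|lborel. exp (- 2) * indicator {-1/2..1/2::real} y :: real) = exp (- 2)"
    by (simp add: measure_def)
  ultimately show ?thesis using exp_gt_zero[of "-2::real"] by linarith
qed

definition unit_bump :: "nat \<Rightarrow> real \<Rightarrow> real" where
  "unit_bump l y = (1 / (LINT y|lborel. bump 0 y)) * bump l y"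

lemma test_seq_unit_bump: "test_seq unit_bump"
  unfolding unit_bump_def[abs_def] by (intro test_seq_scale test_seq_bump)

lemma unit_bump_integral: "(LINT y|lborel. unit_bump 0 y) = 1"
  using bump_integral_pos unfolding unit_bump_def by simp

lemma unit_bump_bound:
  assumes "c > 0"
  shows "\<exists>B\<ge>0. \<forall>y. \<bar>unit_bump 0 y\<bar> \<le> B * exp (- c * y\<^sup>2)"
proof -
  let ?I = "LINT y|lborel. bump 0 y"
  have "\<bar>unit_bump 0 y\<bar> \<le> exp c / ?I * exp (- c * y\<^sup>2)" for y
  proof (cases "\<bar>y\<bar> > 1")
    case False
    then have "y\<^sup>2 \<le> 1" by (simp add: abs_square_le_1)
    then have "c * y\<^sup>2 \<le> c * 1" using assms by (intro mult_left_mono) auto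
    then have "1 \<le> exp (c + (- c * y\<^sup>2))" by simp
    then have "1 / ?I \<le> exp (c + (- c * y\<^sup>2)) / ?I" using bump_integral_pos by (intro divide_right_mono) auto
    moreover have "\<bar>unit_bump 0 y\<bar> \<le> 1 / ?I"
      using bump_range[of y] bump_integral_pos by (simp add: unit_bump_def abs_mult divide_right_mono)
    ultimately show ?thesis unfolding exp_add by simp
  qed (use bump_integral_pos in \<open>simp add: unit_bump_def bump_supp\<close>)
  then show ?thesis using bump_integral_pos by (intro exI[of _ "exp c / ?I"]) auto
qed

definition vec_upd :: "real^'n \<Rightarrow> 'n \<Rightarrow> real \<Rightarrow> real^'n" where
  "vec_upd x i y = (\<chi> j. if j = i then y else x $ j)"

lemma vec_upd_nth [simp]: "vec_upd x i y $ i = y" "j \<noteq> i \<Longrightarrow> vec_upd x i y $ j = x $ j"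
  by (simp_all add: vec_upd_def)

lemma norm_vec_upd: "(norm (vec_upd x i y))\<^sup>2 = y\<^sup>2 + ((norm x)\<^sup>2 - (x $ i)\<^sup>2)"
proof -
  have "(norm (vec_upd x i y))\<^sup>2 = y\<^sup>2 + (\<Sum>j\<in>UNIV-{i}. (x $ j)\<^sup>2)"
    unfolding norm_sq_vec by (subst sum.remove[of UNIV i]) auto
  moreover have "(norm x)\<^sup>2 = (x $ i)\<^sup>2 + (\<Sum>j\<in>UNIV-{i}. (x $ j)\<^sup>2)"
    unfolding norm_sq_vec by (subst sum.remove[of UNIV i]) auto
  ultimately show ?thesis by simp
qed

lemma primitive_sum:
  assumes "finite A" "\<And>k. k \<in> A \<Longrightarrow> integrable lborel (h k)"
  shows "primitive (\<lambda>y. \<Sum>k\<in>A. h k y * a k) z = (\<Sum>k\<in>A. primitive (h k) z * a k)"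
proof -
  have i: "integrable lborel (\<lambda>y. indicator {..z} y * h k y)" if "k \<in> A" for k
    by (intro integrable_indicator_mult assms that) simp
  have "primitive (\<lambda>y. \<Sum>k\<in>A. h k y * a k) z = (LINT y|lborel. (\<Sum>k\<in>A. (indicator {..z} y * h k y) * a k))"
    unfolding primitive_def by (simp only: sum_distrib_left mult.assoc)
  also have "\<dots> = (\<Sum>k\<in>A. LINT y|lborel. (indicator {..z} y * h k y) * a k)"
    by (rule Bochner_Integration.integral_sum) (use i in \<open>intro integrable_mult_left\<close>)
  also have "\<dots> = (\<Sum>k\<in>A. primitive (h k) z * a k)"
    unfolding primitive_def by (simp only: integral_mult_left_zero)
  finally show ?thesis .
qed

text \<open>Replacing \<open>S\<close> by its average in the direction \<open>i\<close> changes the pairing with \<open>f\<close> by the pairing of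
  the weak derivative \<open>g\<close> with an antiderivative of the difference.\<close>

lemma average_direction:
  fixes f g :: "real^'n \<Rightarrow> real" and i :: 'n
  assumes c: "c > 0" and f: "loc_int f" and g: "gauss_integrable g" and wd: "tensor_weak_deriv ((\<lambda>_. 0)(i := 1)) f g"
  shows "\<exists>D\<ge>0. \<forall>S M. tensor_sum S \<longrightarrow> M \<ge> 0 \<longrightarrow> (\<forall>x. \<bar>S x\<bar> \<le> M * exp (- c * (norm x)\<^sup>2)) \<longrightarrow>
    (\<exists>S'. tensor_sum S' \<and> (\<forall>x. \<bar>S' x\<bar> \<le> (D * M) * exp (- c * (norm x)\<^sup>2)) \<and>
      \<bar>(LINT x|lborel. f x * S x) - (LINT x|lborel. f x * S' x)\<bar> \<le> D * M \<and>
      (\<forall>x. \<bar>x $ i\<bar> > 1 \<longrightarrow> S' x = 0) \<and>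
      (\<forall>j. (\<forall>x. \<bar>x $ j\<bar> > 1 \<longrightarrow> S x = 0) \<longrightarrow> (\<forall>x. \<bar>x $ j\<bar> > 1 \<longrightarrow> S' x = 0)))"
proof -
  obtain B where B: "B \<ge> 0" "\<And>y. \<bar>unit_bump 0 y\<bar> \<le> B * exp (- c * y\<^sup>2)" using unit_bump_bound[OF c] by blast
  define L where "L = (LINT y|lborel. exp (- c * (y::real)\<^sup>2))"
  have L: "L \<ge> 0" unfolding L_def by (intro Bochner_Integration.integral_nonneg) auto
  define E where "E = (LINT x|lborel. \<bar>exp (- c * (norm x)\<^sup>2) * g x\<bar>)"
  have E: "E \<ge> 0" unfolding E_def by (intro Bochner_Integration.integral_nonneg) auto
  \<comment> \<open>\<open>B * L\<close> bounds the averaged function;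
    \<open>(1 + B * L) * L\<close> bounds the antiderivative of the difference, and \<open>E\<close>
    is the integral of \<open>g\<close> against the Gaussian.\<close>
  define D where "D = B * L + (1 + B * L) * L * E"
  have D0: "D \<ge> 0" "B * L \<le> D" "(1 + B * L) * L * E \<le> D" using B(1) L E by (auto simp: D_def)
  show ?thesis
  proof (intro exI[of _ D] conjI allI impI D0(1))
    fix S :: "real^'n \<Rightarrow> real" and M :: real
    assume S: "tensor_sum S" and M: "M \<ge> 0" and bnd: "\<forall>x. \<bar>S x\<bar> \<le> M * exp (- c * (norm x)\<^sup>2)"
    \<comment> \<open>The individual products of the representation carry no bound, so every
      estimate below is made on the sum over \<open>k\<close>.\<close>
    obtain N :: nat and G where G: "\<And>k i. test_seq (G k i)" and S_rep: "\<And>x. S x = (\<Sum>k<N. \<Prod>i\<in>UNIV. G k i 0 (x $ i))"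
      using tensor_sum_rep[OF S] by blast
    define P where "P k x = (\<Prod>j\<in>UNIV-{i}. G k j 0 (x $ j))" for k and x :: "real^'n"
    have split: "(\<Prod>j\<in>UNIV. ((G k)(i := F)) j 0 (x $ j)) = F 0 (x $ i) * P k x" for k F and x :: "real^'n"
      unfolding P_def by (subst prod.remove[of UNIV i]) (auto intro!: prod.cong)
    have P_upd: "P k (vec_upd x i y) = P k x" for k x y
      unfolding P_def by (rule prod.cong) auto
    have S_eq: "S x = (\<Sum>k<N. G k i 0 (x $ i) * P k x)" for x
    proof -
      have "(\<Prod>j\<in>UNIV. G k j 0 (x $ j)) = G k i 0 (x $ i) * P k x" for k using split[of k "G k i" x] by simp
      then show ?thesis unfolding S_rep by simp
    qed
    define ck where "ck k = (LINT y|lborel. G k i 0 y)" for k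
    \<comment> \<open>Since \<open>unit_bump\<close> has integral 1, subtracting this multiple makes
      the mean of the \<open>i\<close>-th factor vanish, and its antiderivative is again a test
      sequence.\<close>
    define h where "h k l y = G k i l y + (- ck k) * unit_bump l y" for k l y
    have bh: "test_seq (h k)" for k unfolding h_def[abs_def] by (intro test_seq_add test_seq_scale test_seq_unit_bump G)
    have h0: "(LINT y|lborel. h k 0 y) = 0" for k
      unfolding h_def using test_seq_integrable[OF G] test_seq_integrable[OF test_seq_unit_bump]
      by (simp add: unit_bump_integral ck_def)
    define A where "A k = (\<lambda>l. case l of 0 \<Rightarrow> primitive (h k 0) | Suc l \<Rightarrow> h k l)" for k
    have bA: "test_seq (A k)" for k unfolding A_def by (rule test_seq_primitive[OF bh h0])
    define S' where "S' x = (\<Sum>k<N. (ck k * unit_bump 0 (x $ i)) * P k x)" for x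
    define T where "T x = (\<Sum>k<N. primitive (h k 0) (x $ i) * P k x)" for x
    have tensor_sum_upd: "tensor_sum (\<lambda>x. \<Sum>k<N. F k 0 (x $ i) * P k x)" if "\<And>k. test_seq (F k)" for F
    proof (rule tensor_sum_sum)
      fix k
      have "tensor_sum (\<lambda>x. \<Prod>j\<in>UNIV. ((G k)(i := F k)) j 0 (x $ j))" by (rule tensor_sum_tensor) (use that G in simp)
      then show "tensor_sum (\<lambda>x. F k 0 (x $ i) * P k x)" unfolding split .
    qed simp
    have tensor_sum_term: "tensor_sum (\<lambda>x. F 0 (x $ i) * P k x)" if "test_seq F" for F k
    proof -
      have "tensor_sum (\<lambda>x. \<Prod>j\<in>UNIV. ((G k)(i := F)) j 0 (x $ j))" by (rule tensor_sum_tensor) (use that G in simp)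
      then show ?thesis unfolding split .
    qed
    have tS': "tensor_sum S'" unfolding S'_def[abs_def] by (rule tensor_sum_upd[of "\<lambda>k l y. ck k * unit_bump l y"]) (intro test_seq_scale test_seq_unit_bump)
    have tT: "tensor_sum T" unfolding T_def[abs_def] using tensor_sum_upd[of A] bA by (simp add: A_def)
    have diff: "S x - S' x = (\<Sum>k<N. h k 0 (x $ i) * P k x)" for x
      unfolding S_eq S'_def h_def sum_subtractf[symmetric] by (simp add: left_diff_distrib)
    have pair: "(LINT x|lborel. f x * (h k 0 (x $ i) * P k x)) = - (LINT x|lborel. g x * (primitive (h k 0) (x $ i) * P k x))" for k
    proof -
      let ?F = "(G k)(i := A k)" and ?e = "(\<lambda>_. 0)(i := 1) :: 'n \<Rightarrow> nat"
      have e: "msize ?e = 1" using msize_upd[of "\<lambda>_. 0" i 1] by simp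
      have 1: "(\<Prod>j\<in>UNIV. ?F j (?e j) (x $ j)) = h k 0 (x $ i) * P k x" for x
        unfolding P_def by (subst prod.remove[of UNIV i]) (auto simp: A_def intro!: prod.cong)
      have 2: "(\<Prod>j\<in>UNIV. ?F j 0 (x $ j)) = primitive (h k 0) (x $ i) * P k x" for x
        unfolding split by (simp add: A_def)
      have "\<forall>j. test_seq (?F j)" using G bA by simp
      with wd have "(LINT x|lborel. f x * (\<Prod>j\<in>UNIV. ?F j (?e j) (x $ j))) = (-1) ^ msize ?e * (LINT x|lborel. g x * (\<Prod>j\<in>UNIV. ?F j 0 (x $ j)))"
        unfolding tensor_weak_deriv_def by blast
      then show ?thesis unfolding 1 2 e by simp
    qed
    have "(LINT x|lborel. f x * S x) - (LINT x|lborel. f x * S' x) = (LINT x|lborel. f x * S x - f x * S' x)"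
      using tensor_sum_integrable[OF f S] tensor_sum_integrable[OF f tS'] by simp
    also have "\<dots> = (LINT x|lborel. (\<Sum>k<N. f x * (h k 0 (x $ i) * P k x)))"
      unfolding right_diff_distrib[symmetric] diff sum_distrib_left ..
    also have "\<dots> = (\<Sum>k<N. LINT x|lborel. f x * (h k 0 (x $ i) * P k x))"
      by (rule Bochner_Integration.integral_sum) (intro tensor_sum_integrable[OF f] tensor_sum_term bh)
    also have "\<dots> = - (\<Sum>k<N. LINT x|lborel. g x * (primitive (h k 0) (x $ i) * P k x))"
      unfolding pair sum_negf ..
    also have "(\<Sum>k<N. LINT x|lborel. g x * (primitive (h k 0) (x $ i) * P k x)) = (LINT x|lborel. (\<Sum>k<N. g x * (primitive (h k 0) (x $ i) * P k x)))"
      by (rule Bochner_Integration.integral_sum[symmetric])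
        (use tensor_sum_integrable[OF gauss_integrable_loc_int[OF g] tensor_sum_term[OF bA]] in \<open>simp add: A_def\<close>)
    also have "\<dots> = (LINT x|lborel. g x * T x)" unfolding T_def sum_distrib_left ..
    finally have pairing: "(LINT x|lborel. f x * S x) - (LINT x|lborel. f x * S' x) = - (LINT x|lborel. g x * T x)" .
    \<comment> \<open>The part of the Gaussian in the coordinates other than \<open>i\<close>; it is
      constant along lines in direction \<open>i\<close>.\<close>
    define Q where "Q x = exp (- c * ((norm x)\<^sup>2 - (x $ i)\<^sup>2))" for x :: "real^'n"
    have Q: "exp (- c * (norm x)\<^sup>2) = exp (- c * (x $ i)\<^sup>2) * Q x" for x
      unfolding Q_def exp_add[symmetric] by (simp add: algebra_simps)
    have Q_upd: "exp (- c * (norm (vec_upd x i y))\<^sup>2) = exp (- c * y\<^sup>2) * Q x" for x y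
      unfolding Q_def exp_add[symmetric] norm_vec_upd by (simp add: algebra_simps)
    have Q0: "Q x > 0" for x by (simp add: Q_def)
    have gi: "integrable lborel (\<lambda>y. M * (exp (- c * y\<^sup>2) * Q x))" for x
      by (intro integrable_mult_right integrable_mult_left gauss_integrable_real c)
    define I where "I x = (\<Sum>k<N. ck k * P k x)" for x
    have Gb: "\<bar>\<Sum>k<N. G k i 0 y * P k x\<bar> \<le> M * (exp (- c * y\<^sup>2) * Q x)" for x y
      using bnd[rule_format, of "vec_upd x i y"] unfolding S_eq Q_upd P_upd by simp
    have I: "\<bar>I x\<bar> \<le> M * L * Q x" for x
    proof -
      have ii: "integrable lborel (\<lambda>y. G k i 0 y * P k x)" for k
        by (intro integrable_mult_left test_seq_integrable G)
      have "I x = (LINT y|lborel. (\<Sum>k<N. G k i 0 y * P k x))"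
        unfolding I_def ck_def using ii by (simp add: Bochner_Integration.integral_sum)
      also have "\<bar>\<dots>\<bar> \<le> (LINT y|lborel. \<bar>\<Sum>k<N. G k i 0 y * P k x\<bar>)" by (rule integral_abs_bound)
      also have "\<dots> \<le> (LINT y|lborel. M * (exp (- c * y\<^sup>2) * Q x))"
        by (intro integral_mono integrable_abs Bochner_Integration.integrable_sum ii gi Gb)
      also have "\<dots> = M * L * Q x" unfolding L_def by simp
      finally show ?thesis .
    qed
    \<comment> \<open>\<open>I x\<close> is the integral of \<open>S\<close> along the line through
      \<open>x\<close> in direction \<open>i\<close>; it depends only on the other
      coordinates.\<close>
    have S'_I: "S' x = unit_bump 0 (x $ i) * I x" for x
      unfolding S'_def I_def sum_distrib_left by (simp add: mult_ac)
    have S'b: "\<bar>unit_bump 0 y * I x\<bar> \<le> (B * L) * M * (exp (- c * y\<^sup>2) * Q x)" for x y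
    proof -
      have "\<bar>unit_bump 0 y * I x\<bar> \<le> (B * exp (- c * y\<^sup>2)) * (M * L * Q x)"
        unfolding abs_mult using B I[of x] by (intro mult_mono) auto
      also have "\<dots> = (B * L) * M * (exp (- c * y\<^sup>2) * Q x)" by (simp only: mult_ac)
      finally show ?thesis .
    qed
    have Tb: "\<bar>T x\<bar> \<le> (1 + B * L) * L * M * exp (- c * (norm x)\<^sup>2)" for x
    proof -
      let ?H = "\<lambda>y. \<Sum>k<N. h k 0 y * P k x"
      have ih: "integrable lborel (h k 0)" for k by (rule test_seq_integrable[OF bh])
      have H: "?H y = (\<Sum>k<N. G k i 0 y * P k x) - unit_bump 0 y * I x" for y
        unfolding h_def I_def sum_distrib_left sum_subtractf[symmetric] by (simp add: algebra_simps)
      have "\<bar>primitive ?H (x $ i)\<bar> \<le> ((1 + B * L) * M * Q x) * (LINT y|lborel. exp (- c * y\<^sup>2)) * exp (- c * (x $ i)\<^sup>2)"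
      proof (rule primitive_gauss_bound[OF _ _ c])
        show "integrable lborel ?H" by (intro Bochner_Integration.integrable_sum integrable_mult_left ih)
        show "(LINT y|lborel. ?H y) = 0" using ih h0 by (simp add: Bochner_Integration.integral_sum)
        fix y
        have "\<bar>?H y\<bar> \<le> M * (exp (- c * y\<^sup>2) * Q x) + (B * L) * M * (exp (- c * y\<^sup>2) * Q x)"
          unfolding H using Gb[of y x] S'b[of y x] by linarith
        also have "\<dots> = ((1 + B * L) * M * Q x) * exp (- c * y\<^sup>2)" by (simp only: distrib_right distrib_left mult_1_left mult_1_right mult_ac)
        finally show "\<bar>?H y\<bar> \<le> ((1 + B * L) * M * Q x) * exp (- c * y\<^sup>2)" .
      qed
      also have "primitive ?H (x $ i) = T x" unfolding T_def by (intro primitive_sum ih) simp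
      also have "((1 + B * L) * M * Q x) * (LINT y|lborel. exp (- c * y\<^sup>2)) * exp (- c * (x $ i)\<^sup>2) =
          (1 + B * L) * L * M * exp (- c * (norm x)\<^sup>2)"
        unfolding L_def[symmetric] Q[of x] by (simp only: mult_ac)
      finally show ?thesis .
    qed
    show "\<exists>S'. tensor_sum S' \<and> (\<forall>x. \<bar>S' x\<bar> \<le> (D * M) * exp (- c * (norm x)\<^sup>2)) \<and>
      \<bar>(LINT x|lborel. f x * S x) - (LINT x|lborel. f x * S' x)\<bar> \<le> D * M \<and>
      (\<forall>x. \<bar>x $ i\<bar> > 1 \<longrightarrow> S' x = 0) \<and>
      (\<forall>j. (\<forall>x. \<bar>x $ j\<bar> > 1 \<longrightarrow> S x = 0) \<longrightarrow> (\<forall>x. \<bar>x $ j\<bar> > 1 \<longrightarrow> S' x = 0))"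
    proof (intro exI[of _ S'] conjI allI impI tS')
      fix x
      have "\<bar>S' x\<bar> \<le> (B * L) * M * exp (- c * (norm x)\<^sup>2)" using S'b[of "x $ i" x] unfolding S'_I Q .
      also have "\<dots> \<le> D * M * exp (- c * (norm x)\<^sup>2)" using D0 M by (intro mult_right_mono) auto
      finally show "\<bar>S' x\<bar> \<le> (D * M) * exp (- c * (norm x)\<^sup>2)" .
    next
      have "\<bar>LINT x|lborel. g x * T x\<bar> \<le> (LINT x|lborel. \<bar>g x * T x\<bar>)" by (rule integral_abs_bound)
      also have "\<dots> \<le> (LINT x|lborel. (1 + B * L) * L * M * \<bar>exp (- c * (norm x)\<^sup>2) * g x\<bar>)"
      proof (rule integral_mono)
        show "integrable lborel (\<lambda>x. \<bar>g x * T x\<bar>)" by (intro integrable_abs tensor_sum_integrable gauss_integrable_loc_int g tT)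
        show "integrable lborel (\<lambda>x. (1 + B * L) * L * M * \<bar>exp (- c * (norm x)\<^sup>2) * g x\<bar>)"
          by (intro integrable_mult_right integrable_abs gauss_integrable_integrable g c)
        fix x
        have "\<bar>g x * T x\<bar> \<le> \<bar>g x\<bar> * ((1 + B * L) * L * M * exp (- c * (norm x)\<^sup>2))"
          unfolding abs_mult by (intro mult_left_mono Tb) auto
        also have "\<dots> = (1 + B * L) * L * M * \<bar>exp (- c * (norm x)\<^sup>2) * g x\<bar>"
          unfolding abs_mult abs_exp_cancel by (simp only: mult_ac)
        finally show "\<bar>g x * T x\<bar> \<le> (1 + B * L) * L * M * \<bar>exp (- c * (norm x)\<^sup>2) * g x\<bar>" .
      qed
      also have "\<dots> = (1 + B * L) * L * E * M" unfolding E_def by simp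
      also have "\<dots> \<le> D * M" using D0(3) M by (intro mult_right_mono) auto
      finally show "\<bar>(LINT x|lborel. f x * S x) - (LINT x|lborel. f x * S' x)\<bar> \<le> D * M"
        unfolding pairing by simp
    next
      fix x :: "real^'n" assume "\<bar>x $ i\<bar> > 1"
      then show "S' x = 0" unfolding S'_I by (simp add: unit_bump_def bump_supp)
    next
      fix j and x :: "real^'n"
      assume j: "\<forall>x. \<bar>x $ j\<bar> > 1 \<longrightarrow> S x = 0" and x: "\<bar>x $ j\<bar> > 1"
      show "S' x = 0"
      proof (cases "j = i")
        case True
        then show ?thesis using x unfolding S'_I by (simp add: unit_bump_def bump_supp)
      next
        case False
        \<comment> \<open>Changing the coordinate \<open>i\<close> leaves
          \<open>\<bar>x $ j\<bar> > 1\<close> intact, so \<open>S\<close> vanishes along the whole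
          line over which \<open>I x\<close> integrates.\<close>
        have "(\<Sum>k<N. G k i 0 y * P k x) = 0" for y
          using j[rule_format, of "vec_upd x i y"] x False unfolding S_eq P_upd by simp
        then have "I x = 0"
        proof -
          have ii: "integrable lborel (\<lambda>y. G k i 0 y * P k x)" for k
            by (intro integrable_mult_left test_seq_integrable G)
          have "I x = (LINT y|lborel. (\<Sum>k<N. G k i 0 y * P k x))"
            unfolding I_def ck_def using ii by (simp add: Bochner_Integration.integral_sum)
          then show ?thesis using \<open>\<And>y. (\<Sum>k<N. G k i 0 y * P k x) = 0\<close> by simp
        qed
        then show ?thesis by (simp add: S'_I)
      qed
    qed
  qed
qed

text \<open>Averaging in every direction in turn leaves a test function that vanishes outside the
  cube of half-width 1, where local integrability of \<open>f\<close> is enough. Each direction only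
  multiplies the constant, and the exponent \<open>c\<close> is kept throughout.\<close>

lemma pairing_bound:
  fixes f :: "real^'n \<Rightarrow> real"
  assumes c: "c > 0" and f: "loc_int f" and wd: "\<And>i. \<exists>g. gauss_integrable g \<and> tensor_weak_deriv ((\<lambda>_. 0)(i := 1)) f g"
  shows "\<exists>D\<ge>0. \<forall>S M. tensor_sum S \<longrightarrow> M \<ge> 0 \<longrightarrow> (\<forall>x. \<bar>S x\<bar> \<le> M * exp (- c * (norm x)\<^sup>2)) \<longrightarrow>
    \<bar>LINT x|lborel. f x * S x\<bar> \<le> D * M"
proof -
  define E where "E x = exp (- c * (norm x)\<^sup>2)" for x :: "real^'n"
  define pr where "pr S = (LINT x|lborel. f x * S x)" for S :: "real^'n \<Rightarrow> real"
  define adm where "adm M S \<longleftrightarrow> tensor_sum S \<and> M \<ge> 0 \<and> (\<forall>x. \<bar>S x\<bar> \<le> M * E x)" for M :: real and S :: "real^'n \<Rightarrow> real"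
  define van where "van j S \<longleftrightarrow> (\<forall>x. \<bar>x $ j\<bar> > 1 \<longrightarrow> S x = 0)" for j and S :: "real^'n \<Rightarrow> real"
  have iter: "\<exists>D\<ge>0. \<forall>M S. adm M S \<longrightarrow> (\<exists>S'. adm (D * M) S' \<and> \<bar>pr S - pr S'\<bar> \<le> D * M \<and> (\<forall>j\<in>J. van j S'))"
    if "finite J" for J :: "'n set"
    using that
  proof (induction J rule: finite_induct)
    case empty
    show ?case
    proof (rule exI[of _ 1], intro conjI allI impI)
      fix M S assume "adm M S"
      then show "\<exists>S'. adm (1 * M) S' \<and> \<bar>pr S - pr S'\<bar> \<le> 1 * M \<and> (\<forall>j\<in>{}. van j S')"
        by (intro exI[of _ S]) (simp add: adm_def)
    qed simp
  next
    case (insert i J)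
    from insert.IH obtain D where D: "D \<ge> 0"
      "\<forall>M S. adm M S \<longrightarrow> (\<exists>S'. adm (D * M) S' \<and> \<bar>pr S - pr S'\<bar> \<le> D * M \<and> (\<forall>j\<in>J. van j S'))"
      by (elim exE conjE)
    obtain g where "gauss_integrable g" "tensor_weak_deriv ((\<lambda>_. 0)(i := 1)) f g" using wd by blast
    from average_direction[OF c f this] obtain B where B: "B \<ge> 0"
      and B2: "\<forall>S M. tensor_sum S \<longrightarrow> M \<ge> 0 \<longrightarrow> (\<forall>x. \<bar>S x\<bar> \<le> M * E x) \<longrightarrow>
        (\<exists>S'. tensor_sum S' \<and> (\<forall>x. \<bar>S' x\<bar> \<le> (B * M) * E x) \<and> \<bar>pr S - pr S'\<bar> \<le> B * M \<and> van i S' \<and> (\<forall>j. van j S \<longrightarrow> van j S'))"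
      unfolding E_def pr_def van_def by (elim exE conjE)
    have E1: "\<exists>S'. adm (B * M) S' \<and> \<bar>pr S - pr S'\<bar> \<le> B * M \<and> van i S' \<and> (\<forall>j. van j S \<longrightarrow> van j S')"
      if "adm M S" for M S
    proof -
      from that have 1: "tensor_sum S" "M \<ge> 0" "\<forall>x. \<bar>S x\<bar> \<le> M * E x" by (simp_all add: adm_def)
      have "0 \<le> B * M" using B 1(2) by simp
      then show ?thesis
        using B2[THEN spec, THEN spec, THEN mp, THEN mp, THEN mp, OF 1] unfolding adm_def by (simp only: simp_thms conj_assoc)
    qed
    show ?case
    \<comment> \<open>The old steps contribute the error \<open>D * M\<close>; the new one acts on a
      function of size \<open>D * M\<close> and adds \<open>B * (D * M)\<close>. The sum also bounds
      the size of the new function.\<close>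
    proof (rule exI[of _ "D + B * D"], intro conjI allI impI)
      show "0 \<le> D + B * D" using D(1) B by simp
      fix M S assume S: "adm M S"
      obtain S1 where S1: "adm (D * M) S1" "\<bar>pr S - pr S1\<bar> \<le> D * M" "\<forall>j\<in>J. van j S1"
        using D(2)[THEN spec, THEN spec, THEN mp, OF S] by (elim exE conjE)
      obtain S2 where S2: "adm (B * (D * M)) S2" "\<bar>pr S1 - pr S2\<bar> \<le> B * (D * M)" "van i S2" "\<forall>j. van j S1 \<longrightarrow> van j S2"
        using E1[OF S1(1)] by (elim exE conjE)
      have DM: "D * M \<ge> 0" using S1(1) by (simp add: adm_def)
      have eq: "(D + B * D) * M = D * M + B * (D * M)" by (simp only: distrib_right mult.assoc)
      have "adm ((D + B * D) * M) S2"
      proof -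
        have "B * (D * M) * E x \<le> (D + B * D) * M * E x" for x
          unfolding eq using DM by (intro mult_right_mono) (auto simp: E_def)
        then have "\<bar>S2 x\<bar> \<le> (D + B * D) * M * E x" for x
          using S2(1) order_trans unfolding adm_def by blast
        then show ?thesis using S2(1) DM B unfolding adm_def eq by simp
      qed
      moreover have "\<bar>pr S - pr S2\<bar> \<le> (D + B * D) * M" unfolding eq using S1(2) S2(2) by linarith
      moreover have "\<forall>j\<in>insert i J. van j S2" using S1(3) S2(3,4) by simp
      ultimately show "\<exists>S'. adm ((D + B * D) * M) S' \<and> \<bar>pr S - pr S'\<bar> \<le> (D + B * D) * M \<and> (\<forall>j\<in>insert i J. van j S')"
        by (intro exI[of _ S2] conjI)
    qed
  qed
  obtain D where D: "D \<ge> 0"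
    "\<forall>M S. adm M S \<longrightarrow> (\<exists>S'. adm (D * M) S' \<and> \<bar>pr S - pr S'\<bar> \<le> D * M \<and> (\<forall>j\<in>UNIV. van j S'))"
    using iter[OF finite[of UNIV]] by (elim exE conjE)
  \<comment> \<open>A point of the cube has l1 norm at most \<open>CARD('n)\<close>, so this ball
    contains the cube.\<close>
  define F where "F = (LINT x|lborel. \<bar>f x * indicator (cball 0 (real CARD('n))) x\<bar>)"
  have fi: "integrable lborel (\<lambda>x. f x * indicator (cball 0 (real CARD('n))) x)"
    by (rule loc_int_integrable[OF f, where B = 1 and R = "real CARD('n)"]) (auto simp: indicator_def)
  show ?thesis
  proof (intro exI[of _ "D + D * F"] conjI allI impI)
    have F: "F \<ge> 0" unfolding F_def by (intro Bochner_Integration.integral_nonneg) auto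
    show "D + D * F \<ge> 0" using D(1) F by simp
    fix S :: "real^'n \<Rightarrow> real" and M :: real
    assume S: "tensor_sum S" and M: "M \<ge> 0" and b: "\<forall>x. \<bar>S x\<bar> \<le> M * exp (- c * (norm x)\<^sup>2)"
    have aS: "adm M S" using S M b by (simp add: adm_def E_def)
    obtain S1 where S1': "adm (D * M) S1" "\<bar>pr S - pr S1\<bar> \<le> D * M" "\<forall>j\<in>UNIV. van j S1"
      using D(2)[THEN spec, THEN spec, THEN mp, OF aS] by (elim exE conjE)
    have S1: "tensor_sum S1" "\<And>x. \<bar>S1 x\<bar> \<le> (D * M) * exp (- c * (norm x)\<^sup>2)"
        "\<bar>(LINT x|lborel. f x * S x) - (LINT x|lborel. f x * S1 x)\<bar> \<le> D * M"
        "\<And>j x. \<bar>x $ j\<bar> > 1 \<Longrightarrow> S1 x = 0"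
      using S1' unfolding adm_def E_def pr_def van_def by auto
    have DM: "D * M \<ge> 0" using D(1) M by simp
    have "\<bar>LINT x|lborel. f x * S1 x\<bar> \<le> (LINT x|lborel. \<bar>f x * S1 x\<bar>)" by (rule integral_abs_bound)
    also have "\<dots> \<le> (LINT x|lborel. (D * M) * \<bar>f x * indicator (cball 0 (real CARD('n))) x\<bar>)"
    proof (rule integral_mono)
      show "integrable lborel (\<lambda>x. \<bar>f x * S1 x\<bar>)" by (intro integrable_abs tensor_sum_integrable f S1)
      show "integrable lborel (\<lambda>x. (D * M) * \<bar>f x * indicator (cball 0 (real CARD('n))) x\<bar>)"
        by (intro integrable_mult_right integrable_abs fi)
      fix x :: "real^'n"
      show "\<bar>f x * S1 x\<bar> \<le> (D * M) * \<bar>f x * indicator (cball 0 (real CARD('n))) x\<bar>"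
      proof (cases "\<exists>j. \<bar>x $ j\<bar> > 1")
        case True
        then show ?thesis using S1(4) DM by auto
      next
        case False
        then have "norm x \<le> (\<Sum>j\<in>(UNIV::'n set). 1)"
          by (intro order_trans[OF norm_le_l1_cart] sum_mono) (auto simp: not_less)
        then have x: "x \<in> cball 0 (real CARD('n))" by simp
        have "exp (- c * (norm x)\<^sup>2) \<le> 1" using c by simp
        then have "(D * M) * exp (- c * (norm x)\<^sup>2) \<le> (D * M) * 1" using DM by (intro mult_left_mono) auto
        then have "\<bar>S1 x\<bar> \<le> D * M" using S1(2)[of x] by linarith
        then have "\<bar>f x\<bar> * \<bar>S1 x\<bar> \<le> \<bar>f x\<bar> * (D * M)" by (intro mult_left_mono) auto
        then show ?thesis using x by (simp add: abs_mult mult_ac)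
      qed
    qed
    also have "\<dots> = D * M * F" unfolding F_def by simp
    finally have "\<bar>LINT x|lborel. f x * S x\<bar> \<le> D * M + D * M * F" using S1(3) by linarith
    then show "\<bar>LINT x|lborel. f x * S x\<bar> \<le> (D + D * F) * M" by (simp add: algebra_simps)
  qed
qed

section \<open>Duality\<close>

text \<open>A measurable function is an a.e. limit of continuous ones; clipping these to values
  between -1 and 1 preserves the limit. Stone-Weierstrass replaces them on \<open>A\<close> by
  polynomials with error below \<open>1 / real (Suc n)\<close>, whence the bound 2.\<close>

lemma sgn_polynomial_approximation:
  fixes f :: "real^'n \<Rightarrow> real"
  assumes f: "f \<in> borel_measurable borel" and A: "compact A"
  shows "\<exists>p. (\<forall>n. real_polynomial_function (p n)) \<and> (\<forall>n. \<forall>x\<in>A. \<bar>p n x\<bar> \<le> 2) \<and>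
    (AE x in lborel. x \<in> A \<longrightarrow> (\<lambda>n. p n x) \<longlonglongrightarrow> sgn (f x))"
proof -
  have "(\<lambda>x. sgn (f x)) \<in> borel_measurable lborel" using f by measurable
  then have "(\<lambda>x. sgn (f x)) \<in> borel_measurable lebesgue" by (rule measurable_completion)
  then have "(\<lambda>x. sgn (f x)) measurable_on UNIV" by (rule lebesgue_measurable_imp_measurable_on) simp
  then obtain Z g where Z: "negligible Z" and g: "\<And>n. continuous_on UNIV (g n)"
    and lim: "\<And>x. x \<notin> Z \<Longrightarrow> (\<lambda>n::nat. g n x) \<longlonglongrightarrow> sgn (f x)"
    unfolding measurable_on_def by auto
  define g' where "g' n x = max (-1) (min 1 (g n x))" for n x
  have "\<exists>p. real_polynomial_function p \<and> (\<forall>x\<in>A. \<bar>g' n x - p x\<bar> < 1 / real (Suc n))" for n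
  proof -
    have "continuous_on A (g' n)" unfolding g'_def[abs_def]
      by (intro continuous_intros continuous_on_subset[OF g]) auto
    from Stone_Weierstrass_real_polynomial_function[OF A this, of "1 / real (Suc n)"] show ?thesis
      by (metis of_nat_0_less_iff zero_less_Suc zero_less_divide_1_iff)
  qed
  then obtain p where p: "\<And>n. real_polynomial_function (p n)" "\<And>n x. x \<in> A \<Longrightarrow> \<bar>g' n x - p n x\<bar> < 1 / real (Suc n)"
    by metis
  have "\<bar>p n x\<bar> \<le> 2" if "x \<in> A" for n x
  proof -
    have "1 / real (Suc n) \<le> 1" by simp
    moreover have "\<bar>g' n x\<bar> \<le> 1" by (auto simp: g'_def)
    ultimately show ?thesis using p(2)[OF that, of n] by linarith
  qed
  moreover have "AE x in lborel. x \<in> A \<longrightarrow> (\<lambda>n. p n x) \<longlonglongrightarrow> sgn (f x)"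
  proof -
    have "AE x in lebesgue. x \<notin> Z"
      using Z unfolding negligible_iff_null_sets by (rule AE_not_in)
    then have "AE x in lborel. x \<notin> Z" by (simp add: AE_completion_iff)
    then show ?thesis
    proof (rule AE_mp, intro AE_I2 impI)
      fix x assume x: "x \<notin> Z" "x \<in> A"
      have "(\<lambda>n. max (-1) (min 1 (g n x))) \<longlonglongrightarrow> max (-1) (min 1 (sgn (f x)))"
        by (intro tendsto_max tendsto_min tendsto_const lim x)
      then have g': "(\<lambda>n. g' n x) \<longlonglongrightarrow> sgn (f x)" by (auto simp: g'_def sgn_if)
      have "(\<lambda>n. p n x - g' n x) \<longlonglongrightarrow> 0"
      proof (rule Lim_null_comparison)
        show "\<forall>\<^sub>F n in sequentially. norm (p n x - g' n x) \<le> 1 / real (Suc n)"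
          using p(2)[OF x(2)] by (intro always_eventually allI) (simp add: abs_minus_commute less_imp_le)
        show "(\<lambda>n. 1 / real (Suc n)) \<longlonglongrightarrow> 0" using LIMSEQ_inverse_real_of_nat by (simp add: inverse_eq_divide)
      qed
      from tendsto_add[OF this g'] show "(\<lambda>n. p n x) \<longlonglongrightarrow> sgn (f x)" by simp
    qed
  qed
  ultimately show ?thesis using p(1) by blast
qed

text \<open>\<open>f\<close> is tested with \<open>p n * W N\<close>, where \<open>W N\<close> is a
  cut-off Gaussian and \<open>p n\<close> approximates the sign of \<open>f\<close>. These functions
  are at most twice the Gaussian, so \<open>pairing_bound\<close> gives \<open>2 * D\<close>
  uniformly. The limit in \<open>n\<close> produces the integral of
  \<open>\<bar>f\<bar> * W N\<close>, and Fatou's lemma removes the cutoff.\<close>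

lemma gauss_integrable_weak_derivs:
  fixes f :: "real^'n \<Rightarrow> real"
  assumes f: "loc_int f" and wd: "\<And>i. \<exists>g. gauss_integrable g \<and> tensor_weak_deriv ((\<lambda>_. 0)(i := 1)) f g"
  shows "gauss_integrable f"
proof (rule gauss_integrable_from_nn)
  show fm [measurable]: "f \<in> borel_measurable borel" using f by (simp add: loc_int_def)
  fix c :: real assume c: "c > 0"
  obtain D where D: "D \<ge> 0" "\<And>S M. tensor_sum S \<Longrightarrow> M \<ge> 0 \<Longrightarrow> (\<And>x. \<bar>S x\<bar> \<le> M * exp (- c * (norm x)\<^sup>2)) \<Longrightarrow>
    \<bar>LINT x|lborel. f x * S x\<bar> \<le> D * M" using pairing_bound[OF c f wd] by blast
  \<comment> \<open>The function \<open>exp (- c * y\<^sup>2)\<close> with its derivatives, by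
    rescaling: \<open>gauss_hermite 0\<close> at \<open>2 * sqrt c * y\<close> is this Gaussian
    divided by \<open>sqrt (4 * pi)\<close>.\<close>
  define Ga where "Ga k y = sqrt (4 * pi) * (2 * sqrt c) ^ k * gauss_hermite k ((2 * sqrt c) * y + 0)" for k y
  have sGa: "deriv_seq Ga"
    unfolding Ga_def[abs_def] by (intro deriv_seq_affine) (simp add: deriv_seq_def gauss_hermite_deriv)
  have Ga0: "Ga 0 y = exp (- c * y\<^sup>2)" for y
    using c by (simp add: Ga_def power_mult_distrib)
  define W where "W N x = (\<Prod>i\<in>UNIV. leibniz 0 (bump_at_scale N) Ga (x $ i))" for N and x :: "real^'n"
  have bW: "test_seq (\<lambda>k. leibniz k (bump_at_scale N) Ga)" for N by (intro test_seq_leibniz test_seq_bump_at_scale sGa)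
  have tW: "tensor_sum (W N)" for N
    unfolding W_def[abs_def] using tensor_sum_tensor[of "\<lambda>_ k. leibniz k (bump_at_scale N) Ga"] bW by simp
  have br: "0 \<le> bump_at_scale N 0 y" "bump_at_scale N 0 y \<le> 1" for N y
    by (simp_all add: bump_at_scale_def bump_range)
  have rho: "(\<Prod>i\<in>UNIV. exp (- c * (x $ i)\<^sup>2)) = exp (- c * (norm x)\<^sup>2)" for x :: "real^'n"
    by (simp add: norm_sq_vec sum_distrib_left sum_negf flip: exp_sum)
  have W0: "0 \<le> W N x" for N x
    unfolding W_def by (intro prod_nonneg) (simp add: br Ga0)
  have W1: "W N x \<le> exp (- c * (norm x)\<^sup>2)" for N x
    unfolding W_def rho[symmetric] using br by (intro prod_mono) (auto simp: Ga0 intro!: mult_left_le_one_le)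
  have Wlim: "(\<lambda>N. W N x) \<longlonglongrightarrow> exp (- c * (norm x)\<^sup>2)" for x
  proof -
    have "(\<lambda>N. W N x) \<longlonglongrightarrow> (\<Prod>i\<in>UNIV. Ga 0 (x $ i))"
      unfolding W_def by (intro tendsto_prod leibniz_tendsto bump_at_scale_tendsto)
    then show ?thesis by (simp only: Ga0 rho)
  qed
  have main: "(\<integral>\<^sup>+x. ennreal (\<bar>f x\<bar> * W N x) \<partial>lborel) \<le> ennreal (D * 2)" for N
  proof -
    obtain R where R: "\<And>x. norm x > R \<Longrightarrow> W N x = 0" using tensor_sum_bounded[OF tW] by metis
    obtain p where p: "\<And>n. real_polynomial_function (p n)" "\<And>n x. x \<in> cball 0 R \<Longrightarrow> \<bar>p n x\<bar> \<le> 2"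
      and plim: "AE x in lborel. x \<in> cball 0 R \<longrightarrow> (\<lambda>n. p n x) \<longlonglongrightarrow> sgn (f x)"
      using sgn_polynomial_approximation[OF fm compact_cball[of 0 R]] by blast
    have tpW: "tensor_sum (\<lambda>x. p n x * W N x)" for n by (intro tensor_sum_mult_poly p tW)
    have pW: "\<bar>p n x * W N x\<bar> \<le> 2 * W N x" for n x
    proof (cases "norm x > R")
      case False
      then have "\<bar>p n x\<bar> * W N x \<le> 2 * W N x" using p(2)[of x n] W0 by (intro mult_right_mono) auto
      then show ?thesis using W0[of N x] by (simp add: abs_mult)
    qed (simp add: R)
    have iW: "integrable lborel (\<lambda>x. f x * W N x)" by (rule tensor_sum_integrable[OF f tW])
    have "(\<lambda>n. LINT x|lborel. f x * (p n x * W N x)) \<longlonglongrightarrow> (LINT x|lborel. \<bar>f x\<bar> * W N x)"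
    proof (rule integral_dominated_convergence[where w = "\<lambda>x. 2 * \<bar>f x * W N x\<bar>"])
      have [measurable]: "W N \<in> borel_measurable borel" by (rule tensor_sum_measurable[OF tW])
      show "(\<lambda>x. \<bar>f x\<bar> * W N x) \<in> borel_measurable lborel" by measurable
      show "(\<lambda>x. f x * (p n x * W N x)) \<in> borel_measurable lborel" for n
        using tensor_sum_measurable[OF tpW] by measurable
      show "integrable lborel (\<lambda>x. 2 * \<bar>f x * W N x\<bar>)" using iW by (intro integrable_mult_right integrable_abs)
      show "AE x in lborel. (\<lambda>n. f x * (p n x * W N x)) \<longlonglongrightarrow> \<bar>f x\<bar> * W N x"
        using plim
      proof eventually_elim
        case (elim x)
        show ?case
        proof (cases "norm x > R")
          case False
          then have "(\<lambda>n. f x * (p n x * W N x)) \<longlonglongrightarrow> f x * (sgn (f x) * W N x)"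
            using elim by (intro tendsto_intros) auto
          then show ?thesis by (simp add: mult.assoc[symmetric] mult_sgn_abs abs_sgn[symmetric])
        qed (simp add: R)
      qed
      show "AE x in lborel. norm (f x * (p n x * W N x)) \<le> 2 * \<bar>f x * W N x\<bar>" for n
      proof (rule AE_I2)
        fix x
        have "\<bar>f x\<bar> * \<bar>p n x * W N x\<bar> \<le> \<bar>f x\<bar> * (2 * W N x)" by (intro mult_left_mono pW) auto
        then show "norm (f x * (p n x * W N x)) \<le> 2 * \<bar>f x * W N x\<bar>"
          using W0[of N x] by (simp add: abs_mult mult_ac)
      qed
    qed
    moreover have "(LINT x|lborel. f x * (p n x * W N x)) \<le> D * 2" for n
    proof -
      have "\<bar>p n x * W N x\<bar> \<le> 2 * exp (- c * (norm x)\<^sup>2)" for x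
        using pW[of n x] W1[of N x] by linarith
      from D(2)[OF tpW _ this] show ?thesis by simp
    qed
    ultimately have le: "(LINT x|lborel. \<bar>f x\<bar> * W N x) \<le> D * 2" by (intro LIMSEQ_le_const2) auto
    have "(\<integral>\<^sup>+x. ennreal (\<bar>f x\<bar> * W N x) \<partial>lborel) = ennreal (LINT x|lborel. \<bar>f x\<bar> * W N x)"
    proof (rule nn_integral_eq_integral)
      show "integrable lborel (\<lambda>x. \<bar>f x\<bar> * W N x)" using integrable_abs[OF iW] W0 by (simp add: abs_mult)
    qed (simp add: W0)
    also have "\<dots> \<le> ennreal (D * 2)" by (rule ennreal_leI[OF le])
    finally show ?thesis .
  qed
  have "(\<integral>\<^sup>+x. ennreal (\<bar>f x\<bar> * exp (- c * (norm x)\<^sup>2)) \<partial>lborel) = (\<integral>\<^sup>+x. liminf (\<lambda>N. ennreal (\<bar>f x\<bar> * W N x)) \<partial>lborel)"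
  proof (rule nn_integral_cong, rule lim_imp_Liminf[symmetric])
    show "(\<lambda>N. ennreal (\<bar>f x\<bar> * W N x)) \<longlonglongrightarrow> ennreal (\<bar>f x\<bar> * exp (- c * (norm x)\<^sup>2))" for x
      by (intro tendsto_ennrealI tendsto_mult_left Wlim)
  qed simp
  also have "\<dots> \<le> liminf (\<lambda>N. \<integral>\<^sup>+x. ennreal (\<bar>f x\<bar> * W N x) \<partial>lborel)"
    by (rule nn_integral_liminf) (use tensor_sum_measurable[OF tW] in measurable)
  also have "\<dots> \<le> ennreal (D * 2)"
    by (rule order_trans[OF Liminf_le_Limsup Limsup_bounded]) (simp, intro always_eventually allI main)
  finally show "(\<integral>\<^sup>+x. ennreal (\<bar>f x\<bar> * exp (- c * (norm x)\<^sup>2)) \<partial>lborel) < \<infinity>"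
    by (rule le_less_trans) simp
qed

section \<open>The estimate\<close>

lemma borel_representative:
  assumes "f \<in> Lp_loc 1"
  obtains f' where "loc_int f'" "AE x in lborel. f x = f' x"
proof -
  from assms have m: "f \<in> borel_measurable lebesgue"
    and fin: "\<And>A. compact A \<Longrightarrow> (\<integral>\<^sup>+x\<in>A. ennreal (\<bar>f x\<bar> powr 1) \<partial>lebesgue) < \<infinity>"
    by (auto simp: Lp_loc_def)
  obtain f' where f': "f' \<in> borel_measurable lborel" "AE x in lborel. f x = f' x"
    using completion_ex_borel_measurable_real[OF m] by blast
  have "(\<integral>\<^sup>+x\<in>cball 0 R. ennreal \<bar>f' x\<bar> \<partial>lborel) < \<infinity>" for R
  proof -
    have "(\<integral>\<^sup>+x\<in>cball 0 R. ennreal \<bar>f' x\<bar> \<partial>lborel) = (\<integral>\<^sup>+x\<in>cball 0 R. ennreal (\<bar>f x\<bar> powr 1) \<partial>lborel)"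
      by (rule nn_integral_cong_AE, use f'(2) in eventually_elim) simp
    also have "\<dots> < \<infinity>" using fin[OF compact_cball] by (simp only: nn_integral_completion)
    finally show ?thesis .
  qed
  then have "loc_int f'" using f'(1) by (simp add: loc_int_def)
  then show ?thesis using f'(2) that by blast
qed

lemma AE_lborel_translate:
  fixes h :: "'a::euclidean_space"
  assumes "AE x in lborel. P x"
  shows "AE x in lborel. P (x + h)"
proof -
  have d: "distr lborel borel (\<lambda>x. h + x) = lborel" by (rule lborel_distr_plus)
  from assms obtain N where N: "N \<in> null_sets lborel" "{x \<in> space lborel. \<not> P x} \<subseteq> N"
    unfolding eventually_ae_filter by auto
  have "AE x in distr lborel borel (\<lambda>x. h + x). x \<notin> N"
    unfolding d by (rule AE_not_in[OF N(1)])
  then have "AE x in lborel. h + x \<notin> N"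
    by (subst (asm) AE_distr_iff) (use N(1) in \<open>auto simp: null_sets_def\<close>)
  then show ?thesis by eventually_elim (use N(2) in \<open>auto simp: add.commute\<close>)
qed

lemma fdiff_AE:
  fixes f g :: "'a::euclidean_space \<Rightarrow> real"
  assumes "AE x in lborel. f x = g x"
  shows "AE x in lborel. fdiff k h f x = fdiff k h g x"
  using assms
proof (induction k arbitrary: f g)
  case (Suc k)
  have "AE x in lborel. f (x + h) - f x = g (x + h) - g x"
    using Suc.prems AE_lborel_translate[OF Suc.prems, of h] by eventually_elim simp
  from Suc.IH[OF this] show ?case by simp
qed simp

lemma besov_seminorm_le1_eq:
  fixes f f' :: "real^'n \<Rightarrow> real"
  assumes "AE x in lborel. f x = f' x"
  shows "besov_seminorm_le1 \<sigma> 1 f = besov_int (nat \<lfloor>\<sigma>\<rfloor> + 1) \<sigma> f'"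
proof -
  have e: "ennpowr x 1 = x" for x by (cases x) (simp_all add: ennpowr_def)
  have lp: "Lp_norm 1 (fdiff k h f) = diff_modulus k f' h" for k h
  proof -
    have "Lp_norm 1 (fdiff k h f) = (\<integral>\<^sup>+x. ennreal \<bar>fdiff k h f x\<bar> \<partial>lborel)"
      by (simp add: Lp_norm_def e nn_integral_completion)
    also have "\<dots> = diff_modulus k f' h"
      unfolding diff_modulus_def by (rule nn_integral_cong_AE, use fdiff_AE[OF assms, of k h] in eventually_elim) simp
    finally show ?thesis .
  qed
  show ?thesis
    unfolding besov_seminorm_le1_def besov_int_def lp e by (simp add: e nn_integral_completion)
qed

lemma gauss_integrable_besov:
  assumes f: "loc_int f" and k: "k = 1 \<or> k = 2" and fin: "besov_int k \<sigma> f < \<infinity>" and \<sigma>: "\<sigma> > 0"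
  shows "gauss_integrable (f :: real^'n \<Rightarrow> real)"
  using k gauss_integrable_first_difference[OF f _ \<sigma>] gauss_integrable_second_difference[OF f _ \<sigma>] fin by auto

lemma finite_multi_indices: "finite {\<alpha> :: 'n::finite \<Rightarrow> nat. msize \<alpha> = l}"
proof (rule finite_subset)
  show "{\<alpha> :: 'n \<Rightarrow> nat. msize \<alpha> = l} \<subseteq> (UNIV :: 'n set) \<rightarrow>\<^sub>E {..l}"
    by (auto simp: PiE_def intro: member_le_sum)
  show "finite ((UNIV :: 'n set) \<rightarrow>\<^sub>E {..l})" by (intro finite_PiE) auto
qed

section \<open>Reduction of the Besov hypothesis to smoothness at most 1\<close>

text \<open>The integer \<open>l\<close> with \<open>s = l + \<sigma>\<close> and
  \<open>0 < \<sigma> \<le> 1\<close>. For \<open>s \<le> 1\<close> the set in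
  \<open>besov_ell\<close> is empty and its \<open>Max\<close> carries no information, hence the
  separate case.\<close>

definition reduced_order :: "real \<Rightarrow> nat" where
  "reduced_order s = (if s \<le> 1 then 0 else besov_ell s)"

lemma reduced_order_bounds:
  assumes "s > 0"
  shows "real (reduced_order s) < s" "s \<le> real (reduced_order s) + 1"
proof -
  have "real (reduced_order s) < s \<and> s \<le> real (reduced_order s) + 1"
  proof (cases "s \<le> 1")
    case False
    let ?J = "{j. 1 \<le> j \<and> real j < s}"
    have "?J \<subseteq> {..nat \<lceil>s\<rceil>}" by (auto simp: nat_le_iff le_nat_iff) linarith
    then have fin: "finite ?J" using finite_subset by blast
    have ne: "?J \<noteq> {}" using False by (auto intro: exI[of _ 1])
    have "Max ?J \<in> ?J" by (rule Max_in[OF fin ne])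
    moreover have "\<not> real (Max ?J + 1) < s"
    proof
      assume "real (Max ?J + 1) < s"
      then have "Max ?J + 1 \<in> ?J" by simp
      from Max_ge[OF fin this] show False by simp
    qed
    ultimately show ?thesis using False by (simp add: reduced_order_def besov_ell_def)
  qed (use assms in \<open>simp add: reduced_order_def\<close>)
  then show "real (reduced_order s) < s" "s \<le> real (reduced_order s) + 1" by auto
qed

text \<open>Interface between the Besov hypothesis and the kernel estimates: the latter see
  \<open>f\<close> only through functions that have absorbed \<open>l\<close> derivatives. In
  \<open>besov_data\<close> these are the Borel representative itself if \<open>l = 0\<close>, and
  representatives of weak derivatives otherwise.\<close>

abbreviation reduces_to :: "nat \<Rightarrow> (real^'n \<Rightarrow> real) \<Rightarrow> (('n \<Rightarrow> nat) \<Rightarrow> real^'n \<Rightarrow> real) \<Rightarrow> bool" where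
  "reduces_to l f g \<equiv> \<forall>\<alpha>. msize \<alpha> = l \<longrightarrow> gauss_integrable (g \<alpha>) \<and>
     (\<forall>\<beta> t x. t > 0 \<longrightarrow> heat_conv (\<lambda>i. \<beta> i + \<alpha> i) f t x = heat_conv \<beta> (g \<alpha>) t x)"

abbreviation besov_sum :: "nat \<Rightarrow> nat \<Rightarrow> real \<Rightarrow> (('n \<Rightarrow> nat) \<Rightarrow> real^'n \<Rightarrow> real) \<Rightarrow> ennreal" where
  "besov_sum l k \<sigma> g \<equiv> \<Sum>\<alpha> | msize \<alpha> = l. besov_int k \<sigma> (g \<alpha>)"

text \<open>The seminorm makes only the weak derivatives of top order \<open>l\<close> Gaussian
  integrable. From there the property descends one order at a time to the function itself, after
  which weak derivatives may be moved through the convolution.\<close>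

lemma besov_data:
  fixes f :: "real^'n \<Rightarrow> real"
  assumes s: "s > 0" and f: "f \<in> besov s 1"
  defines "l \<equiv> reduced_order s"
  defines "k \<equiv> nat \<lfloor>s - real l\<rfloor> + 1"
  shows "\<exists>f' g. gauss_integrable f' \<and> (AE x in lborel. f x = f' x) \<and>
    reduces_to l f' g \<and>
    besov_sum l k (s - real l) g = besov_seminorm s 1 f"
proof -
  have \<sigma>: "s - real l > 0" "s - real l \<le> 1" using reduced_order_bounds[OF s] by (auto simp: l_def)
  have k: "k = 1 \<or> k = 2"
  proof -
    obtain z where z: "\<lfloor>s - real l\<rfloor> = z" by blast
    have "z = 0 \<or> z = 1" using \<sigma> z by linarith
    then show ?thesis unfolding k_def z by auto
  qed
  show ?thesis
  proof (cases "s \<le> 1")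
    case True
    then have l: "l = 0" by (simp add: l_def reduced_order_def)
    from f True have "f \<in> Lp_loc 1" and fin: "besov_seminorm_le1 s 1 f < \<infinity>"
      by (auto simp: besov_def besov_le1_def)
    then obtain f' where f': "loc_int f'" "AE x in lborel. f x = f' x" using borel_representative by blast
    have eq: "besov_seminorm_le1 s 1 f = besov_int k (s - real l) f'"
      unfolding k_def l using besov_seminorm_le1_eq[OF f'(2), of s] by simp
    have "gauss_integrable f'" by (rule gauss_integrable_besov[OF f'(1) k _ \<sigma>(1)]) (use fin eq in simp)
    moreover have "{\<alpha>::'n \<Rightarrow> nat. msize \<alpha> = l} = {\<lambda>_. 0}" by (auto simp: l)
    ultimately show ?thesis
      using f'(2) eq True by (intro exI[of _ f'] exI[of _ "\<lambda>_. f'"]) (auto simp: besov_seminorm_def l)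
  next
    case False
    then have l: "l = besov_ell s" by (simp add: l_def reduced_order_def)
    have l1: "l \<ge> 1" using reduced_order_bounds(2)[OF s] False unfolding l_def by linarith
    from f False have fW: "f \<in> Wkp_loc l 1"
      and fin: "\<And>\<alpha>. msize \<alpha> = l \<Longrightarrow> weak_deriv \<alpha> f \<in> besov_le1 (s - real l) 1"
      by (auto simp: besov_def l)
    from fW have fL: "f \<in> Lp_loc 1" by (simp add: Wkp_loc_def)
    have wd: "weak_deriv \<alpha> f \<in> Lp_loc 1 \<and> is_weak_deriv \<alpha> f (weak_deriv \<alpha> f)" if "msize \<alpha> \<le> l" for \<alpha>
    proof -
      have "\<exists>g. g \<in> Lp_loc 1 \<and> is_weak_deriv \<alpha> f g" using fW that by (auto simp: Wkp_loc_def)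
      then show ?thesis unfolding weak_deriv_def by (rule someI_ex)
    qed
    obtain f' where f': "loc_int f'" "AE x in lborel. f x = f' x" using borel_representative[OF fL] by blast
    have "\<exists>d. loc_int d \<and> (AE x in lborel. weak_deriv \<alpha> f x = d x)" if "msize \<alpha> \<le> l" for \<alpha>
      using borel_representative wd[OF that] by metis
    then obtain d where d: "\<And>\<alpha>. msize \<alpha> \<le> l \<Longrightarrow> loc_int (d \<alpha>)"
      "\<And>\<alpha>. msize \<alpha> \<le> l \<Longrightarrow> AE x in lborel. weak_deriv \<alpha> f x = d \<alpha> x" by metis
    have wt: "tensor_weak_deriv \<alpha> f' (d \<alpha>)" if "msize \<alpha> \<le> l" for \<alpha>
    proof (rule is_weak_deriv_imp_tensor)
      show "is_weak_deriv \<alpha> f (weak_deriv \<alpha> f)" using wd[OF that] by simp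
      show "f \<in> borel_measurable lebesgue" using fL by (simp add: Lp_loc_def)
      show "f' \<in> borel_measurable borel" using f'(1) by (simp add: loc_int_def)
      show "weak_deriv \<alpha> f \<in> borel_measurable lebesgue" using wd[OF that] by (simp add: Lp_loc_def)
      show "d \<alpha> \<in> borel_measurable borel" using d(1)[OF that] by (simp add: loc_int_def)
    qed (use f'(2) d(2)[OF that] in auto)
    have eq: "besov_seminorm_le1 (s - real l) 1 (weak_deriv \<alpha> f) = besov_int k (s - real l) (d \<alpha>)" if "msize \<alpha> = l" for \<alpha>
      unfolding k_def using that by (intro besov_seminorm_le1_eq d(2)) simp
    have top: "gauss_integrable (d \<alpha>)" if "msize \<alpha> = l" for \<alpha>
      by (rule gauss_integrable_besov[OF d(1) k _ \<sigma>(1)]) (use fin[OF that] eq[OF that] that in \<open>auto simp: besov_le1_def\<close>)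
    \<comment> \<open>Induction on the distance to the top order: the first derivatives of
      \<open>d \<alpha>\<close> are the \<open>d\<close> of the next higher multi-indices.\<close>
    have dGI: "gauss_integrable (d \<alpha>)" if "msize \<alpha> \<le> l" for \<alpha>
      using that
    proof (induction "l - msize \<alpha>" arbitrary: \<alpha>)
      case 0
      then show ?case by (intro top) simp
    next
      case (Suc n)
      have m: "msize (\<alpha>(i := Suc (\<alpha> i))) = Suc (msize \<alpha>)" for i using msize_upd[of \<alpha> i 1] by simp
      show ?case
      proof (rule gauss_integrable_weak_derivs[OF d(1)[OF Suc.prems]])
        fix i
        have le: "msize (\<alpha>(i := Suc (\<alpha> i))) \<le> l" using Suc.hyps(2) unfolding m by linarith
        have "gauss_integrable (d (\<alpha>(i := Suc (\<alpha> i))))" by (rule Suc.hyps(1)[OF _ le]) (use Suc.hyps(2) in \<open>unfold m, linarith\<close>)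
        moreover have "tensor_weak_deriv ((\<lambda>_. 0)(i := 1)) (d \<alpha>) (d (\<alpha>(i := Suc (\<alpha> i))))"
          by (rule tensor_weak_deriv_step[OF wt[OF Suc.prems] wt[OF le]])
        ultimately show "\<exists>g. gauss_integrable g \<and> tensor_weak_deriv ((\<lambda>_. 0)(i := 1)) (d \<alpha>) g" by blast
      qed
    qed
    \<comment> \<open>A separate last step, since \<open>d\<close> at the zero multi-index is a
      chosen weak derivative of order 0 and not syntactically \<open>f'\<close>.\<close>
    have GIf: "gauss_integrable f'"
    proof (rule gauss_integrable_weak_derivs[OF f'(1)])
      fix i :: 'n
      have "msize ((\<lambda>_. 0)(i := 1)) \<le> l" using msize_upd[of "\<lambda>_. 0" i 1] l1 by simp
      then show "\<exists>g. gauss_integrable g \<and> tensor_weak_deriv ((\<lambda>_. 0)(i := 1)) f' g" using dGI wt by blast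
    qed
    show ?thesis
    proof (intro exI[of _ f'] exI[of _ d] conjI allI impI GIf f'(2))
      fix \<alpha> :: "'n \<Rightarrow> nat" assume \<alpha>: "msize \<alpha> = l"
      show "gauss_integrable (d \<alpha>)" by (rule top[OF \<alpha>])
      show "heat_conv (\<lambda>i. \<beta> i + \<alpha> i) f' t x = heat_conv \<beta> (d \<alpha>) t x" if "t > 0" for \<beta> t x
        by (rule heat_conv_weak_deriv[OF wt GIf top that]) (use \<alpha> in auto)
    next
      have "besov_seminorm s 1 f = (\<Sum>\<alpha> | msize \<alpha> = l. besov_seminorm_le1 (s - real l) 1 (weak_deriv \<alpha> f))"
        using False by (simp add: besov_seminorm_def l)
      also have "\<dots> = besov_sum l k (s - real l) d"
        by (intro sum.cong) (auto simp: eq)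
      finally show "besov_sum l k (s - real l) d = besov_seminorm s 1 f" ..
    qed
  qed
qed

lemma deriv_rep_measurable:
  fixes G :: "(real^'n \<Rightarrow> real) \<Rightarrow> real \<Rightarrow> real^'n \<Rightarrow> real"
  assumes "deriv_rep j G" and [measurable]: "f \<in> borel_measurable borel"
  shows "(\<lambda>z. G f (snd z) (fst z)) \<in> borel_measurable borel"
  using assms(1)
proof (induction rule: deriv_rep.induct)
  case (basic j \<alpha> c)
  note heat_conv_measurable[OF assms(2), of \<alpha>, measurable]
  have [measurable]: "snd \<in> borel_measurable (borel :: ((real^'n) \<times> real) measure)"
    by (intro borel_measurable_continuous_onI continuous_intros)
  show ?case by measurable
qed auto

lemma nn_integral_half_space:
  fixes F :: "(real^'n) \<times> real \<Rightarrow> ennreal"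
  assumes [measurable]: "F \<in> borel_measurable borel"
  shows "(\<integral>\<^sup>+z\<in>UNIV \<times> {0<..}. F z \<partial>lborel) = (\<integral>\<^sup>+t\<in>{0<..}. (\<integral>\<^sup>+x. F (x, t) \<partial>lborel) \<partial>lborel)"
proof -
  have [measurable]: "F \<in> borel_measurable (lborel \<Otimes>\<^sub>M lborel)" by (simp add: lborel_prod)
  have "(\<integral>\<^sup>+z\<in>UNIV \<times> {0<..}. F z \<partial>lborel) = (\<integral>\<^sup>+z. F z * indicator {0<..} (snd z) \<partial>(lborel \<Otimes>\<^sub>M lborel))"
    unfolding lborel_prod by (intro nn_integral_cong) (auto simp: indicator_def)
  also have "\<dots> = (\<integral>\<^sup>+t. (\<integral>\<^sup>+x. F (x, t) * indicator {0<..} (snd (x, t)) \<partial>lborel) \<partial>lborel)"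
    by (rule lborel_pair.nn_integral_snd[symmetric]) measurable
  also have "\<dots> = (\<integral>\<^sup>+t\<in>{0<..}. (\<integral>\<^sup>+x. F (x, t) \<partial>lborel) \<partial>lborel)"
    by (intro nn_integral_cong) (simp add: nn_integral_multc)
  finally show ?thesis .
qed

section \<open>Estimate for a single space-time derivative\<close>

text \<open>In each basic term \<open>l\<close> derivatives go to \<open>g\<close> and the others
  stay on the kernel, which reduces the term to \<open>core_estimate\<close>. The constant depends
  on \<open>G\<close> alone.\<close>

lemma deriv_rep_estimate:
  fixes G :: "(real^'n \<Rightarrow> real) \<Rightarrow> real \<Rightarrow> real^'n \<Rightarrow> real"
  assumes "deriv_rep (m + 1) G" and a: "- 1 < a" "a < real m"
  defines "s \<equiv> real m - a"
  defines "l \<equiv> reduced_order s"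
  defines "k \<equiv> nat \<lfloor>s - real l\<rfloor> + 1"
  shows "\<exists>C\<ge>0. \<forall>f (g :: ('n \<Rightarrow> nat) \<Rightarrow> real^'n \<Rightarrow> real). gauss_integrable f \<longrightarrow>
    reduces_to l f g \<longrightarrow>
    (\<integral>\<^sup>+z\<in>UNIV \<times> {0<..}. ennreal (snd z powr a * \<bar>G f (snd z) (fst z)\<bar>) \<partial>lborel) \<le>
      ennreal C * besov_sum l k (s - real l) g"
  using assms(1)
proof (induction "m + 1" G rule: deriv_rep.induct)
  case zero
  show ?case by (intro exI[of _ 0]) simp
next
  case (basic \<gamma> c)
  have s: "s > 0" using a by (simp add: s_def)
  have \<sigma>: "s - real l > 0" "s - real l \<le> 1" using reduced_order_bounds[OF s] by (auto simp: l_def)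
  have lle: "l \<le> m" using \<sigma>(1) a(1) unfolding s_def by linarith
  obtain \<beta> \<alpha> where \<gamma>: "\<gamma> = (\<lambda>i. \<beta> i + \<alpha> i)" and \<alpha>: "msize \<alpha> = l"
    using multi_index_split[of l \<gamma>] basic lle by auto
  have m\<gamma>: "msize \<gamma> = msize \<beta> + l" by (simp add: \<gamma> sum.distrib \<alpha>)
  have "k = 1 \<or> k = 2 \<and> s - real l = 1"
  proof -
    obtain z where z: "\<lfloor>s - real l\<rfloor> = z" by blast
    have "z = 0 \<or> z = 1 \<and> s - real l = 1" using \<sigma> z by linarith
    then show ?thesis unfolding k_def z by auto
  qed
  \<comment> \<open>From \<open>-1 < a\<close> follows \<open>l < m + 1\<close>, so at least one
    derivative stays on the kernel. If \<open>k = 2\<close>, then \<open>m - a = l + 1\<close>, and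
    \<open>-1 < a\<close> now forces \<open>l < m\<close>, which leaves two.\<close>
  then have k: "k = 1 \<or> k = 2" and k\<beta>: "k \<le> msize \<beta>"
    using basic lle a(1) unfolding m\<gamma> s_def by linarith+
  from core_estimate[OF k k\<beta> \<sigma>(1)] obtain C where C: "C \<ge> 0" and
    core: "\<And>g :: real^'n \<Rightarrow> real. gauss_integrable g \<Longrightarrow> (\<integral>\<^sup>+t\<in>{0<..}. (\<integral>\<^sup>+x. ennreal (t powr (real (msize \<beta>) - (s - real l) - 1) * \<bar>heat_conv \<beta> g t (x::real^'n)\<bar>) \<partial>lborel) \<partial>lborel) \<le>
     ennreal C * besov_int k (s - real l) g" by blast
  show ?case
  proof (intro exI[of _ "\<bar>c\<bar> * C"] conjI allI impI)
    show "0 \<le> \<bar>c\<bar> * C" using C by simp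
    fix f :: "real^'n \<Rightarrow> real" and g :: "('n \<Rightarrow> nat) \<Rightarrow> real^'n \<Rightarrow> real"
    assume f: "gauss_integrable f" and g: "reduces_to l f g"
    have g\<alpha>: "gauss_integrable (g \<alpha>)" using g \<alpha> by blast
    have [measurable]: "g \<alpha> \<in> borel_measurable borel" using g\<alpha> by (simp add: gauss_integrable_def)
    let ?e = "real (msize \<beta>) - (s - real l) - 1"
    let ?G = "\<lambda>f t x. c * t ^ (msize \<gamma> - (m + 1)) * heat_conv \<gamma> f t x"
    have Gm: "(\<lambda>z. ?G f (snd z) (fst z)) \<in> borel_measurable borel"
      using deriv_rep_measurable[OF deriv_rep.basic[OF basic, of c]] f by (simp add: gauss_integrable_def)
    have "(\<integral>\<^sup>+z\<in>UNIV \<times> {0<..}. ennreal (snd z powr a * \<bar>?G f (snd z) (fst z)\<bar>) \<partial>lborel) =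
        (\<integral>\<^sup>+t\<in>{0<..}. (\<integral>\<^sup>+x. ennreal (snd (x, t) powr a * \<bar>?G f (snd (x, t)) (fst (x, t))\<bar>) \<partial>lborel) \<partial>lborel)"
    proof (rule nn_integral_half_space)
      have "snd \<in> borel_measurable (borel :: ((real^'n) \<times> real) measure)"
        by (intro borel_measurable_continuous_onI continuous_intros)
      then show "(\<lambda>z. ennreal (snd z powr a * \<bar>?G f (snd z) (fst z)\<bar>)) \<in> borel_measurable borel"
        using Gm by measurable
    qed
    also have "\<dots> = (\<integral>\<^sup>+t. ennreal \<bar>c\<bar> * ((\<integral>\<^sup>+x. ennreal (t powr ?e * \<bar>heat_conv \<beta> (g \<alpha>) t x\<bar>) \<partial>lborel) * indicator {0<..} t) \<partial>lborel)"
    proof (rule nn_integral_cong)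
      fix t :: real
      show "(\<integral>\<^sup>+x. ennreal (snd (x, t) powr a * \<bar>?G f (snd (x, t)) (fst (x, t))\<bar>) \<partial>lborel) * indicator {0<..} t =
        ennreal \<bar>c\<bar> * ((\<integral>\<^sup>+x. ennreal (t powr ?e * \<bar>heat_conv \<beta> (g \<alpha>) t x\<bar>) \<partial>lborel) * indicator {0<..} t)"
      proof (cases "t > 0")
        case True
        have e: "t powr a * t ^ (msize \<gamma> - (m + 1)) = t powr ?e"
        proof -
          have "t ^ (msize \<gamma> - (m + 1)) = t powr real (msize \<gamma> - (m + 1))" by (rule powr_realpow[OF True, symmetric])
          then have "t powr a * t ^ (msize \<gamma> - (m + 1)) = t powr (a + real (msize \<gamma> - (m + 1)))" by (simp only: powr_add)
          \<comment> \<open>With \<open>msize \<gamma> = msize \<beta> + l\<close> and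
            \<open>s = m - a\<close>, the powers of \<open>t\<close> combine to exactly the exponent
            of \<open>core_estimate\<close>.\<close>
          also have "a + real (msize \<gamma> - (m + 1)) = ?e"
            using of_nat_diff[OF basic, where 'a = real] unfolding m\<gamma> s_def by simp
          finally show ?thesis .
        qed
        have "heat_conv \<gamma> f t x = heat_conv \<beta> (g \<alpha>) t x" for x using g \<alpha> True unfolding \<gamma> by blast
        then have "snd (x, t) powr a * \<bar>?G f (snd (x, t)) (fst (x, t))\<bar> = \<bar>c\<bar> * ((t powr a * t ^ (msize \<gamma> - (m + 1))) * \<bar>heat_conv \<beta> (g \<alpha>) t x\<bar>)" for x
          using True by (simp add: abs_mult)
        then have "(\<integral>\<^sup>+x. ennreal (snd (x, t) powr a * \<bar>?G f (snd (x, t)) (fst (x, t))\<bar>) \<partial>lborel) =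
            (\<integral>\<^sup>+x. ennreal \<bar>c\<bar> * ennreal (t powr ?e * \<bar>heat_conv \<beta> (g \<alpha>) t x\<bar>) \<partial>lborel)"
          unfolding e by (simp only: ennreal_mult abs_ge_zero powr_ge_zero mult_nonneg_nonneg)
        also have "\<dots> = ennreal \<bar>c\<bar> * (\<integral>\<^sup>+x. ennreal (t powr ?e * \<bar>heat_conv \<beta> (g \<alpha>) t x\<bar>) \<partial>lborel)"
          by (rule nn_integral_cmult) measurable
        finally show ?thesis using True by simp
      qed simp
    qed
    also have "\<dots> = ennreal \<bar>c\<bar> * (\<integral>\<^sup>+t\<in>{0<..}. (\<integral>\<^sup>+x. ennreal (t powr ?e * \<bar>heat_conv \<beta> (g \<alpha>) t x\<bar>) \<partial>lborel) \<partial>lborel)"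
      by (rule nn_integral_cmult) measurable
    also have "\<dots> \<le> ennreal \<bar>c\<bar> * (ennreal C * besov_int k (s - real l) (g \<alpha>))"
      by (intro mult_left_mono core g\<alpha>) simp
    also have "\<dots> = ennreal (\<bar>c\<bar> * C) * besov_int k (s - real l) (g \<alpha>)"
      using C by (simp add: ennreal_mult mult.assoc)
    also have "\<dots> \<le> ennreal (\<bar>c\<bar> * C) * besov_sum l k (s - real l) g"
      by (intro mult_left_mono member_le_sum finite_multi_indices) (use \<alpha> in auto)
    finally show "(\<integral>\<^sup>+z\<in>UNIV \<times> {0<..}. ennreal (snd z powr a * \<bar>?G f (snd z) (fst z)\<bar>) \<partial>lborel) \<le>
      ennreal (\<bar>c\<bar> * C) * besov_sum l k (s - real l) g" .
  qed
next
  case (add G H)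
  from add.hyps(2) obtain C where C: "C \<ge> 0" and G: "\<And>f (g :: ('n \<Rightarrow> nat) \<Rightarrow> real^'n \<Rightarrow> real). gauss_integrable f \<Longrightarrow>
    reduces_to l f g \<Longrightarrow>
    (\<integral>\<^sup>+z\<in>UNIV \<times> {0<..}. ennreal (snd z powr a * \<bar>G f (snd z) (fst z)\<bar>) \<partial>lborel) \<le>
      ennreal C * besov_sum l k (s - real l) g" by blast
  from add.hyps(4) obtain D where D: "D \<ge> 0" and H: "\<And>f (g :: ('n \<Rightarrow> nat) \<Rightarrow> real^'n \<Rightarrow> real). gauss_integrable f \<Longrightarrow>
    reduces_to l f g \<Longrightarrow>
    (\<integral>\<^sup>+z\<in>UNIV \<times> {0<..}. ennreal (snd z powr a * \<bar>H f (snd z) (fst z)\<bar>) \<partial>lborel) \<le>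
      ennreal D * besov_sum l k (s - real l) g" by blast
  show ?case
  proof (intro exI[of _ "C + D"] conjI allI impI)
    show "0 \<le> C + D" using C D by simp
    fix f :: "real^'n \<Rightarrow> real" and g :: "('n \<Rightarrow> nat) \<Rightarrow> real^'n \<Rightarrow> real"
    assume f: "gauss_integrable f" and g: "reduces_to l f g"
    have fm: "f \<in> borel_measurable borel" using f by (simp add: gauss_integrable_def)
    note [measurable] = deriv_rep_measurable[OF add.hyps(1) fm] deriv_rep_measurable[OF add.hyps(3) fm]
    have [measurable]: "snd \<in> borel_measurable (borel :: ((real^'n) \<times> real) measure)"
      by (intro borel_measurable_continuous_onI continuous_intros)
    have [measurable]: "UNIV \<times> {0<..} \<in> sets (borel :: ((real^'n) \<times> real) measure)"
      by (intro borel_open open_Times) auto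
    let ?F = "\<lambda>G z. ennreal (snd z powr a * \<bar>G f (snd z) (fst z)\<bar>) * indicator (UNIV \<times> {0<..}) z"
    have "(\<integral>\<^sup>+z. ?F (\<lambda>f t x. G f t x + H f t x) z \<partial>lborel) \<le> (\<integral>\<^sup>+z. ?F G z + ?F H z \<partial>lborel)"
    proof (rule nn_integral_mono)
      fix z :: "(real^'n) \<times> real"
      have "snd z powr a * \<bar>G f (snd z) (fst z) + H f (snd z) (fst z)\<bar> \<le>
         snd z powr a * \<bar>G f (snd z) (fst z)\<bar> + snd z powr a * \<bar>H f (snd z) (fst z)\<bar>"
        unfolding distrib_left[symmetric] by (intro mult_left_mono) auto
      from ennreal_leI[OF this]
      have "ennreal (snd z powr a * \<bar>G f (snd z) (fst z) + H f (snd z) (fst z)\<bar>) \<le>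
         ennreal (snd z powr a * \<bar>G f (snd z) (fst z)\<bar>) + ennreal (snd z powr a * \<bar>H f (snd z) (fst z)\<bar>)"
        by (subst (asm) ennreal_plus) simp_all
      then show "?F (\<lambda>f t x. G f t x + H f t x) z \<le> ?F G z + ?F H z"
        unfolding distrib_right[symmetric] by (intro mult_right_mono) auto
    qed
    also have "\<dots> = (\<integral>\<^sup>+z. ?F G z \<partial>lborel) + (\<integral>\<^sup>+z. ?F H z \<partial>lborel)"
      by (rule nn_integral_add) measurable
    also have "\<dots> \<le> ennreal C * besov_sum l k (s - real l) g +
        ennreal D * besov_sum l k (s - real l) g"
      by (intro add_mono G[OF f g] H[OF f g])
    also have "\<dots> = ennreal (C + D) * besov_sum l k (s - real l) g"
      using C D by (simp add: distrib_right)
    finally show "(\<integral>\<^sup>+z. ?F (\<lambda>f t x. G f t x + H f t x) z \<partial>lborel) \<le>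
      ennreal (C + D) * besov_sum l k (s - real l) g" .
  qed
qed

theorem theorem1p1:
  fixes m :: nat and a :: real
  assumes "-1 < a" and "a < real m"
  shows "\<exists>C>0. \<forall>f :: real^'n \<Rightarrow> real. f \<in> besov (real m - a) 1 \<longrightarrow>
           (\<integral>\<^sup>+z\<in>UNIV \<times> {0<..}. ennreal (snd z powr a * nabla_norm (m + 1) (gauss_ext f) z) \<partial>lborel)
             \<le> ennreal C * besov_seminorm (real m - a) 1 f"
proof -
  define s where "s = real m - a"
  define l where "l = reduced_order s"
  define k where "k = nat \<lfloor>s - real l\<rfloor> + 1"
  have s: "s > 0" using assms by (simp add: s_def)
  define I where "I = {bs. set bs \<subseteq> (Basis :: ((real^'n) \<times> real) set) \<and> length bs = m + 1}"
  have fin: "finite I" unfolding I_def by (rule finite_lists_length_eq) simp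
  have "\<forall>bs\<in>I. \<exists>G. deriv_rep (m + 1) G \<and> (\<forall>f F. gauss_integrable f \<longrightarrow> (\<forall>t x. t > 0 \<longrightarrow> F (x, t) = heat_conv (\<lambda>_::'n. 0) f t x) \<longrightarrow>
     (\<forall>t x. t > 0 \<longrightarrow> partials bs F (x, t) = G f t x))"
  proof
    fix bs assume "bs \<in> I"
    then have "bs \<in> lists Basis" "length bs = m + 1" by (auto simp: I_def)
    with partials_deriv_rep[of bs] show "\<exists>G. deriv_rep (m + 1) G \<and> (\<forall>f F. gauss_integrable f \<longrightarrow> (\<forall>t x. t > 0 \<longrightarrow> F (x, t) = heat_conv (\<lambda>_::'n. 0) f t x) \<longrightarrow>
     (\<forall>t x. t > 0 \<longrightarrow> partials bs F (x, t) = G f t x))" by simp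
  qed
  \<comment> \<open>The representations, and below them the constants, are fixed for all
    \<open>bs\<close> before any \<open>f\<close> is introduced.\<close>
  from bchoice[OF this] obtain G where G: "\<And>bs. bs \<in> I \<Longrightarrow> deriv_rep (m + 1) (G bs)"
    and GF: "\<And>bs f F t x. bs \<in> I \<Longrightarrow> gauss_integrable f \<Longrightarrow> (\<forall>t x. t > 0 \<longrightarrow> F (x, t) = heat_conv (\<lambda>_::'n. 0) f t x) \<Longrightarrow> t > 0 \<Longrightarrow>
       partials bs F (x, t) = G bs f t x" by blast
  have "\<forall>bs\<in>I. \<exists>C\<ge>0. \<forall>f (g :: ('n \<Rightarrow> nat) \<Rightarrow> real^'n \<Rightarrow> real). gauss_integrable f \<longrightarrow>
    reduces_to l f g \<longrightarrow>
    (\<integral>\<^sup>+z\<in>UNIV \<times> {0<..}. ennreal (snd z powr a * \<bar>G bs f (snd z) (fst z)\<bar>) \<partial>lborel) \<le>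
      ennreal C * besov_sum l k (s - real l) g"
    unfolding k_def l_def s_def by (intro ballI deriv_rep_estimate G assms)
  from bchoice[OF this] obtain C where C: "\<And>bs. bs \<in> I \<Longrightarrow> C bs \<ge> 0"
    and est: "\<And>bs f (g :: ('n \<Rightarrow> nat) \<Rightarrow> real^'n \<Rightarrow> real). bs \<in> I \<Longrightarrow> gauss_integrable f \<Longrightarrow>
    reduces_to l f g \<Longrightarrow>
    (\<integral>\<^sup>+z\<in>UNIV \<times> {0<..}. ennreal (snd z powr a * \<bar>G bs f (snd z) (fst z)\<bar>) \<partial>lborel) \<le>
      ennreal (C bs) * besov_sum l k (s - real l) g" by blast
  show ?thesis
  \<comment> \<open>The summand 1 makes the constant strictly positive, as the \<open>C bs\<close>
    are only nonnegative.\<close>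
  proof (intro exI[of _ "1 + (\<Sum>bs\<in>I. C bs)"] conjI allI impI)
    have C0: "(\<Sum>bs\<in>I. C bs) \<ge> 0" by (intro sum_nonneg C)
    then show "0 < 1 + (\<Sum>bs\<in>I. C bs)" by simp
    fix f :: "real^'n \<Rightarrow> real" assume "f \<in> besov (real m - a) 1"
    then have "f \<in> besov s 1" by (simp add: s_def)
    from besov_data[OF s this, folded l_def, folded k_def] obtain f' g where f': "gauss_integrable f'" and ae: "AE x in lborel. f x = f' x"
      and g: "reduces_to l f' g"
      and B: "besov_sum l k (s - real l) g = besov_seminorm s 1 f" by blast
    have f'm: "f' \<in> borel_measurable borel" using f' by (simp add: gauss_integrable_def)
    \<comment> \<open>\<open>f\<close> is merely Lebesgue measurable; its extension coincides with
      that of the Borel representative \<open>f'\<close>, to which the estimates apply.\<close>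
    have ext: "\<forall>t x. t > 0 \<longrightarrow> gauss_ext f (x, t) = heat_conv (\<lambda>_. 0) f' t x"
    proof (intro allI impI)
      fix t :: real and x :: "real^'n" assume t: "t > 0"
      have "gauss_ext f (x, t) = (LINT y|lebesgue. heat (\<lambda>_. 0) t (x - y) * f y)"
        by (simp add: gauss_ext_def gauss_kernel_eq_heat[OF t])
      also have "\<dots> = (LINT y|lebesgue. heat (\<lambda>_. 0) t (x - y) * f' y)"
      proof (rule integral_cong_AE)
        have fl: "f' \<in> borel_measurable lebesgue" by (rule measurable_completion) (use f'm in simp)
        have Kl: "(\<lambda>y. heat (\<lambda>_. 0) t (x - y)) \<in> borel_measurable lebesgue" by (rule measurable_completion) simp
        show "(\<lambda>y. heat (\<lambda>_. 0) t (x - y) * f' y) \<in> borel_measurable lebesgue" using fl Kl by (rule borel_measurable_times[rotated])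
        show "AE y in lebesgue. heat (\<lambda>_. 0) t (x - y) * f y = heat (\<lambda>_. 0) t (x - y) * f' y"
          using AE_completion[OF ae] by eventually_elim simp
        have "f \<in> borel_measurable lebesgue" using \<open>f \<in> besov s 1\<close>
          by (auto simp: besov_def besov_le1_def Wkp_loc_def Lp_loc_def split: if_splits)
        then show "(\<lambda>y. heat (\<lambda>_. 0) t (x - y) * f y) \<in> borel_measurable lebesgue" using Kl by (rule borel_measurable_times[rotated])
      qed
      also have "\<dots> = heat_conv (\<lambda>_. 0) f' t x" unfolding heat_conv_def
        by (rule integral_completion) (use f'm in measurable)
      finally show "gauss_ext f (x, t) = heat_conv (\<lambda>_. 0) f' t x" .
    qed
    have [measurable]: "snd \<in> borel_measurable (borel :: ((real^'n) \<times> real) measure)"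
      by (intro borel_measurable_continuous_onI continuous_intros)
    have [measurable]: "UNIV \<times> {0<..} \<in> sets (borel :: ((real^'n) \<times> real) measure)"
      by (intro borel_open open_Times) auto
    have "(\<integral>\<^sup>+z\<in>UNIV \<times> {0<..}. ennreal (snd z powr a * nabla_norm (m + 1) (gauss_ext f) z) \<partial>lborel) \<le>
       (\<integral>\<^sup>+z. (\<Sum>bs\<in>I. ennreal (snd z powr a * \<bar>G bs f' (snd z) (fst z)\<bar>) * indicator (UNIV \<times> {0<..}) z) \<partial>lborel)"
    proof (rule nn_integral_mono)
      fix z :: "(real^'n) \<times> real"
      show "ennreal (snd z powr a * nabla_norm (m + 1) (gauss_ext f) z) * indicator (UNIV \<times> {0<..}) z \<le>
        (\<Sum>bs\<in>I. ennreal (snd z powr a * \<bar>G bs f' (snd z) (fst z)\<bar>) * indicator (UNIV \<times> {0<..}) z)"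
      proof (cases "snd z > 0")
        case True
        have p: "partials bs (gauss_ext f) z = G bs f' (snd z) (fst z)" if "bs \<in> I" for bs
          using GF[OF that f' ext True, of "fst z"] by simp
        have "nabla_norm (m + 1) (gauss_ext f) z = L2_set (\<lambda>bs. partials bs (gauss_ext f) z) I"
          by (simp add: nabla_norm_def L2_set_def I_def)
        \<comment> \<open>Bounding the Euclidean norm by the sum of absolute values allows each
          entry of the tensor to be estimated separately.\<close>
        also have "\<dots> \<le> (\<Sum>bs\<in>I. \<bar>partials bs (gauss_ext f) z\<bar>)" by (rule L2_set_le_sum_abs)
        also have "\<dots> = (\<Sum>bs\<in>I. \<bar>G bs f' (snd z) (fst z)\<bar>)" by (intro sum.cong) (auto simp: p)
        finally have "snd z powr a * nabla_norm (m + 1) (gauss_ext f) z \<le> (\<Sum>bs\<in>I. snd z powr a * \<bar>G bs f' (snd z) (fst z)\<bar>)"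
          unfolding sum_distrib_left[symmetric] by (intro mult_left_mono) auto
        from ennreal_leI[OF this] have "ennreal (snd z powr a * nabla_norm (m + 1) (gauss_ext f) z) \<le>
           (\<Sum>bs\<in>I. ennreal (snd z powr a * \<bar>G bs f' (snd z) (fst z)\<bar>))"
          by (subst sum_ennreal) auto
        then show ?thesis using True by (cases z) simp
      next
        case False
        then show ?thesis by (cases z) simp
      qed
    qed
    also have "\<dots> = (\<Sum>bs\<in>I. \<integral>\<^sup>+z\<in>UNIV \<times> {0<..}. ennreal (snd z powr a * \<bar>G bs f' (snd z) (fst z)\<bar>) \<partial>lborel)"
    proof (rule nn_integral_sum)
      fix bs assume "bs \<in> I"
      note [measurable] = deriv_rep_measurable[OF G[OF this] f'm]
      show "(\<lambda>z. ennreal (snd z powr a * \<bar>G bs f' (snd z) (fst z)\<bar>) * indicator (UNIV \<times> {0<..}) z) \<in> borel_measurable lborel"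
        by measurable
    qed
    also have "\<dots> \<le> (\<Sum>bs\<in>I. ennreal (C bs) * besov_seminorm s 1 f)"
      unfolding B[symmetric] by (intro sum_mono est f' g)
    also have "\<dots> = ennreal (\<Sum>bs\<in>I. C bs) * besov_seminorm s 1 f"
      unfolding sum_distrib_right[symmetric] using C by (simp add: sum_ennreal)
    also have "\<dots> \<le> ennreal (1 + (\<Sum>bs\<in>I. C bs)) * besov_seminorm (real m - a) 1 f"
      unfolding s_def by (intro mult_right_mono ennreal_leI) auto
    finally show "(\<integral>\<^sup>+z\<in>UNIV \<times> {0<..}. ennreal (snd z powr a * nabla_norm (m + 1) (gauss_ext f) z) \<partial>lborel)
             \<le> ennreal (1 + (\<Sum>bs\<in>I. C bs)) * besov_seminorm (real m - a) 1 f" .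
  qed
qed

end
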